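(* Suppose $f$ satisfies conditions (i)-(vi) of the context with $K=K_n^+$, let $\Omega\subset\mathbb{R}^n$ be a bounded smooth domain, $\sigma\in(0,1)$, and let $u^\epsilon(x,t)$ be an admissible solution of the Dirichlet problem $$u_t=uw(f(\kappa[\Sigma^\epsilon(t)])-\sigma)\ \text{ on }\Omega\times[0,T),\qquad u(x,0)=u_0^\epsilon(x)\ \text{ on }\Omega,\qquad u=\epsilon\ \text{ on }\partial\Omega\times[0,T),$$ where $\Sigma^\epsilon(t)=\{(x,u^\epsilon(x,t)):x\in\Omega\}$ and $\Sigma_0^\epsilon=\{(x,u_0^\epsilon(x)):x\in\Omega\}$. If in addition $$f(\kappa[\Sigma_0^\epsilon])>\sigma,$$ then $$f(\kappa[\Sigma^\epsilon(t)])>\sigma\quad\text{for all }t\in[0,T).$$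
   Context: Half-space model: $\mathbb{H}^{n+1}=\{(x,x_{n+1})\in\mathbb{R}^{n+1}:x_{n+1}>0\}$ with metric $ds^2=x_{n+1}^{-2}\sum_{i=1}^{n+1}dx_i^2$. Let $K=K_n^+=\{\lambda\in\mathbb{R}^n:\lambda_i>0,\ 1\le i\le n\}$. The function $f$ is smooth and symmetric on $K$, continuous up to $\partial K$, and satisfies: (i) $f_i:=\partial f/\partial\lambda_i>0$ in $K$ for all $i$; (ii) $f$ is concave in $K$; (iii) $f>0$ in $K$ and $f=0$ on $\partial K$; (iv) $f(1,\dots,1)=1$; (v) $f$ is homogeneous of degree one; (vi) for some fixed $\epsilon_0>0,\delta_0>0$, $\lim_{R\to+\infty}f(\lambda_1,\dots,\lambda_{n-1},\lambda_n+R)\ge 1+\epsilon_0$ uniformly for $\lambda\in B_{\delta_0}((1,\dots,1))$. For a graph $\Sigma=\{(x,u(x))\}$, $u>0$: $w=\sqrt{1+|Du|^2}$. The hyperbolic principal curvatures $\kappa[\Sigma]$ (with respect to the upward normal) are the eigenvalues of $A[u]=\{a_{ij}\}$, $a_{ij}=\frac1w(\delta_{ij}+u\gamma^{ik}u_{kl}\gamma^{lj})$, $\gamma^{ij}=\delta_{ij}-\frac{u_iu_j}{w(1+w)}$. A solution $u>0$ is called admissible if $\{\delta_{ij}+u_iu_j+uu_{ij}\}$ is positive definite in $\Omega$ for all times $t$. Initial data: $\epsilon>0$ is small and $u_0^\epsilon=u_0+\epsilon$, where $u_0\in C^\infty(\Omega)\cap C^{1+1}(\overline\Omega)$, $u_0>0$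 in $\Omega$, $u_0=0$ on $\partial\Omega$, and the graph of $u_0$ is a complete locally strictly convex hypersurface (all hyperbolic principal curvatures positive). *)

theory Defs
  imports "HOL-Analysis.Analysis"
begin

section \<open>Smoothness and domains\<close>

text \<open>Meant for open \<open>S\<close>, since the derivatives are two-sided.\<close>

primrec Ck_on :: "nat \<Rightarrow> ('a::euclidean_space \<Rightarrow> real) \<Rightarrow> 'a set \<Rightarrow> bool" where
  "Ck_on 0 f S \<longleftrightarrow> continuous_on S f"
| "Ck_on (Suc k) f S \<longleftrightarrow>
     (\<exists>f'. (\<forall>x\<in>S. (f has_derivative f' x) (at x)) \<and> (\<forall>v. Ck_on k (\<lambda>x. f' x v) S))"

definition smooth_on :: "('a::euclidean_space \<Rightarrow> real) \<Rightarrow> 'a set \<Rightarrow> bool" where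
  "smooth_on f S \<longleftrightarrow> (\<forall>k. Ck_on k f S)"

text \<open>The gradient on the open set \<open>S\<close> is the restriction of a Lipschitz field on the closure.\<close>

definition C11_on_closure :: "('a::euclidean_space \<Rightarrow> real) \<Rightarrow> 'a set \<Rightarrow> bool" where
  "C11_on_closure u S \<longleftrightarrow>
     continuous_on (closure S) u \<and>
     (\<exists>g L. L-lipschitz_on (closure S) g \<and>
        (\<forall>x\<in>S. (u has_derivative (\<lambda>h. g x \<bullet> h)) (at x)))"

definition smooth_boundary :: "'a::euclidean_space set \<Rightarrow> bool" where
  "smooth_boundary \<Omega> \<longleftrightarrow>
     (\<forall>p\<in>frontier \<Omega>. \<exists>U \<rho>. open U \<and> p \<in> U \<and> smooth_on \<rho> U \<and>
        (\<forall>x\<in>U. \<exists>v. frechet_derivative \<rho> (at x) v \<noteq> 0) \<and>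
        \<Omega> \<inter> U = {x\<in>U. \<rho> x < 0})"

definition bounded_smooth_domain :: "'a::euclidean_space set \<Rightarrow> bool" where
  "bounded_smooth_domain \<Omega> \<longleftrightarrow>
     open \<Omega> \<and> connected \<Omega> \<and> \<Omega> \<noteq> {} \<and> bounded \<Omega> \<and> smooth_boundary \<Omega>"

section \<open>Curvature functions on the positive cone\<close>

definition pos_cone :: "(real ^ 'n) set" where
  "pos_cone = {l. \<forall>i. l $ i > 0}"

text \<open>
  Only the values of \<open>f\<close> on \<open>closure pos_cone\<close> matter.  In the last condition the
  distinguished coordinate is arbitrary (by symmetry of \<open>f\<close> this is the same as fixing the
  last one); a uniform lower bound \<open>1 + \<epsilon>\<^sub>0\<close> for the limit, which may be infinite, is expressed
  by all \<open>\<eta> > 0\<close>; and the ball is intersected with the cone, where \<open>f\<close> is defined.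
\<close>

definition curvature_function :: "(real ^ 'n \<Rightarrow> real) \<Rightarrow> bool" where
  "curvature_function f \<longleftrightarrow>
     smooth_on f pos_cone \<and>
     (\<forall>l\<in>pos_cone. \<forall>p. bij p \<longrightarrow> f (\<chi> i. l $ p i) = f l) \<and>
     continuous_on (closure pos_cone) f \<and>
     (\<forall>l\<in>pos_cone. \<forall>i. frechet_derivative f (at l) (axis i 1) > 0) \<and>
     concave_on pos_cone f \<and>
     (\<forall>l\<in>pos_cone. f l > 0) \<and> (\<forall>l\<in>frontier pos_cone. f l = 0) \<and>
     f 1 = 1 \<and>
     (\<forall>l\<in>pos_cone. \<forall>c>0. f (c *\<^sub>R l) = c * f l) \<and>
     (\<exists>\<epsilon>\<^sub>0>0. \<exists>\<delta>\<^sub>0>0. \<forall>i. \<forall>\<eta>>0. \<forall>\<^sub>F R in at_top.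
        \<forall>l \<in> ball 1 \<delta>\<^sub>0 \<inter> pos_cone. f (l + R *\<^sub>R axis i 1) \<ge> 1 + \<epsilon>\<^sub>0 - \<eta>)"

section \<open>Graphs in the half-space model\<close>

definition partial_deriv :: "'n \<Rightarrow> (real ^ 'n \<Rightarrow> real) \<Rightarrow> real ^ 'n \<Rightarrow> real" where
  "partial_deriv i u x = frechet_derivative u (at x) (axis i 1)"

definition grad :: "(real ^ 'n \<Rightarrow> real) \<Rightarrow> real ^ 'n \<Rightarrow> real ^ 'n" where
  "grad u x = (\<chi> i. partial_deriv i u x)"

definition hess :: "(real ^ 'n \<Rightarrow> real) \<Rightarrow> real ^ 'n \<Rightarrow> real ^ 'n ^ 'n" where
  "hess u x = (\<chi> i j. partial_deriv j (partial_deriv i u) x)"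

definition graph_w :: "(real ^ 'n \<Rightarrow> real) \<Rightarrow> real ^ 'n \<Rightarrow> real" where
  "graph_w u x = sqrt (1 + (norm (grad u x))\<^sup>2)"

definition graph_gamma :: "(real ^ 'n \<Rightarrow> real) \<Rightarrow> real ^ 'n \<Rightarrow> real ^ 'n ^ 'n" where
  "graph_gamma u x =
     (\<chi> i j. (if i = j then 1 else 0)
        - partial_deriv i u x * partial_deriv j u x / (graph_w u x * (1 + graph_w u x)))"

definition curvature_matrix :: "(real ^ 'n \<Rightarrow> real) \<Rightarrow> real ^ 'n \<Rightarrow> real ^ 'n ^ 'n" where
  "curvature_matrix u x =
     (1 / graph_w u x) *\<^sub>R (mat 1 + u x *\<^sub>R (graph_gamma u x ** hess u x ** graph_gamma u x))"

text \<open>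
  A vector listing the roots of the characteristic polynomial with multiplicity, in an
  unspecified order.  It exists for symmetric matrices; it will only be used through
  permutation-invariant expressions.
\<close>

definition eigenvalue_vector :: "real ^ 'n ^ 'n \<Rightarrow> real ^ 'n" where
  "eigenvalue_vector A = (SOME k. \<forall>z. det (mat z - A) = (\<Prod>i\<in>UNIV. z - k $ i))"

definition principal_curvatures :: "(real ^ 'n \<Rightarrow> real) \<Rightarrow> real ^ 'n \<Rightarrow> real ^ 'n" where
  "principal_curvatures u x = eigenvalue_vector (curvature_matrix u x)"

text \<open>
  The half-space is the part of \<open>(real ^ 'n) \<times> real\<close> with positive second component.
  The induced distance on a connected hypersurface is the infimum of hyperbolic lengths of
  \<open>C\<^sup>1\<close> curves in it.  Such curves may have zero speed, so corners are not excluded, and the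
  integrand below is continuous, so \<open>integral\<close> never takes its default value.
\<close>

definition hyperbolic_length :: "(real \<Rightarrow> (real ^ 'n) \<times> real) \<Rightarrow> real" where
  "hyperbolic_length c = integral {0..1} (\<lambda>s. norm (vector_derivative c (at s)) / snd (c s))"

definition induced_dist ::
    "((real ^ 'n) \<times> real) set \<Rightarrow> (real ^ 'n) \<times> real \<Rightarrow> (real ^ 'n) \<times> real \<Rightarrow> real" where
  "induced_dist S p q =
     Inf {hyperbolic_length c | c. c C1_differentiable_on {0..1} \<and> c ` {0..1} \<subseteq> S \<and>
            c 0 = p \<and> c 1 = q}"

definition graph_over :: "(real ^ 'n) set \<Rightarrow> (real ^ 'n \<Rightarrow> real) \<Rightarrow> ((real ^ 'n) \<times> real) set" where
  "graph_over \<Omega> u = (\<lambda>x. (x, u x)) ` \<Omega>"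

definition complete_hypersurface :: "((real ^ 'n) \<times> real) set \<Rightarrow> bool" where
  "complete_hypersurface S \<longleftrightarrow> Metric_space.mcomplete S (induced_dist S)"

definition initial_graph :: "(real ^ 'n) set \<Rightarrow> (real ^ 'n \<Rightarrow> real) \<Rightarrow> bool" where
  "initial_graph \<Omega> u0 \<longleftrightarrow>
     smooth_on u0 \<Omega> \<and> C11_on_closure u0 \<Omega> \<and>
     (\<forall>x\<in>\<Omega>. u0 x > 0) \<and> (\<forall>x\<in>frontier \<Omega>. u0 x = 0) \<and>
     complete_hypersurface (graph_over \<Omega> u0) \<and>
     (\<forall>x\<in>\<Omega>. \<forall>i. principal_curvatures u0 x $ i > 0)"

section \<open>The flow\<close>

text \<open>The interval \<open>[0,T)\<close>, where \<open>T = \<infinity>\<close> is allowed.\<close>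

definition time_interval :: "ereal \<Rightarrow> real set" where
  "time_interval T = {t. 0 \<le> t \<and> ereal t < T}"

text \<open>
  Classical regularity: continuous up to the boundary, and twice continuously differentiable
  in space and once in time on \<open>\<Omega> \<times> [0,T)\<close> (the time derivative at \<open>0\<close> being one-sided).
\<close>

definition classical_regularity ::
    "(real ^ 'n) set \<Rightarrow> ereal \<Rightarrow> (real ^ 'n \<Rightarrow> real \<Rightarrow> real) \<Rightarrow> bool" where
  "classical_regularity \<Omega> T u \<longleftrightarrow>
     continuous_on (closure \<Omega> \<times> time_interval T) (\<lambda>(x, t). u x t) \<and>
     (\<forall>t\<in>time_interval T. Ck_on 2 (\<lambda>x. u x t) \<Omega>) \<and>
     (\<forall>i. continuous_on (\<Omega> \<times> time_interval T) (\<lambda>(x, t). partial_deriv i (\<lambda>y. u y t) x)) \<and>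
     continuous_on (\<Omega> \<times> time_interval T) (\<lambda>(x, t). hess (\<lambda>y. u y t) x) \<and>
     (\<exists>v. continuous_on (\<Omega> \<times> time_interval T) (\<lambda>(x, t). v x t) \<and>
        (\<forall>x\<in>\<Omega>. \<forall>t\<in>time_interval T. (u x has_real_derivative v x t) (at t within time_interval T)))"

definition pos_definite :: "real ^ 'n ^ 'n \<Rightarrow> bool" where
  "pos_definite A \<longleftrightarrow> transpose A = A \<and> (\<forall>v. v \<noteq> 0 \<longrightarrow> v \<bullet> (A *v v) > 0)"

definition admissible ::
    "(real ^ 'n) set \<Rightarrow> ereal \<Rightarrow> (real ^ 'n \<Rightarrow> real \<Rightarrow> real) \<Rightarrow> bool" where
  "admissible \<Omega> T u \<longleftrightarrow>
     (\<forall>x\<in>\<Omega>. \<forall>t\<in>time_interval T. u x t > 0 \<and>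
        pos_definite (\<chi> i j. (if i = j then 1 else 0)
          + partial_deriv i (\<lambda>y. u y t) x * partial_deriv j (\<lambda>y. u y t) x
          + u x t * hess (\<lambda>y. u y t) x $ i $ j))"

definition flow_solution ::
    "(real ^ 'n \<Rightarrow> real) \<Rightarrow> real \<Rightarrow> (real ^ 'n) set \<Rightarrow> ereal \<Rightarrow>
     (real ^ 'n \<Rightarrow> real) \<Rightarrow> real \<Rightarrow> (real ^ 'n \<Rightarrow> real \<Rightarrow> real) \<Rightarrow> bool" where
  "flow_solution f \<sigma> \<Omega> T u0 \<epsilon> u \<longleftrightarrow>
     classical_regularity \<Omega> T u \<and>
     (\<forall>x\<in>\<Omega>. \<forall>t\<in>time_interval T.
        (u x has_real_derivative
           u x t * graph_w (\<lambda>y. u y t) x * (f (principal_curvatures (\<lambda>y. u y t) x) - \<sigma>))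
          (at t within time_interval T)) \<and>
     (\<forall>x\<in>\<Omega>. u x 0 = u0 x + \<epsilon>) \<and>
     (\<forall>x\<in>frontier \<Omega>. \<forall>t\<in>time_interval T. u x t = \<epsilon>)"

end

theory Submission
  imports Defs
begin

text \<open>
  The flow equation reads \<open>u\<^sub>t = u w (f(\<kappa>) - \<sigma>)\<close> with \<open>u w > 0\<close>, so the claim is that \<open>u\<^sub>t\<close>, which is
  positive initially, stays positive. Formally \<open>u\<^sub>t\<close> solves the linearised parabolic equation and the
  strong maximum principle applies; but solutions are only \<open>C\<^sup>2\<close> in space and \<open>C\<^sup>1\<close> in time, and their second
  derivatives are not controlled near the boundary. The argument therefore compares \<open>u\<close> with its own
  translates in time and never differentiates the equation.

  \<^emph>\<open>The operator.\<close> Homogeneity of \<open>f\<close> gives \<open>w f(\<kappa>) = F(N)\<close> with \<open>N = I + u \<gamma> D\<^sup>2u \<gamma>\<close>, where \<open>F\<close> is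
  the symmetric function \<open>f\<close> of the eigenvalues. Weyl's monotonicity principle makes \<open>F\<close> monotone on
  positive definite matrices, homogeneity controls small perturbations multiplicatively, and trace
  considerations with concavity of \<open>f\<close> show that a rank-one increase of \<open>N\<close> raises \<open>F\<close> by a
  comparable amount (\<open>spectral_value_rank_one_gain\<close>).

  \<^emph>\<open>A priori bounds.\<close> At an interior minimum the graph is horizontal and convex and moves up, hence
  \<open>u \<ge> \<epsilon>\<close>. Admissibility says that \<open>|x|\<^sup>2 + u\<^sup>2\<close> is locally convex; following rays to the boundary,
  where \<open>u\<close> attains its minimum \<open>\<epsilon>\<close>, bounds \<open>|Du|\<close> on all of \<open>\<Omega>\<close> (\<open>u_gradient_bound\<close>).

  \<^emph>\<open>Weak monotonicity\<close> (\<open>u_mono\<close>). Suppose \<open>exp (- \<Lambda> t) (u(x,s) - u(x,t))\<close> has a positive maximum over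
  \<open>x\<close> and \<open>s \<le> t\<close>. Maximality in \<open>s\<close> gives \<open>u\<^sub>t(x,s) \<ge> 0\<close>. The two graphs have the same gradient at \<open>x\<close>
  and ordered Hessians, so \<open>F\<close> at the lower graph is at least \<open>u(x,t) / u(x,s)\<close> times \<open>F\<close> at the
  higher one, and \<open>u\<^sub>t(x,t) \<ge> - \<sigma> w (u(x,s) - u(x,t))\<close>. Maximality in \<open>t\<close> contradicts this as soon as
  \<open>\<Lambda> > \<sigma> w\<close>, which the gradient bound allows.

  \<^emph>\<open>Strict monotonicity\<close> (\<open>u_speed_pos\<close>). On a ball of radius \<open>r\<close> around \<open>x0\<close> let
  \<open>q = r\<^sup>2 - |x - x0|\<^sup>2\<close>. The increment \<open>u(x, t + k) - u(x, t)\<close> stays above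
  \<open>k \<delta> exp (- \<Lambda> t) q\<^sup>2\<close> with \<open>\<delta>\<close> independent of \<open>k\<close>: initially because \<open>u\<^sub>t > 0\<close> at time \<open>0\<close>, on the edge
  of the ball by weak monotonicity, and inside because adding this function to \<open>u\<close> gives a strict subsolution
  (\<open>speed_barrier_gain\<close>). Dividing by \<open>k\<close> and letting \<open>k\<close> tend to \<open>0\<close> yields \<open>u\<^sub>t > 0\<close> at \<open>x0\<close>.
\<close>

section \<open>Spectral theory of symmetric matrices\<close>

lemma symmetric_inner:
  fixes A :: "real^'n^'n"
  assumes "transpose A = A"
  shows "x \<bullet> (A *v y) = (A *v x) \<bullet> y"
  by (metis assms dot_lmul_matrix vector_transpose_matrix)

text \<open>A maximiser \<open>e\<close> of the Rayleigh quotient, with maximum \<open>c\<close>, is an eigenvector because the first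
  variation of \<open>x \<bullet> A x - c (x \<bullet> x)\<close> at \<open>e\<close> in the direction of the defect \<open>A e - c e\<close> is twice the
  squared norm of the defect.\<close>

lemma rayleigh_eigenvector:
  fixes A :: "real^'n^'n"
  assumes sym: "transpose A = A" and S: "subspace S" and inv: "\<And>x. x \<in> S \<Longrightarrow> A *v x \<in> S"
    and ne: "y0 \<in> S" "y0 \<noteq> 0"
  obtains e c where "e \<in> S" "norm e = 1" "A *v e = c *\<^sub>R e"
proof -
  have "compact (S \<inter> sphere 0 1)"
    by (simp add: S closed_subspace closed_Int_compact)
  moreover have "(1 / norm y0) *\<^sub>R y0 \<in> S \<inter> sphere 0 1"
    using ne S by (simp add: subspace_scale)
  hence "S \<inter> sphere 0 1 \<noteq> {}" by blast
  moreover have "continuous_on (S \<inter> sphere 0 1) (\<lambda>x. x \<bullet> (A *v x))"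
    by (intro continuous_intros)
  ultimately obtain e where e: "e \<in> S \<inter> sphere 0 1"
    and max: "\<And>y. y \<in> S \<inter> sphere 0 1 \<Longrightarrow> y \<bullet> (A *v y) \<le> e \<bullet> (A *v e)"
    using continuous_attains_sup[of "S \<inter> sphere 0 1" "\<lambda>x. x \<bullet> (A *v x)"] by blast
  define c where "c = e \<bullet> (A *v e)"
  have ee: "e \<bullet> e = 1" using e by (simp add: dot_square_norm)
  have le: "y \<bullet> (A *v y) \<le> c * (y \<bullet> y)" if "y \<in> S" for y
  proof (cases "y = 0")
    case False
    define z where "z = (1 / norm y) *\<^sub>R y"
    have "z \<in> S \<inter> sphere 0 1" using False that S by (simp add: z_def subspace_scale)
    from max[OF this] have "z \<bullet> (A *v z) \<le> c" by (simp add: c_def)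
    moreover have "z \<bullet> (A *v z) = (y \<bullet> (A *v y)) / (y \<bullet> y)"
      by (simp add: z_def matrix_vector_mult_scaleR dot_square_norm power2_eq_square)
    ultimately show ?thesis using False by (simp add: pos_divide_le_eq)
  qed simp
  define d where "d = A *v e - c *\<^sub>R e"
  have dS: "d \<in> S" using e inv S by (simp add: d_def subspace_diff subspace_scale)
  have dd: "d \<bullet> (A *v e) - c * (d \<bullet> e) = d \<bullet> d"
  proof -
    have "d \<bullet> d = d \<bullet> (A *v e - c *\<^sub>R e)" by (simp only: d_def)
    thus ?thesis by (simp add: inner_diff_right)
  qed
  define B where "B = c * (d \<bullet> d) - d \<bullet> (A *v d)"
  have B: "B \<ge> 0" using le[OF dS] by (simp add: B_def)
  have quad: "2 * t * (d \<bullet> d) \<le> t\<^sup>2 * B" for t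
  proof -
    have "e + t *\<^sub>R d \<in> S" using e dS S by (simp add: subspace_add subspace_scale)
    note le = le[OF this]
    have ed: "e \<bullet> (A *v d) = d \<bullet> (A *v e)"
      using symmetric_inner[OF sym, of e d] by (simp add: inner_commute)
    have q1: "(e + t *\<^sub>R d) \<bullet> (A *v (e + t *\<^sub>R d))
        = c + 2 * t * (d \<bullet> (A *v e)) + t\<^sup>2 * (d \<bullet> (A *v d))"
      by (simp add: matrix_vector_right_distrib matrix_vector_mult_scaleR inner_add_left
          inner_add_right c_def ed distrib_left power2_eq_square)
    have q2: "(e + t *\<^sub>R d) \<bullet> (e + t *\<^sub>R d) = 1 + 2 * t * (d \<bullet> e) + t\<^sup>2 * (d \<bullet> d)"
      by (simp add: inner_add_left inner_add_right ee distrib_left inner_commute[of e d]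
          power2_eq_square)
    from le have "c + 2 * t * (d \<bullet> (A *v e)) + t\<^sup>2 * (d \<bullet> (A *v d))
        \<le> c * (1 + 2 * t * (d \<bullet> e) + t\<^sup>2 * (d \<bullet> d))"
      unfolding q1 q2 .
    hence "2 * t * (d \<bullet> (A *v e) - c * (d \<bullet> e)) \<le> t\<^sup>2 * B"
      by (simp add: B_def algebra_simps)
    thus ?thesis by (simp add: dd)
  qed
  have "d = 0"
  proof (rule ccontr)
    assume "d \<noteq> 0"
    hence dpos: "d \<bullet> d > 0" by simp
    \<comment> \<open>A step so short that the linear term of the variation beats the quadratic one.\<close>
    define t where "t = (d \<bullet> d) / (B + 1)"
    have t: "t > 0" using dpos B by (simp add: t_def)
    have "2 * t * (d \<bullet> d) \<le> t * (t * B)" using quad[of t] by (simp add: power2_eq_square algebra_simps)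
    hence "2 * (d \<bullet> d) \<le> t * B" using t by (simp add: mult.assoc)
    also have "t * B \<le> d \<bullet> d" using B dpos by (simp add: t_def field_simps)
    finally show False using dpos by simp
  qed
  hence "A *v e = c *\<^sub>R e" by (simp add: d_def)
  thus ?thesis using that e by auto
qed

definition orthonormal_family :: "('n \<Rightarrow> real^'n) \<Rightarrow> bool" where
  "orthonormal_family a \<longleftrightarrow> (\<forall>i j. a i \<bullet> a j = (if i = j then 1 else 0))"

text \<open>An orthonormal set of eigenvectors of maximal size spans the space: its orthogonal complement is
  invariant, and if it were nontrivial it would contain one more eigenvector.\<close>

theorem symmetric_orthonormal_eigenbasis:
  fixes A :: "real^'n^'n"
  assumes sym: "transpose A = A"
  shows "\<exists>a l. orthonormal_family a \<and> (\<forall>i. A *v a i = l i *\<^sub>R a i)"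
proof -
  define P where "P B \<longleftrightarrow> pairwise orthogonal B \<and> (\<forall>b\<in>B. norm b = 1 \<and> (\<exists>c. A *v b = c *\<^sub>R b))"
    for B :: "(real^'n) set"
  have indep: "independent B" if "P B" for B
    using that unfolding P_def by (intro pairwise_orthogonal_independent) auto
  have bound: "card B \<le> CARD('n)" "finite B" if "P B" for B
    using independent_bound[OF indep[OF that]] by simp_all
  have "P {}" by (simp add: P_def)
  obtain B where B: "P B" and max: "\<And>C. P C \<Longrightarrow> card C \<le> card B"
  proof -
    have "\<exists>B. P B \<and> (\<forall>C. P C \<longrightarrow> card C \<le> card B)"
      using bound(1) by (intro ex_has_greatest_nat[of P "{}" card "Suc CARD('n)"]) (auto simp: less_Suc_eq_le \<open>P {}\<close>)
    thus ?thesis using that by blast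
  qed
  have card: "card B = CARD('n)"
  proof (rule ccontr)
    assume "card B \<noteq> CARD('n)"
    with bound[OF B] have "card B < CARD('n)" by simp
    hence "dim B < DIM(real^'n)" using indep[OF B] by (simp add: dim_eq_card_independent)
    then obtain x where x: "x \<noteq> 0" "\<And>y. y \<in> span B \<Longrightarrow> orthogonal x y"
      using orthogonal_to_subspace_exists by blast
    define S where "S = {x. \<forall>b\<in>B. orthogonal b x}"
    have S: "subspace S"
      by (auto simp: S_def subspace_def orthogonal_def inner_simps)
    have inv: "A *v y \<in> S" if "y \<in> S" for y
    proof -
      have "b \<bullet> (A *v y) = 0" if b: "b \<in> B" for b
      proof -
        obtain c where "A *v b = c *\<^sub>R b" using B b by (auto simp: P_def)
        thus ?thesis using \<open>y \<in> S\<close> b by (simp add: symmetric_inner[OF sym] S_def orthogonal_def)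
      qed
      thus ?thesis by (simp add: S_def orthogonal_def)
    qed
    have "x \<in> S" using x(2) by (auto simp: S_def span_base orthogonal_commute)
    then obtain e c where e: "e \<in> S" "norm e = 1" "A *v e = c *\<^sub>R e"
      using rayleigh_eigenvector[OF sym S inv _ x(1)] by blast
    have "e \<notin> B"
    proof
      assume "e \<in> B"
      hence "e \<bullet> e = 0" using e(1) by (auto simp: S_def orthogonal_def)
      thus False using e(2) by simp
    qed
    moreover have "P (insert e B)"
      using B e by (auto simp: P_def pairwise_insert S_def orthogonal_commute)
    ultimately show False using max[of "insert e B"] bound(2)[OF B] by simp
  qed
  then obtain a where a: "bij_betw a (UNIV::'n set) B"
    using bound(2)[OF B] by (metis finite_same_card_bij finite_class.finite_UNIV)
  have "orthonormal_family a"
    unfolding orthonormal_family_def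
  proof (intro allI)
    fix i j
    have aB: "a i \<in> B" "a j \<in> B" using a by (auto simp: bij_betw_def)
    show "a i \<bullet> a j = (if i = j then 1 else 0)"
    proof (cases "i = j")
      case True
      thus ?thesis using aB B by (auto simp: P_def norm_eq_1)
    next
      case False
      hence "a i \<noteq> a j" using a by (auto simp: bij_betw_def inj_on_def)
      thus ?thesis using False aB B by (auto simp: P_def pairwise_def orthogonal_def)
    qed
  qed
  moreover have "\<forall>i. \<exists>c. A *v a i = c *\<^sub>R a i"
    using a B by (auto simp: P_def bij_betw_def)
  ultimately show ?thesis by metis
qed

context
  fixes A :: "real^'n^'n" and a :: "'n \<Rightarrow> real^'n" and l :: "'n \<Rightarrow> real"
  assumes on: "orthonormal_family a" and eig: "\<And>i. A *v a i = l i *\<^sub>R a i"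
begin

private definition Q :: "real^'n^'n" where "Q = (\<chi> i j. a j $ i)"
private definition D :: "real^'n^'n" where "D = (\<chi> i j. if i = j then l i else 0)"

private lemma QtQ: "transpose Q ** Q = mat 1"
  using on by (simp add: orthonormal_family_def Q_def transpose_def matrix_matrix_mult_def mat_def
      vec_eq_iff inner_vec_def)

private lemma QQt: "Q ** transpose Q = mat 1"
  using QtQ matrix_left_right_inverse by blast

private lemma AQ: "A ** Q = Q ** D"
proof -
  have "(A ** Q) $ i $ j = (Q ** D) $ i $ j" for i j
  proof -
    have "(A ** Q) $ i $ j = (A *v a j) $ i"
      by (simp add: Q_def matrix_matrix_mult_def matrix_vector_mult_def)
    also have "\<dots> = a j $ i * l j" by (simp add: eig)
    also have "\<dots> = (Q ** D) $ i $ j"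
      by (simp add: matrix_matrix_mult_def Q_def D_def if_distrib cong: if_cong)
    finally show ?thesis .
  qed
  thus ?thesis by (simp add: vec_eq_iff)
qed

lemma det_mat_minus_eigenbasis: "det (mat z - A) = (\<Prod>i\<in>UNIV. z - l i)"
proof -
  have "(mat z - A) ** Q = Q ** (mat z - D)"
  proof -
    have "mat z ** Q = Q ** mat z"
      by (simp add: vec_eq_iff matrix_matrix_mult_def mat_def if_distrib if_distribR cong: if_cong)
    moreover have "(mat z - A) ** Q = mat z ** Q - A ** Q" "Q ** (mat z - D) = Q ** mat z - Q ** D"
      by (simp_all add: vec_eq_iff matrix_matrix_mult_def sum_subtractf algebra_simps)
    ultimately show ?thesis by (simp add: AQ)
  qed
  hence "det (mat z - A) * det Q = det Q * det (mat z - D)" by (metis det_mul)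
  moreover have "det Q \<noteq> 0" using QtQ by (metis det_I det_mul mult_zero_right zero_neq_one)
  moreover have "det (mat z - D) = (\<Prod>i\<in>UNIV. z - l i)"
    by (subst det_diagonal) (auto simp: D_def mat_def)
  ultimately show ?thesis by simp
qed

lemma trace_eigenbasis: "trace A = (\<Sum>i\<in>UNIV. l i)"
proof -
  have "trace A = trace (A ** (Q ** transpose Q))" by (simp add: QQt)
  also have "\<dots> = trace ((Q ** D) ** transpose Q)" by (simp add: matrix_mul_assoc AQ)
  also have "\<dots> = trace (transpose Q ** (Q ** D))" by (rule trace_mul_sym)
  also have "\<dots> = trace D" by (simp add: matrix_mul_assoc QtQ)
  finally show ?thesis by (simp add: trace_def D_def)
qed

end

lemma prod_linear_factors_unique:
  fixes a b :: "'n::finite \<Rightarrow> real"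
  assumes "\<And>z. (\<Prod>i\<in>UNIV. z - a i) = (\<Prod>i\<in>UNIV. z - b i)"
  obtains p where "bij p" "\<And>i. a i = b (p i)"
proof -
  have roots: "proots (\<Prod>i\<in>UNIV. [:- c i, 1:]) = image_mset c (mset_set UNIV)" for c :: "'n \<Rightarrow> real"
    by (subst proots_prod) (auto simp: sum_unfold_sum_mset)
  have "(\<Prod>i\<in>UNIV. [:- a i, 1:]) = (\<Prod>i\<in>UNIV. [:- b i, 1:])"
    unfolding poly_eq_poly_eq_iff[symmetric] using assms by (auto simp: fun_eq_iff poly_prod)
  hence "image_mset a (mset_set UNIV) = image_mset b (mset_set UNIV)"
    using roots by metis
  then obtain p where "p permutes UNIV" "\<forall>x\<in>UNIV. a x = b (p x)"
    using image_mset_eq_implies_permutes[of UNIV a b] by auto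
  thus ?thesis using that[of p] permutes_bij by auto
qed

text \<open>\<open>eigenvalue_vector\<close> is an arbitrary choice among the orderings of the spectrum; any diagonalisation
  recovers it up to a permutation, which a symmetric function does not see.\<close>

theorem eigenvalue_vector_unique:
  fixes A :: "real^'n^'n"
  assumes "orthonormal_family a" and "\<And>i. A *v a i = l i *\<^sub>R a i"
  obtains p where "bij p" "\<And>i. eigenvalue_vector A $ i = l (p i)"
proof -
  have d: "det (mat z - A) = (\<Prod>i\<in>UNIV. z - (\<chi> i. l i) $ i)" for z
    using det_mat_minus_eigenbasis[OF assms] by simp
  have "\<forall>z. det (mat z - A) = (\<Prod>i\<in>UNIV. z - eigenvalue_vector A $ i)"
    unfolding eigenvalue_vector_def by (rule someI_ex) (use d in blast)
  hence "(\<Prod>i\<in>UNIV. z - eigenvalue_vector A $ i) = (\<Prod>i\<in>UNIV. z - l i)" for z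
    using d by simp
  thus ?thesis using prod_linear_factors_unique that by metis
qed

lemma eigenvalue_vector_eigenbasis:
  fixes A :: "real^'n^'n"
  assumes "transpose A = A"
  obtains a where "orthonormal_family a" "\<And>i. A *v a i = eigenvalue_vector A $ i *\<^sub>R a i"
proof -
  obtain b l where b: "orthonormal_family b" and l: "\<And>i. A *v b i = l i *\<^sub>R b i"
    using symmetric_orthonormal_eigenbasis[OF assms] by blast
  obtain p where p: "bij p" "\<And>i. eigenvalue_vector A $ i = l (p i)"
    using eigenvalue_vector_unique[OF b l] by blast
  have "orthonormal_family (b \<circ> p)"
    using b p(1) by (auto simp: orthonormal_family_def bij_def inj_eq)
  thus ?thesis using that[of "b \<circ> p"] l p(2) by auto
qed

lemma trace_eq_sum_eigenvalue_vector:
  fixes A :: "real^'n^'n"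
  assumes "transpose A = A"
  shows "trace A = (\<Sum>i\<in>UNIV. eigenvalue_vector A $ i)"
  using eigenvalue_vector_eigenbasis[OF assms] trace_eigenbasis by metis

lemma eigenvalue_vector_bounds:
  fixes A :: "real^'n^'n"
  assumes "transpose A = A"
  shows "(\<And>y. c * (y \<bullet> y) \<le> y \<bullet> (A *v y)) \<Longrightarrow> c \<le> eigenvalue_vector A $ i"
    and "(\<And>y. y \<bullet> (A *v y) \<le> c * (y \<bullet> y)) \<Longrightarrow> eigenvalue_vector A $ i \<le> c"
proof -
  obtain a where a: "orthonormal_family a" "\<And>i. A *v a i = eigenvalue_vector A $ i *\<^sub>R a i"
    using eigenvalue_vector_eigenbasis[OF assms] by blast
  have "a i \<bullet> a i = 1" "a i \<bullet> (A *v a i) = eigenvalue_vector A $ i"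
    using a by (simp_all add: orthonormal_family_def)
  thus "(\<And>y. c * (y \<bullet> y) \<le> y \<bullet> (A *v y)) \<Longrightarrow> c \<le> eigenvalue_vector A $ i"
    and "(\<And>y. y \<bullet> (A *v y) \<le> c * (y \<bullet> y)) \<Longrightarrow> eigenvalue_vector A $ i \<le> c"
    by (metis mult.right_neutral)+
qed

section \<open>Monotonicity of eigenvalues\<close>

text \<open>Greedy matching: the counting hypothesis at the level of the largest \<open>l i\<close> shows that the largest
  \<open>m j\<close> dominates it, and removing this pair preserves the hypothesis.\<close>

lemma bij_betw_of_count_le:
  fixes l :: "'a \<Rightarrow> real" and m :: "'b \<Rightarrow> real"
  assumes "finite S" "finite S'" "card S = card S'"
    and "\<And>c. card {i\<in>S. c \<le> l i} \<le> card {j\<in>S'. c \<le> m j}"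
  shows "\<exists>p. bij_betw p S S' \<and> (\<forall>i\<in>S. l i \<le> m (p i))"
  using assms
proof (induction "card S" arbitrary: S S')
  case 0
  thus ?case by (auto simp: bij_betw_def)
next
  case (Suc n)
  have fin: "finite S" "finite S'" "S \<noteq> {}" "S' \<noteq> {}" using Suc by auto
  obtain i where i: "i \<in> S" "\<And>k. k \<in> S \<Longrightarrow> l k \<le> l i"
  proof -
    have "Max (l ` S) \<in> l ` S" using fin by (intro Max_in) auto
    then obtain i where "i \<in> S" "Max (l ` S) = l i" by auto
    thus ?thesis using that fin by (metis Max_ge finite_imageI imageI)
  qed
  obtain j where j: "j \<in> S'" "\<And>k. k \<in> S' \<Longrightarrow> m k \<le> m j"
  proof -
    have "Max (m ` S') \<in> m ` S'" using fin by (intro Max_in) auto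
    then obtain j where "j \<in> S'" "Max (m ` S') = m j" by auto
    thus ?thesis using that fin by (metis Max_ge finite_imageI imageI)
  qed
  have "card {k\<in>S. l i \<le> l k} > 0" using i fin by (auto simp: card_gt_0_iff)
  hence "card {k\<in>S'. l i \<le> m k} > 0" using Suc.prems(4)[of "l i"] by linarith
  then obtain k where "k \<in> S'" "l i \<le> m k" by (auto simp: card_gt_0_iff)
  hence lm: "l i \<le> m j" using j(2) by force
  have "card {k\<in>S-{i}. c \<le> l k} \<le> card {k\<in>S'-{j}. c \<le> m k}" for c
  proof (cases "c \<le> l i")
    case True
    have "{k\<in>S. c \<le> l k} = insert i {k\<in>S-{i}. c \<le> l k}" using True i by auto
    moreover have "{k\<in>S'. c \<le> m k} = insert j {k\<in>S'-{j}. c \<le> m k}" using True lm j by auto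
    ultimately show ?thesis using Suc.prems(4)[of c] fin by simp
  next
    case False
    hence "{k\<in>S-{i}. c \<le> l k} = {}" using i(2) by force
    thus ?thesis by (metis card.empty le0)
  qed
  moreover have "n = card (S - {i})" "card (S - {i}) = card (S' - {j})"
    using Suc.hyps Suc.prems i j by simp_all
  ultimately obtain p where p: "bij_betw p (S - {i}) (S' - {j})" "\<forall>k\<in>S-{i}. l k \<le> m (p k)"
    using Suc.hyps(1)[of "S - {i}" "S' - {j}"] fin by auto
  have "bij_betw (p(i := j)) S S'"
  proof -
    have "bij_betw (p(i := j)) (S - {i}) (S' - {j})"
      using p(1) by (rule bij_betw_cong[THEN iffD1, rotated]) auto
    hence "bij_betw (p(i := j)) (insert i (S - {i})) (insert ((p(i := j)) i) (S' - {j}))"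
      by (subst (asm) notIn_Un_bij_betw3[of i _ "p(i:=j)" "S' - {j}"]) auto
    thus ?thesis using i(1) j(1) by (simp add: insert_absorb)
  qed
  thus ?case using p(2) lm by (intro exI[of _ "p(i := j)"]) auto
qed

lemma orthonormal_family_span:
  fixes a :: "'n \<Rightarrow> real^'n"
  assumes on: "orthonormal_family a"
  shows "dim (span (a ` I)) = card I"
    and "y \<in> span (a ` I) \<Longrightarrow> \<exists>c. y = (\<Sum>i\<in>I. c i *\<^sub>R a i)"
proof -
  have inj: "inj_on a I"
    using on unfolding orthonormal_family_def inj_on_def by (metis zero_neq_one)
  have "pairwise orthogonal (a ` I)"
    using on by (auto simp: pairwise_def orthogonal_def orthonormal_family_def)
  moreover have "0 \<notin> a ` I" 
  proof
    assume "0 \<in> a ` I"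
    then obtain i where "a i = 0" by auto
    thus False using on unfolding orthonormal_family_def by (metis inner_zero_left zero_neq_one)
  qed
  ultimately have "independent (a ` I)" by (rule pairwise_orthogonal_independent)
  thus "dim (span (a ` I)) = card I"
    by (simp add: dim_eq_card_independent card_image[OF inj])
  assume "y \<in> span (a ` I)"
  then obtain u where "y = (\<Sum>v\<in>a ` I. u v *\<^sub>R v)" 
    by (auto simp: span_finite)
  also have "\<dots> = (\<Sum>i\<in>I. u (a i) *\<^sub>R a i)" by (simp add: sum.reindex[OF inj])
  finally show "\<exists>c. y = (\<Sum>i\<in>I. c i *\<^sub>R a i)" by (intro exI[of _ "\<lambda>i. u (a i)"])
qed

lemma orthonormal_family_quadratic_form:
  fixes a :: "'n \<Rightarrow> real^'n" and A :: "real^'n^'n" and I :: "'n set"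
  assumes on: "orthonormal_family a" and eig: "\<And>i. A *v a i = l i *\<^sub>R a i"
  defines "y \<equiv> \<lambda>c. (\<Sum>i\<in>I. c i *\<^sub>R a i)"
  shows "y c \<bullet> y c = (\<Sum>i\<in>I. (c i)\<^sup>2)" and "y c \<bullet> (A *v y c) = (\<Sum>i\<in>I. l i * (c i)\<^sup>2)"
proof -
  have gen: "(\<Sum>i\<in>I. c i *\<^sub>R a i) \<bullet> (\<Sum>i\<in>I. d i *\<^sub>R a i) = (\<Sum>i\<in>I. c i * d i)" for c d
  proof -
    have "(\<Sum>i\<in>I. c i *\<^sub>R a i) \<bullet> (\<Sum>i\<in>I. d i *\<^sub>R a i) = (\<Sum>i\<in>I. \<Sum>j\<in>I. c i * d j * (a i \<bullet> a j))"
      by (simp add: inner_sum_left inner_sum_right sum_distrib_left algebra_simps) (rule sum.swap)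
    also have "\<dots> = (\<Sum>i\<in>I. \<Sum>j\<in>I. if i = j then c i * d j else 0)"
      using on by (intro sum.cong) (auto simp: orthonormal_family_def)
    also have "\<dots> = (\<Sum>i\<in>I. c i * d i)" by simp
    finally show ?thesis .
  qed
  show "y c \<bullet> y c = (\<Sum>i\<in>I. (c i)\<^sup>2)" by (simp add: y_def gen power2_eq_square)
  have "A *v y c = (\<Sum>i\<in>I. A *v (c i *\<^sub>R a i))"
    unfolding y_def by (rule linear_sum[OF matrix_vector_mul_linear])
  also have "\<dots> = (\<Sum>i\<in>I. (c i * l i) *\<^sub>R a i)" by (simp add: matrix_vector_mult_scaleR eig)
  finally show "y c \<bullet> (A *v y c) = (\<Sum>i\<in>I. l i * (c i)\<^sup>2)"
    by (simp add: y_def gen power2_eq_square algebra_simps)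
qed

text \<open>Weyl's monotonicity principle, by counting: the span of the eigenvectors of \<open>A\<close> with
  eigenvalue at least \<open>c\<close> meets the span of those of \<open>B\<close> with eigenvalue below \<open>c\<close> only in \<open>0\<close>,
  so \<open>B\<close> has at least as many eigenvalues in \<open>[c, \<infinity>)\<close> as \<open>A\<close>.\<close>

theorem eigenvalue_vector_mono:
  fixes A B :: "real^'n^'n"
  assumes symA: "transpose A = A" and symB: "transpose B = B"
    and le: "\<And>y. y \<bullet> (A *v y) \<le> y \<bullet> (B *v y)"
  obtains p where "bij p" "\<And>i. eigenvalue_vector A $ i \<le> eigenvalue_vector B $ p i"
proof -
  define l where "l i = eigenvalue_vector A $ i" for i
  define m where "m i = eigenvalue_vector B $ i" for i
  obtain a where a: "orthonormal_family a" "\<And>i. A *v a i = l i *\<^sub>R a i"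
    using eigenvalue_vector_eigenbasis[OF symA] unfolding l_def by blast
  obtain b where b: "orthonormal_family b" "\<And>i. B *v b i = m i *\<^sub>R b i"
    using eigenvalue_vector_eigenbasis[OF symB] unfolding m_def by blast
  have "card {i\<in>UNIV. c \<le> l i} \<le> card {j\<in>UNIV. c \<le> m j}" for c
  proof -
    let ?I = "{i. c \<le> l i}" and ?J = "{j. m j < c}"
    let ?V = "span (a ` ?I)" and ?W = "span (b ` ?J)"
    have "?V \<inter> ?W \<subseteq> {0}"
    proof
      fix y assume y: "y \<in> ?V \<inter> ?W"
      obtain s where s: "y = (\<Sum>i\<in>?I. s i *\<^sub>R a i)" using orthonormal_family_span(2)[OF a(1)] y by blast
      obtain t where t: "y = (\<Sum>i\<in>?J. t i *\<^sub>R b i)" using orthonormal_family_span(2)[OF b(1)] y by blast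
      have "c * (y \<bullet> y) \<le> y \<bullet> (A *v y)"
        unfolding s orthonormal_family_quadratic_form[OF a] sum_distrib_left
        by (intro sum_mono mult_right_mono) auto
      also have "\<dots> \<le> y \<bullet> (B *v y)" by (rule le)
      finally have "c * (\<Sum>i\<in>?J. (t i)\<^sup>2) \<le> (\<Sum>i\<in>?J. m i * (t i)\<^sup>2)"
        unfolding t orthonormal_family_quadratic_form[OF b] .
      hence "(\<Sum>i\<in>?J. (c - m i) * (t i)\<^sup>2) \<le> 0"
        by (simp add: sum_distrib_left left_diff_distrib sum_subtractf)
      moreover have nn: "(c - m i) * (t i)\<^sup>2 \<ge> 0" if "i \<in> ?J" for i
        using that by auto
      ultimately have "(\<Sum>i\<in>?J. (c - m i) * (t i)\<^sup>2) = 0"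
        by (meson antisym sum_nonneg)
      hence "\<forall>i\<in>?J. (c - m i) * (t i)\<^sup>2 = 0"
        using nn by (subst (asm) sum_nonneg_eq_0_iff) auto
      hence "\<forall>i\<in>?J. t i = 0" by auto
      thus "y \<in> {0}" by (simp add: t)
    qed
    hence "dim (?V \<inter> ?W) = 0" by simp
    moreover have "dim {x + y |x y. x \<in> ?V \<and> y \<in> ?W} + dim (?V \<inter> ?W) = dim ?V + dim ?W"
      by (rule dim_sums_Int) (auto intro: subspace_span)
    moreover have "dim {x + y |x y. x \<in> ?V \<and> y \<in> ?W} \<le> CARD('n)"
      using dim_subset_UNIV[of "{x + y |x y. x \<in> ?V \<and> y \<in> ?W}"] by simp
    ultimately have "card ?I + card ?J \<le> CARD('n)"
      unfolding orthonormal_family_span(1)[OF a(1)] orthonormal_family_span(1)[OF b(1)] by linarith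
    moreover have "card {j. c \<le> m j} + card ?J = CARD('n)"
    proof -
      have "{j. c \<le> m j} \<union> ?J = UNIV" "{j. c \<le> m j} \<inter> ?J = {}" by auto
      thus ?thesis by (metis card_Un_disjoint finite)
    qed
    ultimately show ?thesis by simp
  qed
  then obtain p where "bij_betw p UNIV UNIV" "\<forall>i\<in>UNIV. l i \<le> m (p i)"
    using bij_betw_of_count_le[of UNIV UNIV l m] by auto
  thus ?thesis using that by (auto simp: l_def m_def)
qed

section \<open>Curvature functions of matrices\<close>

text \<open>A curvature function increases along every direction of the closed positive cone, because its
  derivative there is a nonnegative combination of the positive partial derivatives.\<close>

lemma curvature_function_deriv_along_line:
  fixes f :: "real^'n \<Rightarrow> real"
  assumes f: "curvature_function f" and l: "l \<in> pos_cone" and d: "\<And>i. 0 \<le> d $ i" and "0 \<le> s"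
  shows "\<exists>D \<ge> 0. (d \<noteq> 0 \<longrightarrow> D > 0) \<and> ((\<lambda>s. f (l + s *\<^sub>R d)) has_real_derivative D) (at s)"
proof -
  let ?x = "l + s *\<^sub>R d"
  have x: "?x \<in> pos_cone"
    using l d \<open>0 \<le> s\<close> by (auto simp: pos_cone_def add_pos_nonneg)
  have "Ck_on 1 f pos_cone" using f by (simp add: curvature_function_def smooth_on_def)
  hence "f differentiable (at ?x)" using x by (auto simp: differentiable_def)
  hence der: "(f has_derivative frechet_derivative f (at ?x)) (at ?x)"
    by (simp add: frechet_derivative_works)
  define D where "D = frechet_derivative f (at ?x) d"
  have "((\<lambda>s. f (l + s *\<^sub>R d)) has_derivative (\<lambda>h. frechet_derivative f (at ?x) (h *\<^sub>R d))) (at s)"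
    by (rule has_derivative_compose[where g = f and f = "\<lambda>s. l + s *\<^sub>R d", OF _ der])
      (auto intro!: derivative_eq_intros)
  moreover have "(\<lambda>h. frechet_derivative f (at ?x) (h *\<^sub>R d)) = (*) D"
    using linear_frechet_derivative[of f "at ?x"] \<open>f differentiable (at ?x)\<close>
    by (auto simp: D_def linear_cmul fun_eq_iff)
  ultimately have "((\<lambda>s. f (l + s *\<^sub>R d)) has_real_derivative D) (at s)"
    by (simp add: has_field_derivative_def)
  moreover have Dsum: "D = (\<Sum>i\<in>UNIV. d $ i * frechet_derivative f (at ?x) (axis i 1))"
  proof -
    have "d = (\<Sum>i\<in>UNIV. d $ i *\<^sub>R axis i 1)"
      by (simp add: basis_expansion flip: scalar_mult_eq_scaleR)
    hence "D = frechet_derivative f (at ?x) (\<Sum>i\<in>UNIV. d $ i *\<^sub>R axis i 1)" by (simp add: D_def)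
    thus ?thesis
      using linear_frechet_derivative[of f "at ?x"] \<open>f differentiable (at ?x)\<close>
      by (simp add: linear_sum linear_cmul)
  qed
  have pos: "frechet_derivative f (at ?x) (axis i 1) > 0" for i
    using f x by (simp add: curvature_function_def)
  have "D \<ge> 0" unfolding Dsum by (intro sum_nonneg mult_nonneg_nonneg d less_imp_le[OF pos])
  moreover have "D > 0" if "d \<noteq> 0"
  proof -
    have "\<exists>i. d $ i \<noteq> 0" using that by (metis vec_eq_iff zero_index)
    then obtain i where "d $ i \<noteq> 0" by blast
    hence "d $ i * frechet_derivative f (at ?x) (axis i 1) > 0" 
      using d[of i] pos[of i] by simp
    thus ?thesis unfolding Dsum
      by (intro sum_pos2[of UNIV i]) (auto intro!: mult_nonneg_nonneg d less_imp_le[OF pos])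
  qed
  ultimately show ?thesis by blast
qed

lemma curvature_function_mono:
  fixes f :: "real^'n \<Rightarrow> real"
  assumes f: "curvature_function f" and l: "l \<in> pos_cone" and le: "\<And>i. l $ i \<le> l' $ i"
  shows "f l \<le> f l'"
proof -
  have "\<exists>D. ((\<lambda>s. f (l + s *\<^sub>R (l' - l))) has_real_derivative D) (at s) \<and> 0 \<le> D" if "0 \<le> s" for s
    using curvature_function_deriv_along_line[OF f l _ that, of "l' - l"] le by auto
  hence "f (l + 0 *\<^sub>R (l' - l)) \<le> f (l + 1 *\<^sub>R (l' - l))"
    by (intro DERIV_nonneg_imp_nondecreasing[of 0 1 "\<lambda>s. f (l + s *\<^sub>R (l' - l))"]) auto
  thus ?thesis by simp
qed

lemma curvature_function_strict_mono:
  fixes f :: "real^'n \<Rightarrow> real"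
  assumes f: "curvature_function f" and l: "l \<in> pos_cone"
  shows "f l < f (l + axis i 1)"
proof -
  have "0 \<le> axis i (1::real) $ j" for j by (simp add: axis_def)
  moreover have "axis i (1::real) \<noteq> 0" by (simp add: axis_eq_0_iff)
  ultimately have "\<exists>D. ((\<lambda>s. f (l + s *\<^sub>R axis i 1)) has_real_derivative D) (at s) \<and> 0 < D"
    if "0 \<le> s" for s
    using curvature_function_deriv_along_line[OF f l _ that, of "axis i 1"] by blast
  hence "f (l + 0 *\<^sub>R axis i 1) < f (l + 1 *\<^sub>R axis i 1)"
    by (intro DERIV_pos_imp_increasing[of 0 1 "\<lambda>s. f (l + s *\<^sub>R axis i 1)"]) auto
  thus ?thesis by simp
qed

lemma curvature_function_continuous:
  fixes f :: "real^'n \<Rightarrow> real"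
  assumes f: "curvature_function f"
  shows "continuous_on pos_cone f"
proof -
  have "continuous_on (closure pos_cone) f" using f by (simp add: curvature_function_def)
  thus ?thesis using closure_subset continuous_on_subset by blast
qed

text \<open>Quantitative strict monotonicity: on a compact box a full unit step in one coordinate
  increases \<open>f\<close> by a uniform amount, and by concavity a fraction of the step yields at least
  that fraction of the increase.\<close>

lemma curvature_function_gain:
  fixes f :: "real^'n \<Rightarrow> real"
  assumes f: "curvature_function f" and "0 < m"
  obtains c where "0 < c"
    "\<And>l i d. \<lbrakk>\<And>j. m \<le> l $ j; \<And>j. l $ j \<le> M; 0 \<le> d; d \<le> 1\<rbrakk> \<Longrightarrow> f l + c * d \<le> f (l + d *\<^sub>R axis i 1)"
proof -
  let ?K = "{l :: real^'n. \<forall>j. m \<le> l $ j \<and> l $ j \<le> M}"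
  have K: "compact ?K"
  proof -
    have "?K = cbox (\<chi> j. m) (\<chi> j. M)" by (auto simp: mem_box_cart)
    thus ?thesis by (simp add: compact_cbox)
  qed
  have sub: "?K \<subseteq> pos_cone" using \<open>0 < m\<close> by (auto simp: pos_cone_def intro: less_le_trans)
  have step: "\<exists>c>0. \<forall>l\<in>?K. c \<le> f (l + axis i 1) - f l" for i
  proof (cases "?K = {}")
    case True
    show ?thesis unfolding True by (auto intro: exI[of _ 1])
  next
    case False
    have "(\<lambda>l. l + axis i 1) ` ?K \<subseteq> pos_cone"
      using sub by (fastforce simp: pos_cone_def axis_def intro: add_pos_nonneg)
    hence "continuous_on ?K (\<lambda>l. f (l + axis i 1) - f l)"
      by (intro continuous_intros continuous_on_compose2[OF curvature_function_continuous[OF f]]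
          continuous_on_subset[OF curvature_function_continuous[OF f] sub]) auto
    from continuous_attains_inf[OF K False this]
    obtain l0 where l0: "l0 \<in> ?K" "\<forall>l\<in>?K. f (l0 + axis i 1) - f l0 \<le> f (l + axis i 1) - f l" by blast
    have "f (l0 + axis i 1) - f l0 > 0"
      using curvature_function_strict_mono[OF f, of l0 i] l0(1) sub by auto
    thus ?thesis using l0(2) by blast
  qed
  have "\<exists>c. \<forall>i. c i > 0 \<and> (\<forall>l\<in>?K. c i \<le> f (l + axis i 1) - f l)"
    by (rule choice, rule allI, rule step)
  then obtain c where c: "\<And>i. c i > 0" "\<And>i l. l \<in> ?K \<Longrightarrow> c i \<le> f (l + axis i 1) - f l" by blast
  define c0 where "c0 = Min (range c)"
  have "c0 > 0" using c(1) by (auto simp: c0_def)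
  have c0: "c0 \<le> c i" for i by (simp add: c0_def)
  show ?thesis
  proof (rule that[OF \<open>c0 > 0\<close>])
    fix l :: "real^'n" and i and d :: real
    assume l: "\<And>j. m \<le> l $ j" "\<And>j. l $ j \<le> M" and d: "0 \<le> d" "d \<le> 1"
    have lK: "l \<in> ?K" using l by simp
    have pc: "l \<in> pos_cone" using lK sub by blast
    hence pc': "l + axis i 1 \<in> pos_cone"
      by (auto simp: pos_cone_def axis_def intro: add_pos_nonneg)
    have "concave_on pos_cone f" using f by (simp add: curvature_function_def)
    hence "f ((1 - d) *\<^sub>R l + d *\<^sub>R (l + axis i 1)) \<ge> (1 - d) * f l + d * f (l + axis i 1)"
      using concave_onD[of pos_cone f d l "l + axis i 1"] d pc pc' by simp
    moreover have "(1 - d) *\<^sub>R l + d *\<^sub>R (l + axis i 1) = l + d *\<^sub>R axis i 1"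
      by (simp add: algebra_simps)
    moreover have "d * (f (l + axis i 1) - f l) \<ge> d * c0"
      using c(2)[OF lK, of i] c0[of i] d by (intro mult_left_mono) auto
    ultimately show "f l + c0 * d \<le> f (l + d *\<^sub>R axis i 1)" by (simp add: algebra_simps)
  qed
qed

text \<open>A curvature function evaluated on the spectrum of a symmetric matrix. The notion inherits
  monotonicity and homogeneity, and the flow only sees the curvature matrix through it.\<close>

definition spectral_value :: "(real^'n \<Rightarrow> real) \<Rightarrow> real^'n^'n \<Rightarrow> real" where
  "spectral_value f A = f (eigenvalue_vector A)"

lemma transpose_add: "transpose (A + B) = transpose A + transpose (B :: real^'n^'m)"
  by (simp add: transpose_def vec_eq_iff)

lemma transpose_scaleR: "transpose (c *\<^sub>R A) = c *\<^sub>R transpose (A :: real^'n^'m)"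
  by (simp add: transpose_def vec_eq_iff)

definition outer :: "real^'n \<Rightarrow> real^'n^'n" where
  "outer y = (\<chi> i j. y $ i * y $ j)"

lemma transpose_outer: "transpose (outer y) = outer y"
  by (simp add: transpose_def outer_def vec_eq_iff mult.commute)

lemma outer_vector: "outer y *v z = (y \<bullet> z) *\<^sub>R y"
  by (simp add: outer_def vec_eq_iff matrix_vector_mult_def inner_vec_def sum_distrib_right
      sum_distrib_left mult_ac)

lemma trace_outer: "trace (outer y) = y \<bullet> y"
  by (simp add: trace_def outer_def inner_vec_def)

lemma mat_scaleR_vector: "(c *\<^sub>R mat 1) *v y = c *\<^sub>R (y :: real^'n)"
  by (simp flip: scaleR_matrix_vector_assoc)

lemma pos_definite_of_le:
  assumes "pos_definite A" "transpose B = B" "\<And>y. y \<bullet> (A *v y) \<le> y \<bullet> (B *v y)"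
  shows "pos_definite B"
  using assms unfolding pos_definite_def by (meson less_le_trans)

lemma pos_definite_scaleR:
  assumes "pos_definite A" "0 < c"
  shows "pos_definite (c *\<^sub>R A)"
  using assms unfolding pos_definite_def
  by (auto simp: transpose_scaleR simp flip: scaleR_matrix_vector_assoc)

lemma pos_definite_scaled_identity: "0 < c \<Longrightarrow> pos_definite (c *\<^sub>R mat 1)"
  by (auto simp: pos_definite_def transpose_scaleR transpose_mat mat_scaleR_vector)

lemma pos_definite_lower_bound:
  assumes "transpose A = A" "0 < m" "\<And>y. m * (y \<bullet> y) \<le> y \<bullet> (A *v y)"
  shows "pos_definite A"
  using assms unfolding pos_definite_def
  by (metis inner_gt_zero_iff mult_pos_pos order_less_le_trans)

lemma eigenvalue_vector_pos_cone:
  assumes "pos_definite A"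
  shows "eigenvalue_vector A \<in> pos_cone"
proof -
  have sym: "transpose A = A" using assms by (simp add: pos_definite_def)
  obtain a where a: "orthonormal_family a" "\<And>i. A *v a i = eigenvalue_vector A $ i *\<^sub>R a i"
    using eigenvalue_vector_eigenbasis[OF sym] by blast
  have "eigenvalue_vector A $ i > 0" for i
  proof -
    have "a i \<bullet> a i = 1" using a(1) by (simp add: orthonormal_family_def)
    hence "a i \<noteq> 0" by auto
    hence "a i \<bullet> (A *v a i) > 0" using assms by (simp add: pos_definite_def)
    thus ?thesis using \<open>a i \<bullet> a i = 1\<close> by (simp add: a(2))
  qed
  thus ?thesis by (simp add: pos_cone_def)
qed

context
  fixes f :: "real^'n \<Rightarrow> real"
  assumes f: "curvature_function f"
begin

lemma curvature_function_permute:
  assumes "l \<in> pos_cone" "bij p" "\<And>i. l' $ i = l $ p i"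
  shows "f l' = f l"
proof -
  have "l' = (\<chi> i. l $ p i)" using assms(3) by (simp add: vec_eq_iff)
  thus ?thesis using f assms(1,2) by (simp add: curvature_function_def)
qed

lemma spectral_value_pos: "pos_definite A \<Longrightarrow> 0 < spectral_value f A"
  using f eigenvalue_vector_pos_cone unfolding spectral_value_def curvature_function_def by blast

lemma spectral_value_mono:
  assumes A: "pos_definite A" and B: "transpose B = B" and le: "\<And>y. y \<bullet> (A *v y) \<le> y \<bullet> (B *v y)"
  shows "spectral_value f A \<le> spectral_value f B"
proof -
  have "transpose A = A" using A by (simp add: pos_definite_def)
  then obtain p where p: "bij p" "\<And>i. eigenvalue_vector A $ i \<le> eigenvalue_vector B $ p i"
    using eigenvalue_vector_mono[OF _ B le] by blast
  have "f (eigenvalue_vector A) \<le> f (\<chi> i. eigenvalue_vector B $ p i)"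
    using p(2) by (intro curvature_function_mono[OF f eigenvalue_vector_pos_cone[OF A]]) simp
  also have "\<dots> = f (eigenvalue_vector B)"
    using eigenvalue_vector_pos_cone[OF pos_definite_of_le[OF A B le]] p(1)
    by (intro curvature_function_permute) auto
  finally show ?thesis by (simp add: spectral_value_def)
qed

lemma spectral_value_scaleR:
  assumes A: "pos_definite A" and c: "0 < c"
  shows "spectral_value f (c *\<^sub>R A) = c * spectral_value f A"
proof -
  have sym: "transpose A = A" using A by (simp add: pos_definite_def)
  obtain a where a: "orthonormal_family a" "\<And>i. A *v a i = eigenvalue_vector A $ i *\<^sub>R a i"
    using eigenvalue_vector_eigenbasis[OF sym] by blast
  have "(c *\<^sub>R A) *v a i = (c * eigenvalue_vector A $ i) *\<^sub>R a i" for i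
    by (simp add: a(2) flip: scaleR_matrix_vector_assoc)
  then obtain p where "bij p" "\<And>i. eigenvalue_vector (c *\<^sub>R A) $ i = c * eigenvalue_vector A $ p i"
    using eigenvalue_vector_unique[OF a(1), of "c *\<^sub>R A" "\<lambda>i. c * eigenvalue_vector A $ i"] by blast
  hence "f (eigenvalue_vector (c *\<^sub>R A)) = f (c *\<^sub>R eigenvalue_vector A)"
    using eigenvalue_vector_pos_cone[OF A] c
    by (intro curvature_function_permute) (auto simp: pos_cone_def)
  also have "\<dots> = c * f (eigenvalue_vector A)"
    using f eigenvalue_vector_pos_cone[OF A] c by (simp add: curvature_function_def)
  finally show ?thesis by (simp add: spectral_value_def)
qed

lemma spectral_value_identity: "spectral_value f (mat 1) = 1"
proof -
  have "orthonormal_family (\<lambda>i::'n. axis i 1)"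
    by (simp add: orthonormal_family_def inner_axis_axis)
  then obtain p :: "'n \<Rightarrow> 'n" where "\<And>i. eigenvalue_vector (mat 1 :: real^'n^'n) $ i = 1"
    using eigenvalue_vector_unique[of "\<lambda>i::'n. axis i 1" "mat 1" "\<lambda>i. 1"]
    by (metis matrix_vector_mul_lid scaleR_one)
  hence "eigenvalue_vector (mat 1 :: real^'n^'n) = 1" by (simp add: vec_eq_iff)
  thus ?thesis using f by (simp add: spectral_value_def curvature_function_def)
qed

lemma spectral_value_le:
  assumes A: "pos_definite A" and M: "0 < M" and le: "\<And>y. y \<bullet> (A *v y) \<le> M * (y \<bullet> y)"
  shows "spectral_value f A \<le> M"
proof -
  have "spectral_value f A \<le> spectral_value f (M *\<^sub>R mat 1)"
    using le by (intro spectral_value_mono[OF A]) (simp_all add: transpose_scaleR transpose_mat mat_scaleR_vector)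
  also have "\<dots> = M"
    using pos_definite_scaled_identity[of 1] spectral_value_scaleR[OF _ M, of "mat 1"]
    by (simp add: spectral_value_identity)
  finally show ?thesis .
qed

text \<open>A rank-one increase of size \<open>s\<close> raises the trace by \<open>s\<close> and lowers no (sorted)
  eigenvalue, hence raises one of the \<open>n\<close> eigenvalues by at least \<open>s / n\<close>.\<close>

lemma spectral_value_rank_one_gain:
  assumes "0 < m"
  obtains c where "0 < c"
    "\<And>A y t. \<lbrakk>transpose A = A; \<And>z. m * (z \<bullet> z) \<le> z \<bullet> (A *v z); \<And>z. z \<bullet> (A *v z) \<le> M * (z \<bullet> z);
      0 \<le> t; t * (y \<bullet> y) \<le> 1\<rbrakk>
      \<Longrightarrow> spectral_value f A + c * (t * (y \<bullet> y)) \<le> spectral_value f (A + t *\<^sub>R outer y)"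
proof -
  obtain c where c: "0 < c"
    "\<And>l i d. \<lbrakk>\<And>j. m \<le> l $ j; \<And>j. l $ j \<le> M; 0 \<le> d; d \<le> 1\<rbrakk> \<Longrightarrow> f l + c * d \<le> f (l + d *\<^sub>R axis i 1)"
    using curvature_function_gain[OF f assms, of M] by metis
  show ?thesis
  proof (rule that[of "c / CARD('n)"])
    fix A :: "real^'n^'n" and y :: "real^'n" and t :: real
    assume sym: "transpose A = A" and lo: "\<And>z. m * (z \<bullet> z) \<le> z \<bullet> (A *v z)"
      and hi: "\<And>z. z \<bullet> (A *v z) \<le> M * (z \<bullet> z)" and t: "0 \<le> t" "t * (y \<bullet> y) \<le> 1"
    let ?B = "A + t *\<^sub>R outer y"
    have A: "pos_definite A" using pos_definite_lower_bound[OF sym assms lo] .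
    have symB: "transpose ?B = ?B" by (simp add: transpose_add transpose_scaleR sym transpose_outer)
    have le: "z \<bullet> (A *v z) \<le> z \<bullet> (?B *v z)" for z
      using t mult_nonneg_nonneg[OF t(1) zero_le_square[of "y \<bullet> z"]]
      by (simp add: matrix_vector_mult_add_rdistrib inner_add_right outer_vector inner_commute
          mult.assoc flip: scaleR_matrix_vector_assoc)
    obtain p where p: "bij p" "\<And>i. eigenvalue_vector A $ i \<le> eigenvalue_vector ?B $ p i"
      using eigenvalue_vector_mono[OF sym symB le] by blast
    define l where "l = eigenvalue_vector A"
    define k where "k = (\<chi> i. eigenvalue_vector ?B $ p i)"
    have "(\<Sum>i\<in>UNIV. k $ i) = trace ?B"
      using sum.reindex_bij_betw[OF p(1), of "($) (eigenvalue_vector ?B)"]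
      by (simp add: k_def trace_eq_sum_eigenvalue_vector[OF symB])
    moreover have "(\<Sum>i\<in>UNIV. l $ i) = trace A"
      by (simp add: l_def trace_eq_sum_eigenvalue_vector[OF sym])
    moreover have "trace ?B = trace A + t * (y \<bullet> y)"
      by (simp add: trace_add trace_outer[symmetric]) (simp add: trace_def sum_distrib_left)
    ultimately have sum: "(\<Sum>i\<in>UNIV. k $ i - l $ i) = t * (y \<bullet> y)" by (simp add: sum_subtractf)
    define d where "d = t * (y \<bullet> y) / CARD('n)"
    have d: "0 \<le> d" "d \<le> 1"
      using t by (auto simp: d_def divide_le_eq intro: order_trans[of _ 1])
    have "\<exists>i. d \<le> k $ i - l $ i"
    proof (rule ccontr)
      assume "\<not> ?thesis"
      hence "(\<Sum>i\<in>UNIV. k $ i - l $ i) < (\<Sum>i\<in>(UNIV::'n set). d)" by (intro sum_strict_mono) (auto simp: not_le)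
      thus False by (simp add: sum d_def)
    qed
    then obtain i where i: "d \<le> k $ i - l $ i" by blast
    have lm: "\<And>j. m \<le> l $ j" "\<And>j. l $ j \<le> M"
      using eigenvalue_vector_bounds[OF sym] lo hi unfolding l_def by blast+
    have "f l + c * d \<le> f (l + d *\<^sub>R axis i 1)" by (rule c(2)[OF lm d])
    also have "\<dots> \<le> f k"
    proof (rule curvature_function_mono[OF f])
      show "l + d *\<^sub>R axis i 1 \<in> pos_cone"
        using eigenvalue_vector_pos_cone[OF A] d(1)
        by (auto simp: pos_cone_def l_def axis_def intro: add_pos_nonneg)
      show "(l + d *\<^sub>R axis i 1) $ j \<le> k $ j" for j
        using i p(2)[of j] by (auto simp: axis_def k_def l_def)
    qed
    also have "f k = f (eigenvalue_vector ?B)"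
      using eigenvalue_vector_pos_cone[OF pos_definite_of_le[OF A symB le]] p(1)
      by (intro curvature_function_permute) (auto simp: k_def)
    finally show "spectral_value f A + c / CARD('n) * (t * (y \<bullet> y)) \<le> spectral_value f ?B"
      by (simp add: spectral_value_def l_def d_def)
  qed (use c(1) in simp)
qed

end

section \<open>The curvature matrix of a graph\<close>

definition slope_w :: "real^'n \<Rightarrow> real" where
  "slope_w p = sqrt (1 + (norm p)\<^sup>2)"

definition slope_gamma :: "real^'n \<Rightarrow> real^'n^'n" where
  "slope_gamma p = (\<chi> i j. (if i = j then 1 else 0) - p $ i * p $ j / (slope_w p * (1 + slope_w p)))"

text \<open>The curvature matrix multiplied by \<open>w\<close>; by homogeneity of the curvature function this
  factor can be absorbed, which makes the flow equation read \<open>u\<^sub>t = u (F(N) - \<sigma> w)\<close>.\<close>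

definition scaled_curvature :: "real^'n \<Rightarrow> real \<Rightarrow> real^'n^'n \<Rightarrow> real^'n^'n" where
  "scaled_curvature p s H = mat 1 + s *\<^sub>R (slope_gamma p ** H ** slope_gamma p)"

lemma slope_w_ge_1: "1 \<le> slope_w p"
  by (simp add: slope_w_def)

lemma slope_w_pos: "0 < slope_w p"
  using slope_w_ge_1[of p] by linarith

lemma slope_w_square: "(slope_w p)\<^sup>2 = 1 + p \<bullet> p"
  by (simp add: slope_w_def add_nonneg_nonneg power2_norm_eq_inner)

lemma slope_w_le: "slope_w p \<le> 1 + norm p"
  unfolding slope_w_def by (rule real_le_lsqrt) (auto simp: power2_eq_square algebra_simps)

lemma slope_w_lipschitz: "\<bar>slope_w p - slope_w q\<bar> \<le> norm (p - q)"
proof -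
  have "slope_w p = norm (1::real, p)" for p :: "real^'a"
    by (simp add: slope_w_def norm_Pair)
  hence "\<bar>slope_w p - slope_w q\<bar> \<le> norm ((1::real, p) - (1, q))" by (metis norm_triangle_ineq3)
  thus ?thesis by (simp add: norm_Pair)
qed

lemma transpose_slope_gamma: "transpose (slope_gamma p) = slope_gamma p"
  by (auto simp: transpose_def slope_gamma_def vec_eq_iff mult.commute)

lemma slope_gamma_vector:
  "slope_gamma p *v y = y - ((p \<bullet> y) / (slope_w p * (1 + slope_w p))) *\<^sub>R p"
proof -
  define a where "a = 1 / (slope_w p * (1 + slope_w p))"
  have "slope_gamma p = mat 1 - a *\<^sub>R outer p"
    by (simp add: slope_gamma_def mat_def outer_def vec_eq_iff a_def)
  thus ?thesis
    by (simp add: matrix_vector_mult_diff_rdistrib outer_vector a_def mult.commute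
        flip: scaleR_matrix_vector_assoc)
qed

lemma inner_slope_gamma: "p \<bullet> (slope_gamma p *v y) = (p \<bullet> y) / slope_w p"
proof -
  define w where "w = slope_w p"
  define b where "b = p \<bullet> y"
  have w: "w \<noteq> 0" "1 + w \<noteq> 0" using slope_w_ge_1[of p] by (auto simp: w_def)
  have pp: "p \<bullet> p = (w - 1) * (1 + w)"
    using slope_w_square[of p] by (simp add: power2_eq_square algebra_simps w_def)
  have "p \<bullet> (slope_gamma p *v y) = b - b / (w * (1 + w)) * (p \<bullet> p)"
    by (simp add: slope_gamma_vector inner_diff_right b_def w_def)
  also have "\<dots> = b - b * (w - 1) / w"
    unfolding pp using w by simp
  also have "\<dots> = b / w" using w by (simp add: field_simps)
  finally show ?thesis by (simp add: b_def w_def)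
qed

text \<open>The identity \<open>\<gamma> (I + p p\<^sup>T) \<gamma> = I\<close> as an identity of quadratic forms.\<close>

lemma slope_gamma_isometry:
  "(slope_gamma p *v y) \<bullet> (slope_gamma p *v y) + (p \<bullet> (slope_gamma p *v y))\<^sup>2 = y \<bullet> y"
proof -
  define w where "w = slope_w p"
  define b where "b = p \<bullet> y"
  have w: "w \<noteq> 0" "1 + w \<noteq> 0" using slope_w_ge_1[of p] by (auto simp: w_def)
  have pp: "p \<bullet> p = (w - 1) * (1 + w)"
    using slope_w_square[of p] by (simp add: power2_eq_square algebra_simps w_def)
  have quad: "(y - c *\<^sub>R p) \<bullet> (y - c *\<^sub>R p) = y \<bullet> y - 2 * c * b + c\<^sup>2 * (p \<bullet> p)" for c
    by (simp add: inner_diff_right inner_diff_left b_def inner_commute[of y p] power2_eq_square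
        algebra_simps)
  have "(slope_gamma p *v y) \<bullet> (slope_gamma p *v y)
      = y \<bullet> y - 2 * (b / (w * (1 + w))) * b + (b / (w * (1 + w)))\<^sup>2 * ((w - 1) * (1 + w))"
    unfolding slope_gamma_vector quad[unfolded b_def] pp by (simp add: b_def w_def)
  also have "(b / (w * (1 + w)))\<^sup>2 * ((w - 1) * (1 + w)) = b\<^sup>2 * (w - 1) / (w\<^sup>2 * (1 + w))"
    using w by (simp add: power2_eq_square)
  also have "y \<bullet> y - 2 * (b / (w * (1 + w))) * b + b\<^sup>2 * (w - 1) / (w\<^sup>2 * (1 + w)) = y \<bullet> y - (b / w)\<^sup>2"
    using w by (simp add: divide_simps power2_eq_square) (simp add: algebra_simps)
  finally show ?thesis by (simp add: inner_slope_gamma b_def w_def)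
qed

lemma norm_slope_gamma_le: "norm (slope_gamma p *v y) \<le> norm y"
proof -
  have "(slope_gamma p *v y) \<bullet> (slope_gamma p *v y) \<le> y \<bullet> y"
    using slope_gamma_isometry[of p y] zero_le_power2[of "p \<bullet> (slope_gamma p *v y)"] by linarith
  thus ?thesis by (simp add: norm_le)
qed

lemma inner_slope_gamma_ge:
  "y \<bullet> y / (slope_w p)\<^sup>2 \<le> (slope_gamma p *v y) \<bullet> (slope_gamma p *v y)"
proof -
  have w: "(slope_w p)\<^sup>2 > 0" using slope_w_pos[of p] by simp
  have "(p \<bullet> y)\<^sup>2 \<le> (p \<bullet> p) * (y \<bullet> y)" by (rule Cauchy_Schwarz_ineq)
  hence "y \<bullet> y \<le> (slope_w p)\<^sup>2 * (y \<bullet> y) - (p \<bullet> y)\<^sup>2"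
    by (simp add: slope_w_square algebra_simps)
  hence "y \<bullet> y / (slope_w p)\<^sup>2 \<le> ((slope_w p)\<^sup>2 * (y \<bullet> y) - (p \<bullet> y)\<^sup>2) / (slope_w p)\<^sup>2"
    using w by (intro divide_right_mono) auto
  also have "\<dots> = y \<bullet> y - ((p \<bullet> y) / slope_w p)\<^sup>2"
    using w by (simp add: diff_divide_distrib power_divide)
  also have "\<dots> = (slope_gamma p *v y) \<bullet> (slope_gamma p *v y)"
    using slope_gamma_isometry[of p y] by (simp add: inner_slope_gamma)
  finally show ?thesis .
qed

text \<open>The barrier of the strong maximum principle has nonzero gradient, so the two graphs compared there
  have different matrices \<open>\<gamma>\<close>; their difference is controlled by that of the gradients.\<close>

lemma slope_gamma_lipschitz:
  assumes p: "norm p \<le> P" and q: "norm q \<le> P"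
  shows "norm (slope_gamma p *v y - slope_gamma q *v y) \<le> ((3 + 2*P) * P\<^sup>2 + 2*P) * norm (p - q) * norm y"
proof -
  have P: "0 \<le> P" using p norm_ge_zero order_trans by blast
  define a where "a v = 1 / (slope_w v * (1 + slope_w v))" for v :: "real^'a"
  have den: "1 \<le> slope_w v * (1 + slope_w v)" for v :: "real^'a"
    using slope_w_ge_1[of v] mult_mono[of 1 "slope_w v" 1 "1 + slope_w v"] by simp
  have a01: "0 < a v" "a v \<le> 1" for v
    using den[of v] by (auto simp: a_def divide_le_eq)
  have da: "\<bar>a p - a q\<bar> \<le> (3 + 2*P) * norm (p - q)"
  proof -
    let ?x = "slope_w p * (1 + slope_w p)" and ?y = "slope_w q * (1 + slope_w q)"
    have "a p - a q = (?y - ?x) / (?x * ?y)"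
      using den[of p] den[of q] by (simp add: a_def field_simps)
    moreover have xy: "1 \<le> ?x * ?y" using mult_mono[OF den[of p] den[of q]] den[of p] by simp
    hence "0 < ?x * ?y" by linarith
    ultimately have "\<bar>a p - a q\<bar> = \<bar>?y - ?x\<bar> / (?x * ?y)"
      by (simp only: abs_divide abs_of_pos)
    also have "\<dots> \<le> \<bar>?y - ?x\<bar> / 1"
      using xy by (intro divide_left_mono) auto
    also have "\<bar>?y - ?x\<bar> / 1 = \<bar>?y - ?x\<bar>" by simp
    also have "?y - ?x = (slope_w q - slope_w p) * (1 + slope_w p + slope_w q)"
      by (simp add: algebra_simps)
    also have "\<bar>\<dots>\<bar> = \<bar>slope_w q - slope_w p\<bar> * (1 + slope_w p + slope_w q)"
      using slope_w_ge_1[of p] slope_w_ge_1[of q] by (simp add: abs_mult)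
    also have "\<dots> \<le> norm (q - p) * (3 + 2*P)"
      using slope_w_le[of p] slope_w_le[of q] p q slope_w_ge_1[of p] slope_w_ge_1[of q]
      by (intro mult_mono slope_w_lipschitz) auto
    finally show ?thesis by (simp add: norm_minus_commute mult.commute)
  qed
  have "slope_gamma p *v y - slope_gamma q *v y
      = (a q - a p) *\<^sub>R ((p \<bullet> y) *\<^sub>R p) + a q *\<^sub>R (((q - p) \<bullet> y) *\<^sub>R p) + a q *\<^sub>R ((q \<bullet> y) *\<^sub>R (q - p))"
    by (simp add: slope_gamma_vector a_def algebra_simps inner_diff_left scaleR_diff_left)
  also have "norm \<dots> \<le> ((3 + 2*P) * norm (p - q)) * ((P * norm y) * P) + 1 * ((norm (p - q) * norm y) * P)
      + 1 * ((P * norm y) * norm (p - q))"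
  proof (intro norm_triangle_le add_mono)
    have py: "\<bar>v \<bullet> y\<bar> \<le> P * norm y" if "norm v \<le> P" for v
      using Cauchy_Schwarz_ineq2[of v y] mult_right_mono[OF that norm_ge_zero[of y]] by linarith
    show "norm ((a q - a p) *\<^sub>R ((p \<bullet> y) *\<^sub>R p)) \<le> ((3 + 2*P) * norm (p - q)) * ((P * norm y) * P)"
      unfolding norm_scaleR using da py[OF p] p P
      by (intro mult_mono) (auto simp: abs_minus_commute)
    have "\<bar>(q - p) \<bullet> y\<bar> \<le> norm (p - q) * norm y"
      using Cauchy_Schwarz_ineq2[of "q - p" y] by (simp add: norm_minus_commute)
    thus "norm (a q *\<^sub>R (((q - p) \<bullet> y) *\<^sub>R p)) \<le> 1 * ((norm (p - q) * norm y) * P)"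
      unfolding norm_scaleR using a01[of q] p P by (intro mult_mono) auto
    show "norm (a q *\<^sub>R ((q \<bullet> y) *\<^sub>R (q - p))) \<le> 1 * ((P * norm y) * norm (p - q))"
      unfolding norm_scaleR using a01[of q] py[OF q] P
      by (intro mult_mono) (auto simp: norm_minus_commute)
  qed
  also have "\<dots> = ((3 + 2*P) * P\<^sup>2 + 2*P) * norm (p - q) * norm y"
    by (simp add: algebra_simps power2_eq_square)
  finally show ?thesis .
qed

lemma scaled_curvature_form:
  "y \<bullet> (scaled_curvature p s H *v y)
    = y \<bullet> y + s * ((slope_gamma p *v y) \<bullet> (H *v (slope_gamma p *v y)))"
proof -
  have "y \<bullet> ((slope_gamma p ** H ** slope_gamma p) *v y)
      = (slope_gamma p *v y) \<bullet> (H *v (slope_gamma p *v y))"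
    by (simp add: symmetric_inner[OF transpose_slope_gamma] flip: matrix_vector_mul_assoc)
  thus ?thesis
    by (simp add: scaled_curvature_def matrix_vector_mult_add_rdistrib inner_add_right
        flip: scaleR_matrix_vector_assoc)
qed

lemma transpose_scaled_curvature:
  "transpose H = H \<Longrightarrow> transpose (scaled_curvature p s H) = scaled_curvature p s H"
  by (simp add: scaled_curvature_def transpose_add transpose_scaleR transpose_mat
      matrix_transpose_mul transpose_slope_gamma matrix_mul_assoc)

text \<open>By the isometry property, substituting \<open>z = \<gamma> y\<close> turns the form of the scaled curvature matrix into
  that of \<open>I + p p\<^sup>T + s H\<close>, the matrix in the definition of admissibility.\<close>

lemma pos_definite_scaled_curvature:
  assumes "transpose H = H" and pos: "\<And>z. z \<noteq> 0 \<Longrightarrow> 0 < z \<bullet> z + (p \<bullet> z)\<^sup>2 + s * (z \<bullet> (H *v z))"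
  shows "pos_definite (scaled_curvature p s H)"
  unfolding pos_definite_def
proof (intro conjI allI impI)
  show "transpose (scaled_curvature p s H) = scaled_curvature p s H"
    by (rule transpose_scaled_curvature) fact
  fix y :: "real^'a" assume y: "y \<noteq> 0"
  let ?z = "slope_gamma p *v y"
  have "?z \<noteq> 0"
  proof
    assume "?z = 0"
    hence "y \<bullet> y = 0" using slope_gamma_isometry[of p y] by simp
    thus False using y by simp
  qed
  from pos[OF this] show "0 < y \<bullet> (scaled_curvature p s H *v y)"
    using slope_gamma_isometry[of p y] by (simp add: scaled_curvature_form)
qed

lemma curvature_function_principal_curvatures:
  assumes f: "curvature_function f"
    and pos: "pos_definite (scaled_curvature (grad u x) (u x) (hess u x))"
  shows "slope_w (grad u x) * f (principal_curvatures u x)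
    = spectral_value f (scaled_curvature (grad u x) (u x) (hess u x))"
proof -
  have w: "graph_w u x = slope_w (grad u x)" by (simp add: graph_w_def slope_w_def)
  have "graph_gamma u x = slope_gamma (grad u x)"
    by (simp add: graph_gamma_def slope_gamma_def w grad_def)
  hence "curvature_matrix u x
      = (1 / slope_w (grad u x)) *\<^sub>R scaled_curvature (grad u x) (u x) (hess u x)"
    by (simp add: curvature_matrix_def scaled_curvature_def w)
  hence "f (principal_curvatures u x)
      = 1 / slope_w (grad u x) * spectral_value f (scaled_curvature (grad u x) (u x) (hess u x))"
    using spectral_value_scaleR[OF f pos, of "1 / slope_w (grad u x)"] slope_w_pos[of "grad u x"]
    by (simp add: principal_curvatures_def flip: spectral_value_def)
  thus ?thesis using slope_w_pos[of "grad u x"] by simp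
qed

section \<open>Pointwise inequalities for the speed of the flow\<close>

text \<open>The right-hand side of the flow equation for a graph of height \<open>s\<close>, gradient \<open>p\<close> and Hessian \<open>H\<close>.\<close>

definition speed :: "(real^'n \<Rightarrow> real) \<Rightarrow> real \<Rightarrow> real^'n \<Rightarrow> real \<Rightarrow> real^'n^'n \<Rightarrow> real" where
  "speed f \<sigma> p s H = s * (spectral_value f (scaled_curvature p s H) - \<sigma> * slope_w p)"

text \<open>At such a point the graph touches from above, to second order, a horosphere, on which the
  curvature function is \<open>1 > \<sigma>\<close>.\<close>

lemma speed_at_minimum:
  fixes H :: "real^'n^'n"
  assumes f: "curvature_function f" and "\<sigma> < 1" and "0 < s"
    and H: "transpose H = H" "\<And>z. 0 \<le> z \<bullet> (H *v z)"
  shows "0 < speed f \<sigma> 0 s H"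
proof -
  have "spectral_value f (mat 1) \<le> spectral_value f (scaled_curvature 0 s H)"
    using \<open>0 < s\<close> H pos_definite_scaled_identity[of 1]
    by (intro spectral_value_mono[OF f]) (auto simp: transpose_scaled_curvature scaled_curvature_form)
  hence "1 \<le> spectral_value f (scaled_curvature 0 s H)"
    by (simp add: spectral_value_identity[OF f])
  thus ?thesis using assms by (simp add: speed_def slope_w_def)
qed

text \<open>Replacing the height \<open>v\<close> by \<open>s < v\<close> costs at most the factor \<open>s / v\<close> in the homogeneous curvature
  function. If the higher graph has nonnegative speed, the curvature function on it is at least
  \<open>\<sigma> w\<close>, and the lower graph loses at most \<open>\<sigma> w (v - s)\<close>: no size of the Hessians enters. This
  matters because second derivatives of the flow are not bounded near \<open>\<partial>\<Omega>\<close>.\<close>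

lemma speed_comparison:
  fixes H G :: "real^'n^'n"
  assumes f: "curvature_function f" and "0 < \<sigma>" and s: "0 < s" "s < v"
    and H: "transpose H = H" and G: "transpose G = G" and le: "\<And>z. z \<bullet> (G *v z) \<le> z \<bullet> (H *v z)"
    and pos: "pos_definite (scaled_curvature p v G)" and nonneg: "0 \<le> speed f \<sigma> p v G"
  shows "- \<sigma> * slope_w p * (v - s) \<le> speed f \<sigma> p s H"
proof -
  let ?F = "spectral_value f" and ?N = "scaled_curvature p v G"
  have v: "0 < v" using s by simp
  have Fv: "\<sigma> * slope_w p \<le> ?F ?N"
    using nonneg v by (simp add: speed_def zero_le_mult_iff)
  have "(s / v) * ?F ?N = ?F ((s / v) *\<^sub>R ?N)"
    using spectral_value_scaleR[OF f pos, of "s / v"] s v by simp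
  also have "\<dots> \<le> ?F (scaled_curvature p s H)"
  proof (rule spectral_value_mono[OF f])
    show "pos_definite ((s / v) *\<^sub>R ?N)" using pos s v by (intro pos_definite_scaleR) auto
    show "transpose (scaled_curvature p s H) = scaled_curvature p s H"
      by (rule transpose_scaled_curvature[OF H])
    fix y :: "real^'n"
    let ?z = "slope_gamma p *v y"
    have "y \<bullet> (((s / v) *\<^sub>R ?N) *v y) = (s / v) * (y \<bullet> y) + s * (?z \<bullet> (G *v ?z))"
      using v by (simp add: scaled_curvature_form distrib_left flip: scaleR_matrix_vector_assoc)
    also have "\<dots> \<le> 1 * (y \<bullet> y) + s * (?z \<bullet> (H *v ?z))"
      using s v le by (intro add_mono mult_right_mono mult_left_mono) auto
    also have "\<dots> = y \<bullet> (scaled_curvature p s H *v y)" by (simp add: scaled_curvature_form)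
    finally show "y \<bullet> (((s / v) *\<^sub>R ?N) *v y) \<le> y \<bullet> (scaled_curvature p s H *v y)" .
  qed
  finally have "(s / v) * (\<sigma> * slope_w p) \<le> ?F (scaled_curvature p s H)"
    using mult_left_mono[OF Fv, of "s / v"] s v by simp
  hence "s * ((s / v) * (\<sigma> * slope_w p) - \<sigma> * slope_w p) \<le> speed f \<sigma> p s H"
    unfolding speed_def using s by (intro mult_left_mono) auto
  moreover have "s * ((s / v) * (\<sigma> * slope_w p) - \<sigma> * slope_w p)
      = - (s / v) * (\<sigma> * slope_w p * (v - s))"
    using v by (simp add: field_simps)
  moreover have "(s / v) * (\<sigma> * slope_w p * (v - s)) \<le> 1 * (\<sigma> * slope_w p * (v - s))"
    using s v \<open>0 < \<sigma>\<close> slope_w_pos[of p] by (intro mult_right_mono) auto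
  ultimately show ?thesis by simp
qed

lemma outer_form: "y \<bullet> (outer a *v y) = (a \<bullet> y)\<^sup>2"
  by (simp add: outer_vector power2_eq_square inner_commute)

text \<open>The quadratic form of the curvature matrix under a perturbation \<open>\<eta> q\<^sup>2\<close> of the height, where
  \<open>q = r\<^sup>2 - |\<xi>|\<^sup>2\<close>. Its gradient \<open>-4 \<eta> q \<xi>\<close> and its Hessian \<open>\<eta> (8 \<xi> \<xi>\<^sup>T - 4 q I)\<close> contribute errors
  of order \<open>\<eta> q\<close>, except for the rank-one part of the Hessian.\<close>

lemma scaled_curvature_barrier:
  fixes H H' :: "real^'n^'n"
  defines "L \<equiv> \<lambda>P :: real. (3 + 2*P) * P\<^sup>2 + 2*P"
  assumes bnds: "0 < e" "e \<le> v" "v \<le> U" "U \<le> v + \<eta> * q\<^sup>2" "v \<le> S" "U \<le> S'" "0 \<le> q" "0 < r" "\<xi> \<bullet> \<xi> + q = r\<^sup>2"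
      "0 < \<eta>"
    and p: "norm p \<le> P" "norm p' \<le> P" "p' = p - (4 * \<eta> * q) *\<^sub>R \<xi>"
    and sym: "transpose H = H"
    and le: "\<And>z. z \<bullet> (H *v z) + \<eta> * (8 * (\<xi> \<bullet> z)\<^sup>2 - 4 * q * (z \<bullet> z)) \<le> z \<bullet> (H' *v z)"
    and h: "\<And>z. norm (H *v z) \<le> h * norm z"
  shows "y \<bullet> ((scaled_curvature p v H + (8 * e * \<eta>) *\<^sub>R outer (slope_gamma p' *v \<xi>)) *v y)
      - (r\<^sup>2 * h + 8 * S * h * L P * r + 4 * S') * (\<eta> * q) * (y \<bullet> y)
    \<le> y \<bullet> (scaled_curvature p' U H' *v y)"
proof -
  let ?z' = "slope_gamma p' *v y" and ?z = "slope_gamma p *v y"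
  have h0: "0 \<le> h" 
  proof -
    have "0 \<le> h * norm (axis undefined 1 :: real^'n)" using h[of "axis undefined 1"] norm_ge_zero order_trans by blast
    thus ?thesis by (simp add: zero_le_mult_iff)
  qed
  have P0: "0 \<le> P" using p(1) norm_ge_zero order_trans by blast
  have pos: "0 < v" "0 < U" "0 < S" "0 < S'" using bnds by linarith+
  have qr: "q \<le> r\<^sup>2" using bnds(9) inner_ge_zero[of \<xi>] by linarith
  have "norm \<xi> ^ 2 \<le> r\<^sup>2" using bnds by (simp add: power2_norm_eq_inner)
  hence xr: "norm \<xi> \<le> r" using \<open>0 < r\<close> by (simp add: power2_le_iff_abs_le)
  have zy: "?z' \<bullet> ?z' \<le> y \<bullet> y" "norm ?z' \<le> norm y" "norm ?z \<le> norm y"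
    using norm_slope_gamma_le[of p' y] norm_slope_gamma_le[of p y] by (auto simp: norm_le)
  have form: "\<bar>a \<bullet> (H *v b)\<bar> \<le> norm a * (h * norm b)" for a b
    using Cauchy_Schwarz_ineq2[of a "H *v b"] mult_left_mono[OF h[of b] norm_ge_zero[of a]] by linarith
  \<comment> \<open>Change of the height in front of the Hessian term.\<close>
  have 1: "- (r\<^sup>2 * h * (\<eta> * q) * (y \<bullet> y)) \<le> (U - v) * (?z' \<bullet> (H *v ?z'))"
  proof -
    have "\<bar>(U - v) * (?z' \<bullet> (H *v ?z'))\<bar> = (U - v) * \<bar>?z' \<bullet> (H *v ?z')\<bar>"
      using bnds by (simp add: abs_mult)
    also have "\<dots> \<le> (\<eta> * q * r\<^sup>2) * (norm y * (h * norm y))"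
    proof (rule mult_mono)
      have "U - v \<le> \<eta> * q * q" using bnds by (simp add: power2_eq_square)
      also have "\<dots> \<le> \<eta> * q * r\<^sup>2" using qr bnds by (intro mult_left_mono) auto
      finally show "U - v \<le> \<eta> * q * r\<^sup>2" .
      show "\<bar>?z' \<bullet> (H *v ?z')\<bar> \<le> norm y * (h * norm y)"
        using form[of ?z' ?z'] mult_mono[OF zy(2) mult_left_mono[OF zy(2) h0]] h0 by simp
      show "0 \<le> \<eta> * q * r\<^sup>2" using bnds by simp
    qed auto
    also have "\<dots> = r\<^sup>2 * h * (\<eta> * q) * (y \<bullet> y)"
      by (simp add: dot_square_norm power2_eq_square)
    finally show ?thesis by linarith
  qed
  \<comment> \<open>Change of the gradient.\<close>
  have 2: "- (8 * S * h * L P * r * (\<eta> * q) * (y \<bullet> y)) \<le> v * (?z' \<bullet> (H *v ?z') - ?z \<bullet> (H *v ?z))"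
  proof -
    have eq: "?z' \<bullet> (H *v ?z') - ?z \<bullet> (H *v ?z) = (?z' - ?z) \<bullet> (H *v (?z' + ?z))"
    proof -
      have "?z' \<bullet> (H *v ?z) = ?z \<bullet> (H *v ?z')"
        using symmetric_inner[OF sym, of ?z' ?z] by (simp only: inner_commute)
      thus ?thesis by (simp add: matrix_vector_right_distrib inner_diff_left inner_add_right)
    qed
    have "norm (?z' - ?z) \<le> L P * norm (p' - p) * norm y"
      unfolding L_def by (rule slope_gamma_lipschitz[OF p(2,1)])
    also have "norm (p' - p) = 4 * \<eta> * q * norm \<xi>"
      using p(3) bnds by simp
    also have "L P * (4 * \<eta> * q * norm \<xi>) * norm y \<le> L P * (4 * \<eta> * q * r) * norm y"
      using xr bnds P0 by (intro mult_right_mono mult_left_mono) (auto simp: L_def)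
    finally have dz: "norm (?z' - ?z) \<le> L P * (4 * \<eta> * q * r) * norm y" .
    have sz: "norm (?z' + ?z) \<le> 2 * norm y"
      using norm_triangle_ineq[of ?z' ?z] zy by linarith
    have "\<bar>?z' \<bullet> (H *v ?z') - ?z \<bullet> (H *v ?z)\<bar> \<le> (L P * (4 * \<eta> * q * r) * norm y) * (h * (2 * norm y))"
      unfolding eq
      using form[of "?z' - ?z" "?z' + ?z"] mult_mono[OF dz mult_left_mono[OF sz h0]] h0 dz norm_ge_zero[of "?z' - ?z"]
      by (smt (verit) mult_nonneg_nonneg norm_ge_zero)
    hence "v * \<bar>?z' \<bullet> (H *v ?z') - ?z \<bullet> (H *v ?z)\<bar> \<le> S * ((L P * (4 * \<eta> * q * r) * norm y) * (h * (2 * norm y)))"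
      using bnds pos by (intro mult_mono) auto
    also have "\<dots> = 8 * S * h * L P * r * (\<eta> * q) * (y \<bullet> y)"
      by (simp add: dot_square_norm power2_eq_square)
    finally have "\<bar>v * (?z' \<bullet> (H *v ?z') - ?z \<bullet> (H *v ?z))\<bar> \<le> 8 * S * h * L P * r * (\<eta> * q) * (y \<bullet> y)"
      using pos by (simp add: abs_mult)
    thus ?thesis by linarith
  qed
  \<comment> \<open>The two parts of the Hessian of the perturbation.\<close>
  have 3: "- (4 * S' * (\<eta> * q) * (y \<bullet> y)) \<le> U * (\<eta> * (- 4 * q * (?z' \<bullet> ?z')))"
  proof -
    have "U * (\<eta> * (4 * q * (?z' \<bullet> ?z'))) \<le> S' * (\<eta> * (4 * q * (y \<bullet> y)))"
      using bnds pos zy(1) by (intro mult_mono mult_left_mono mult_nonneg_nonneg) auto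
    thus ?thesis by (simp add: algebra_simps)
  qed
  have 4: "8 * e * \<eta> * (\<xi> \<bullet> ?z')\<^sup>2 \<le> U * (\<eta> * (8 * (\<xi> \<bullet> ?z')\<^sup>2))"
  proof -
    have "e * (8 * \<eta> * (\<xi> \<bullet> ?z')\<^sup>2) \<le> U * (8 * \<eta> * (\<xi> \<bullet> ?z')\<^sup>2)"
      using bnds by (intro mult_right_mono) auto
    thus ?thesis by (simp add: algebra_simps)
  qed
  have 5: "U * (?z' \<bullet> (H *v ?z')) + U * (\<eta> * (8 * (\<xi> \<bullet> ?z')\<^sup>2)) + U * (\<eta> * (- 4 * q * (?z' \<bullet> ?z')))
      \<le> U * (?z' \<bullet> (H' *v ?z'))"
  proof -
    have "U * (?z' \<bullet> (H *v ?z') + \<eta> * (8 * (\<xi> \<bullet> ?z')\<^sup>2 - 4 * q * (?z' \<bullet> ?z'))) \<le> U * (?z' \<bullet> (H' *v ?z'))"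
      using le[of ?z'] pos by (intro mult_left_mono) auto
    thus ?thesis by (simp add: algebra_simps)
  qed
  have "\<xi> \<bullet> ?z' = (slope_gamma p' *v \<xi>) \<bullet> y"
    by (rule symmetric_inner[OF transpose_slope_gamma])
  hence lhs: "y \<bullet> ((scaled_curvature p v H + (8 * e * \<eta>) *\<^sub>R outer (slope_gamma p' *v \<xi>)) *v y)
      = y \<bullet> y + v * (?z \<bullet> (H *v ?z)) + 8 * e * \<eta> * (\<xi> \<bullet> ?z')\<^sup>2"
    by (simp add: matrix_vector_mult_add_rdistrib inner_add_right scaled_curvature_form outer_form
        flip: scaleR_matrix_vector_assoc)
  have rhs: "y \<bullet> (scaled_curvature p' U H' *v y) = y \<bullet> y + U * (?z' \<bullet> (H' *v ?z'))"
    by (rule scaled_curvature_form)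
  have split: "U * (?z' \<bullet> (H *v ?z'))
      = v * (?z \<bullet> (H *v ?z)) + v * (?z' \<bullet> (H *v ?z') - ?z \<bullet> (H *v ?z)) + (U - v) * (?z' \<bullet> (H *v ?z'))"
    by (simp add: algebra_simps)
  have split2: "(r\<^sup>2 * h + 8 * S * h * L P * r + 4 * S') * (\<eta> * q) * (y \<bullet> y)
      = r\<^sup>2 * h * (\<eta> * q) * (y \<bullet> y) + 8 * S * h * L P * r * (\<eta> * q) * (y \<bullet> y) + 4 * S' * (\<eta> * q) * (y \<bullet> y)"
    by (simp add: distrib_right)
  show ?thesis using 1 2 3 4 5 unfolding lhs rhs split2 split by linarith
qed

text \<open>The key inequality of the strong maximum principle: adding \<open>\<eta> q\<^sup>2\<close> to the height changes the
  speed by at least \<open>\<eta> (c |\<xi>|\<^sup>2 - C q)\<close>. The gain near the edge \<open>q = 0\<close> of the ball comes from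
  the rank-one part of the Hessian, by uniform strict monotonicity.\<close>

lemma speed_barrier_gain:
  fixes f :: "real^'n \<Rightarrow> real"
  assumes f: "curvature_function f" and "0 < \<sigma>" "\<sigma> < 1" and e: "0 < e" and m: "0 < m" and r: "0 < r"
    and P: "0 \<le> P" and h: "0 \<le> h" and S: "0 < S" and M: "0 < M"
  obtains C c \<eta>0 where "0 < C" "0 < c" "0 < \<eta>0"
    "\<And>v U q \<xi> \<eta> p p' H H'. \<lbrakk>e \<le> v; v \<le> U; U \<le> v + \<eta> * q\<^sup>2; v \<le> S; 0 \<le> q; \<xi> \<bullet> \<xi> + q = r\<^sup>2; 0 < \<eta>; \<eta> \<le> \<eta>0;
       p' = p - (4 * \<eta> * q) *\<^sub>R \<xi>; norm p \<le> P; transpose H = H; transpose H' = H';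
       \<And>z. z \<bullet> (H *v z) + \<eta> * (8 * (\<xi> \<bullet> z)\<^sup>2 - 4 * q * (z \<bullet> z)) \<le> z \<bullet> (H' *v z);
       \<And>z. norm (H *v z) \<le> h * norm z;
       \<And>y. m * (y \<bullet> y) \<le> y \<bullet> (scaled_curvature p v H *v y);
       \<And>y. y \<bullet> (scaled_curvature p v H *v y) \<le> M * (y \<bullet> y)\<rbrakk>
     \<Longrightarrow> speed f \<sigma> p v H + \<eta> * (c * (\<xi> \<bullet> \<xi>) - C * q) \<le> speed f \<sigma> p' U H'"
proof -
  obtain g where g: "0 < g" 
    "\<And>A y t. \<lbrakk>transpose A = A; \<And>z. m * (z \<bullet> z) \<le> z \<bullet> (A *v z); \<And>z. z \<bullet> (A *v z) \<le> M * (z \<bullet> z);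
      0 \<le> t; t * (y \<bullet> y) \<le> 1\<rbrakk>
      \<Longrightarrow> spectral_value f A + g * (t * (y \<bullet> y)) \<le> spectral_value f (A + t *\<^sub>R outer y)"
    using spectral_value_rank_one_gain[OF f m, of M] by metis
  define P1 where "P1 = P + 1"
  define W where "W = 1 + P1"
  define C1 where "C1 = r\<^sup>2 * h + 8 * S * h * ((3 + 2*P1) * P1\<^sup>2 + 2*P1) * r + 4 * (S + 1)"
  define C2 where "C2 = C1 / m * (M + 1)"
  define c2 where "c2 = g * (8 * e) / W\<^sup>2"
  define C where "C = S * C2 + (r\<^sup>2 * W + 4 * S * r)"
  define c where "c = e * c2"
  \<comment> \<open>The entries bound, in this order, the height increase, the gradient change, the relative
      error of the quadratic form, and the size of the rank-one term.\<close>
  define \<eta>0 where "\<eta>0 = Min {1 / (r^4 + 1), 1 / (4 * r^3 + 1), m / (2 * (C1 * r\<^sup>2)), 1 / (8 * e * r\<^sup>2 + 1)}"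
  have W: "0 < W" using P by (simp add: W_def P1_def)
  have C1: "0 < C1"
    unfolding C1_def using h S r P by (intro add_nonneg_pos add_nonneg_nonneg mult_nonneg_nonneg) (auto simp: P1_def)
  have C2: "0 < C2" using C1 m M by (simp add: C2_def)
  have c2: "0 < c2" using g(1) e W by (simp add: c2_def)
  have C: "0 < C" unfolding C_def using S C2 W r by (intro add_pos_pos mult_pos_pos) auto
  have c: "0 < c" using e c2 by (simp add: c_def)
  have \<eta>0: "0 < \<eta>0" using r e m C1 by (auto simp: \<eta>0_def intro!: divide_pos_pos add_nonneg_pos mult_nonneg_nonneg)
  show ?thesis
  proof (rule that[OF C c \<eta>0])
    fix v U q \<eta> :: real and \<xi> p p' :: "real^'n" and H H' :: "real^'n^'n"
    assume v: "e \<le> v" "v \<le> U" "U \<le> v + \<eta> * q\<^sup>2" "v \<le> S" and q: "0 \<le> q" "\<xi> \<bullet> \<xi> + q = r\<^sup>2"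
      and \<eta>: "0 < \<eta>" "\<eta> \<le> \<eta>0" and p': "p' = p - (4 * \<eta> * q) *\<^sub>R \<xi>" and p: "norm p \<le> P"
      and sym: "transpose H = H" "transpose H' = H'"
      and le: "\<And>z. z \<bullet> (H *v z) + \<eta> * (8 * (\<xi> \<bullet> z)\<^sup>2 - 4 * q * (z \<bullet> z)) \<le> z \<bullet> (H' *v z)"
      and hH: "\<And>z. norm (H *v z) \<le> h * norm z"
      and lo: "\<And>y. m * (y \<bullet> y) \<le> y \<bullet> (scaled_curvature p v H *v y)"
      and hi: "\<And>y. y \<bullet> (scaled_curvature p v H *v y) \<le> M * (y \<bullet> y)"
    have small: "\<eta> * (r^4 + 1) \<le> 1" "\<eta> * (4 * r^3 + 1) \<le> 1" "\<eta> * (2 * (C1 * r\<^sup>2)) \<le> m" "\<eta> * (8 * e * r\<^sup>2 + 1) \<le> 1"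
    proof -
      have "\<eta> \<le> 1 / (r^4 + 1)" "\<eta> \<le> 1 / (4 * r^3 + 1)" "\<eta> \<le> m / (2 * (C1 * r\<^sup>2))" "\<eta> \<le> 1 / (8 * e * r\<^sup>2 + 1)"
        using \<eta>(2) by (auto simp: \<eta>0_def)
      moreover have "0 < r^4 + 1" "0 < 4 * r^3 + 1" "0 < 2 * (C1 * r\<^sup>2)" "0 < 8 * e * r\<^sup>2 + 1"
        using r e C1 by (auto intro!: add_nonneg_pos)
      ultimately show "\<eta> * (r^4 + 1) \<le> 1" "\<eta> * (4 * r^3 + 1) \<le> 1" "\<eta> * (2 * (C1 * r\<^sup>2)) \<le> m" "\<eta> * (8 * e * r\<^sup>2 + 1) \<le> 1"
        by (simp_all only: pos_le_divide_eq)
    qed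
    have qr: "q \<le> r\<^sup>2" using q inner_ge_zero[of \<xi>] by linarith
    have "norm \<xi> ^ 2 \<le> r\<^sup>2" using q by (simp add: power2_norm_eq_inner)
    hence xr: "norm \<xi> \<le> r" using r by (simp add: power2_le_iff_abs_le)
    have US: "U \<le> S + 1"
    proof -
      have "\<eta> * q\<^sup>2 \<le> \<eta> * (r\<^sup>2)\<^sup>2" using \<eta> q qr by (intro mult_left_mono power_mono) auto
      also have "\<dots> \<le> 1" using small(1) \<eta> by (simp add: distrib_left flip: power_mult)
      finally show ?thesis using v by linarith
    qed
    have dp: "norm (p' - p) = 4 * \<eta> * q * norm \<xi>" using p' \<eta> q by simp
    have dpr: "4 * \<eta> * q * norm \<xi> \<le> 4 * \<eta> * q * r" using xr \<eta> q by (intro mult_left_mono) auto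
    have pP1: "norm p \<le> P1" "norm p' \<le> P1"
    proof -
      have "4 * \<eta> * q * r \<le> 4 * \<eta> * r\<^sup>2 * r" using qr \<eta> r by (intro mult_right_mono mult_left_mono) auto
      also have "\<dots> = \<eta> * (4 * r^3)" by (simp add: power2_eq_square power3_eq_cube)
      also have "\<dots> \<le> 1" using small(2) \<eta> by (simp add: distrib_left)
      finally have "norm (p' - p) \<le> 1" using dp dpr by linarith
      thus "norm p \<le> P1" "norm p' \<le> P1" using p norm_triangle_ineq2[of p' p] by (auto simp: P1_def)
    qed
    have wW: "slope_w p' \<le> W" using slope_w_le[of p'] pP1 by (simp add: W_def)

    let ?F = "spectral_value f"
    let ?N = "scaled_curvature p v H" and ?N' = "scaled_curvature p' U H'"
    define t where "t = 8 * e * \<eta>"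
    define y0 where "y0 = slope_gamma p' *v \<xi>"
    let ?A = "?N + t *\<^sub>R outer y0"
    have t: "0 < t" using e \<eta> by (simp add: t_def)
    have y0: "\<xi> \<bullet> \<xi> / W\<^sup>2 \<le> y0 \<bullet> y0" "y0 \<bullet> y0 \<le> r\<^sup>2"
    proof -
      have "\<xi> \<bullet> \<xi> / W\<^sup>2 \<le> \<xi> \<bullet> \<xi> / (slope_w p')\<^sup>2"
        using wW slope_w_pos[of p'] W by (intro divide_left_mono power_mono mult_pos_pos) auto
      thus "\<xi> \<bullet> \<xi> / W\<^sup>2 \<le> y0 \<bullet> y0" using inner_slope_gamma_ge[of \<xi> p'] by (simp add: y0_def)
      have "y0 \<bullet> y0 \<le> \<xi> \<bullet> \<xi>" unfolding y0_def using norm_slope_gamma_le[of p' \<xi>] by (simp add: norm_le)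
      thus "y0 \<bullet> y0 \<le> r\<^sup>2" using q by linarith
    qed
    have ty0: "t * (y0 \<bullet> y0) \<le> 1"
    proof -
      have "t * (y0 \<bullet> y0) \<le> t * r\<^sup>2" using t y0 by (intro mult_left_mono) auto
      also have "\<dots> \<le> 1" using small(4) \<eta> by (simp add: t_def algebra_simps)
      finally show ?thesis .
    qed
    have symN: "transpose ?N = ?N" by (rule transpose_scaled_curvature[OF sym(1)])
    have symA: "transpose ?A = ?A" by (simp add: transpose_add transpose_scaleR symN transpose_outer)
    have Aform: "y \<bullet> (?A *v y) = y \<bullet> (?N *v y) + t * (y0 \<bullet> y)\<^sup>2" for y
      by (simp add: matrix_vector_mult_add_rdistrib inner_add_right outer_form
          flip: scaleR_matrix_vector_assoc)
    have loA: "m * (y \<bullet> y) \<le> y \<bullet> (?A *v y)" for y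
      using lo[of y] t by (simp add: Aform add_increasing2)
    have posA: "pos_definite ?A" by (rule pos_definite_lower_bound[OF symA m loA])
    have hiA: "y \<bullet> (?A *v y) \<le> (M + 1) * (y \<bullet> y)" for y
    proof -
      have "t * (y0 \<bullet> y)\<^sup>2 \<le> t * ((y0 \<bullet> y0) * (y \<bullet> y))"
        using t by (intro mult_left_mono Cauchy_Schwarz_ineq) auto
      also have "\<dots> = t * (y0 \<bullet> y0) * (y \<bullet> y)" by simp
      also have "\<dots> \<le> 1 * (y \<bullet> y)" using ty0 by (intro mult_right_mono) auto
      finally show ?thesis using hi[of y] by (simp add: Aform distrib_right)
    qed
    have FA: "?F ?A \<le> M + 1" by (rule spectral_value_le[OF f posA _ hiA]) (use M in simp)
    have gain: "?F ?N + g * (t * (y0 \<bullet> y0)) \<le> ?F ?A"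
      by (rule g(2)[OF symN lo hi less_imp_le[OF t] ty0])
    define \<theta> where "\<theta> = C1 * (\<eta> * q) / m"
    have \<theta>: "0 \<le> \<theta>" "\<theta> < 1"
    proof -
      show "0 \<le> \<theta>" using C1 \<eta> q m by (simp add: \<theta>_def)
      have "C1 * (\<eta> * q) \<le> C1 * (\<eta> * r\<^sup>2)" using C1 \<eta> qr by (intro mult_left_mono) auto
      also have "\<dots> < m" using small(3) m by (simp add: algebra_simps)
      finally show "\<theta> < 1" using m by (simp add: \<theta>_def)
    qed
    have form': "y \<bullet> (?A *v y) - C1 * (\<eta> * q) * (y \<bullet> y) \<le> y \<bullet> (?N' *v y)" for y
      unfolding C1_def t_def y0_def
      by (rule scaled_curvature_barrier[OF e v US q(1) r q(2) \<eta>(1) pP1 p' sym(1) le hH])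
    \<comment> \<open>An error \<open>\<theta> m |y|\<^sup>2\<close> is absorbed by the factor \<open>1 - \<theta>\<close>, which homogeneity takes out of \<open>F\<close>.\<close>
    have form: "y \<bullet> (((1 - \<theta>) *\<^sub>R ?A) *v y) \<le> y \<bullet> (?N' *v y)" for y
    proof -
      have "C1 * (\<eta> * q) * (y \<bullet> y) = \<theta> * (m * (y \<bullet> y))" using m by (simp add: \<theta>_def)
      also have "\<dots> \<le> \<theta> * (y \<bullet> (?A *v y))" using \<theta> loA by (intro mult_left_mono) auto
      finally have "y \<bullet> (?A *v y) - \<theta> * (y \<bullet> (?A *v y)) \<le> y \<bullet> (?N' *v y)" using form'[of y] by linarith
      thus ?thesis by (simp add: left_diff_distrib flip: scaleR_matrix_vector_assoc)
    qed
    have posA': "pos_definite ((1 - \<theta>) *\<^sub>R ?A)" using posA \<theta> by (intro pos_definite_scaleR) auto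
    have symN': "transpose ?N' = ?N'" by (rule transpose_scaled_curvature[OF sym(2)])
    have FN'pos: "0 < ?F ?N'"
      by (rule spectral_value_pos[OF f pos_definite_of_le[OF posA' symN' form]])
    have "(1 - \<theta>) * ?F ?A = ?F ((1 - \<theta>) *\<^sub>R ?A)"
      using \<theta> by (intro spectral_value_scaleR[OF f posA, symmetric]) auto
    also have "\<dots> \<le> ?F ?N'" by (rule spectral_value_mono[OF f posA' symN' form])
    finally have "?F ?A - \<theta> * ?F ?A \<le> ?F ?N'" by (simp add: left_diff_distrib)
    moreover have "\<theta> * ?F ?A \<le> \<eta> * (C2 * q)"
      using mult_left_mono[OF FA \<theta>(1)] by (simp add: \<theta>_def C2_def algebra_simps)
    moreover have "\<eta> * (c2 * (\<xi> \<bullet> \<xi>)) \<le> g * (t * (y0 \<bullet> y0))"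
    proof -
      have "g * (t * (\<xi> \<bullet> \<xi> / W\<^sup>2)) \<le> g * (t * (y0 \<bullet> y0))"
        using g(1) t y0 by (intro mult_left_mono) auto
      thus ?thesis by (simp add: c2_def t_def algebra_simps)
    qed
    ultimately have FN: "\<eta> * (c2 * (\<xi> \<bullet> \<xi>) - C2 * q) \<le> ?F ?N' - ?F ?N"
      using gain by (simp add: right_diff_distrib)
    have v0: "0 < v" using e v by linarith
    have "\<eta> * (c * (\<xi> \<bullet> \<xi>) - S * C2 * q) \<le> \<eta> * (v * (c2 * (\<xi> \<bullet> \<xi>) - C2 * q))"
    proof (rule mult_left_mono)
      have "e * (c2 * (\<xi> \<bullet> \<xi>)) \<le> v * (c2 * (\<xi> \<bullet> \<xi>))" using v c2 by (intro mult_right_mono) auto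
      moreover have "v * (C2 * q) \<le> S * (C2 * q)" using v C2 q by (intro mult_right_mono) auto
      ultimately show "c * (\<xi> \<bullet> \<xi>) - S * C2 * q \<le> v * (c2 * (\<xi> \<bullet> \<xi>) - C2 * q)"
        by (simp add: c_def algebra_simps)
    qed (use \<eta> in simp)
    also have "\<dots> \<le> v * (?F ?N' - ?F ?N)"
      using mult_left_mono[OF FN, of v] v0 by (simp add: algebra_simps)
    also have "\<dots> \<le> U * ?F ?N' - v * ?F ?N"
      using v FN'pos by (simp add: right_diff_distrib mult_right_mono)
    finally have main: "\<eta> * (c * (\<xi> \<bullet> \<xi>) - S * C2 * q) \<le> U * ?F ?N' - v * ?F ?N" .
    have "\<sigma> * (U * slope_w p' - v * slope_w p) \<le> \<eta> * ((r\<^sup>2 * W + 4 * S * r) * q)"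
    proof -
      have "U * slope_w p' - v * slope_w p = (U - v) * slope_w p' + v * (slope_w p' - slope_w p)"
        by (simp add: algebra_simps)
      also have "(U - v) * slope_w p' \<le> (\<eta> * q * r\<^sup>2) * W"
      proof (rule mult_mono)
        have "U - v \<le> \<eta> * q * q" using v by (simp add: power2_eq_square)
        also have "\<dots> \<le> \<eta> * q * r\<^sup>2" using qr q \<eta> by (intro mult_left_mono) auto
        finally show "U - v \<le> \<eta> * q * r\<^sup>2" .
      qed (use wW \<eta> q slope_w_pos[of p'] in auto)
      also have "v * (slope_w p' - slope_w p) \<le> S * (4 * \<eta> * q * r)"
      proof -
        have "v * (slope_w p' - slope_w p) \<le> v * (4 * \<eta> * q * r)"
          using slope_w_lipschitz[of p' p] dp dpr v0 by (intro mult_left_mono) auto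
        also have "\<dots> \<le> S * (4 * \<eta> * q * r)" using v \<eta> q r by (intro mult_right_mono) auto
        finally show ?thesis .
      qed
      finally have "U * slope_w p' - v * slope_w p \<le> \<eta> * ((r\<^sup>2 * W + 4 * S * r) * q)"
        by (simp add: algebra_simps)
      moreover have "0 \<le> \<eta> * ((r\<^sup>2 * W + 4 * S * r) * q)" using \<eta> W S r q by simp
      ultimately show ?thesis using \<open>0 < \<sigma>\<close> \<open>\<sigma> < 1\<close>
        by (smt (verit) mult_left_le_one_le mult_left_mono mult_nonneg_nonpos)
    qed
    with main show "speed f \<sigma> p v H + \<eta> * (c * (\<xi> \<bullet> \<xi>) - C * q) \<le> speed f \<sigma> p' U H'"
      by (simp add: speed_def C_def algebra_simps)
  qed
qed

section \<open>Second-order calculus\<close>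

text \<open>A pointwise notion, stable under linear combinations, which lets the second-derivative test
  be applied to differences of solutions and explicit barriers without computing the iterated
  partial derivatives of the difference.\<close>

definition second_order_at ::
    "(real^'n \<Rightarrow> real) \<Rightarrow> real^'n \<Rightarrow> real^'n \<Rightarrow> real^'n^'n \<Rightarrow> bool" where
  "second_order_at g x p H \<longleftrightarrow>
     (\<exists>G. (\<forall>\<^sub>F y in nhds x. (g has_derivative (\<lambda>h. G y \<bullet> h)) (at y)) \<and> G x = p \<and>
       (\<forall>v. ((\<lambda>y. G y \<bullet> v) has_derivative (\<lambda>h. v \<bullet> (H *v h))) (at x)))"

lemma second_order_at_diff:
  assumes "second_order_at g x p H" "second_order_at g' x p' H'"
  shows "second_order_at (\<lambda>y. g y - g' y) x (p - p') (H - H')"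
proof -
  obtain G where G: "\<forall>\<^sub>F y in nhds x. (g has_derivative (\<lambda>h. G y \<bullet> h)) (at y)" "G x = p"
      "\<And>v. ((\<lambda>y. G y \<bullet> v) has_derivative (\<lambda>h. v \<bullet> (H *v h))) (at x)"
    using assms(1) unfolding second_order_at_def by blast
  obtain G' where G': "\<forall>\<^sub>F y in nhds x. (g' has_derivative (\<lambda>h. G' y \<bullet> h)) (at y)" "G' x = p'"
      "\<And>v. ((\<lambda>y. G' y \<bullet> v) has_derivative (\<lambda>h. v \<bullet> (H' *v h))) (at x)"
    using assms(2) unfolding second_order_at_def by blast
  have "\<forall>\<^sub>F y in nhds x. ((\<lambda>y. g y - g' y) has_derivative (\<lambda>h. (G y - G' y) \<bullet> h)) (at y)"
    using G(1) G'(1) by eventually_elim (simp add: inner_diff_left has_derivative_diff)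
  moreover have "((\<lambda>y. (G y - G' y) \<bullet> v) has_derivative (\<lambda>h. v \<bullet> ((H - H') *v h))) (at x)" for v
    using has_derivative_diff[OF G(3) G'(3), of v v]
    by (simp add: inner_diff_left inner_diff_right matrix_vector_mult_diff_rdistrib)
  ultimately show ?thesis
    unfolding second_order_at_def using G(2) G'(2) by (intro exI[of _ "\<lambda>y. G y - G' y"]) auto
qed

lemma second_order_at_scale:
  assumes "second_order_at g x p H"
  shows "second_order_at (\<lambda>y. c * g y) x (c *\<^sub>R p) (c *\<^sub>R H)"
proof -
  obtain G where G: "\<forall>\<^sub>F y in nhds x. (g has_derivative (\<lambda>h. G y \<bullet> h)) (at y)" "G x = p"
      "\<And>v. ((\<lambda>y. G y \<bullet> v) has_derivative (\<lambda>h. v \<bullet> (H *v h))) (at x)"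
    using assms(1) unfolding second_order_at_def by blast
  have a: "\<forall>\<^sub>F y in nhds x. ((\<lambda>y. c * g y) has_derivative (\<lambda>h. (c *\<^sub>R G y) \<bullet> h)) (at y)"
    using G(1) by eventually_elim (simp add: has_derivative_mult_right)
  have b: "((\<lambda>y. (c *\<^sub>R G y) \<bullet> v) has_derivative (\<lambda>h. v \<bullet> ((c *\<^sub>R H) *v h))) (at x)" for v
    using has_derivative_mult_right[OF G(3), of c v]
    by (simp flip: scaleR_matrix_vector_assoc)
  show ?thesis
    unfolding second_order_at_def
    by (rule exI[of _ "\<lambda>y. c *\<^sub>R G y"], intro conjI allI) (rule a, simp add: G(2), rule b)
qed

lemma partial_deriv_expansion:
  assumes "g differentiable (at x)"
  shows "(g has_derivative (\<lambda>h. grad g x \<bullet> h)) (at x)"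
proof -
  have D: "(g has_derivative frechet_derivative g (at x)) (at x)"
    using assms by (simp add: frechet_derivative_works)
  have "frechet_derivative g (at x) h = grad g x \<bullet> h" for h
  proof -
    have "h = (\<Sum>i\<in>UNIV. h $ i *\<^sub>R axis i 1)"
      by (simp add: basis_expansion flip: scalar_mult_eq_scaleR)
    hence "frechet_derivative g (at x) h = frechet_derivative g (at x) (\<Sum>i\<in>UNIV. h $ i *\<^sub>R axis i 1)"
      by simp
    also have "\<dots> = (\<Sum>i\<in>UNIV. h $ i * frechet_derivative g (at x) (axis i 1))"
      using linear_frechet_derivative[OF assms] by (simp add: linear_sum linear_cmul)
    also have "\<dots> = grad g x \<bullet> h"
      by (simp add: grad_def partial_deriv_def inner_vec_def mult.commute)
    finally show ?thesis .
  qed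
  hence "frechet_derivative g (at x) = (\<lambda>h. grad g x \<bullet> h)" by auto
  with D show ?thesis by simp
qed

lemma Ck_on_2_derivatives:
  fixes g :: "real^'n \<Rightarrow> real"
  assumes g: "Ck_on 2 g S" and S: "open S" "x \<in> S"
  shows "(g has_derivative (\<lambda>h. grad g x \<bullet> h)) (at x)"
    and "((\<lambda>y. grad g y \<bullet> v) has_derivative (\<lambda>h. v \<bullet> (hess g x *v h))) (at x)"
proof -
  obtain f' where f': "\<And>x. x \<in> S \<Longrightarrow> (g has_derivative f' x) (at x)"
    and C1: "\<And>v. Ck_on 1 (\<lambda>x. f' x v) S"
    using g by (auto simp: numeral_2_eq_2)
  have diff: "g differentiable (at y)" if "y \<in> S" for y
    using f'[OF that] by (auto simp: differentiable_def)
  show "(g has_derivative (\<lambda>h. grad g x \<bullet> h)) (at x)"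
    by (rule partial_deriv_expansion[OF diff[OF S(2)]])
  have pd: "partial_deriv i g y = f' y (axis i 1)" if "y \<in> S" for i y
    using frechet_derivative_at[OF f'[OF that]] by (simp add: partial_deriv_def)
  have "partial_deriv i g differentiable (at x)" for i
  proof -
    obtain D where "((\<lambda>y. f' y (axis i 1)) has_derivative D) (at x)"
      using C1[of "axis i 1"] S(2) by auto
    hence "(partial_deriv i g has_derivative D) (at x)"
      by (rule has_derivative_transform_within_open[OF _ S]) (simp add: pd)
    thus ?thesis by (auto simp: differentiable_def)
  qed
  hence Di: "(partial_deriv i g has_derivative (\<lambda>h. grad (partial_deriv i g) x \<bullet> h)) (at x)" for i
    by (rule partial_deriv_expansion)
  have "((\<lambda>y. \<Sum>i\<in>UNIV. partial_deriv i g y * v $ i) has_derivative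
      (\<lambda>h. \<Sum>i\<in>UNIV. (grad (partial_deriv i g) x \<bullet> h) * v $ i)) (at x)"
    by (intro has_derivative_sum has_derivative_mult_left Di)
  moreover have "(\<Sum>i\<in>UNIV. partial_deriv i g y * v $ i) = grad g y \<bullet> v" for y
    by (simp add: grad_def inner_vec_def)
  moreover have "(\<Sum>i\<in>UNIV. (grad (partial_deriv i g) x \<bullet> h) * v $ i) = v \<bullet> (hess g x *v h)" for h
    by (simp add: grad_def inner_vec_def hess_def matrix_vector_mult_def mult.commute)
  ultimately show "((\<lambda>y. grad g y \<bullet> v) has_derivative (\<lambda>h. v \<bullet> (hess g x *v h))) (at x)"
    by simp
qed

lemma second_order_at_Ck_on_2:
  fixes g :: "real^'n \<Rightarrow> real"
  assumes g: "Ck_on 2 g S" and S: "open S" "x \<in> S"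
  shows "second_order_at g x (grad g x) (hess g x)"
proof -
  have "\<forall>\<^sub>F y in nhds x. y \<in> S" using S by (rule eventually_nhds_in_open)
  hence "\<forall>\<^sub>F y in nhds x. (g has_derivative (\<lambda>h. grad g y \<bullet> h)) (at y)"
    by eventually_elim (rule Ck_on_2_derivatives(1)[OF g S(1)])
  thus ?thesis
    unfolding second_order_at_def using Ck_on_2_derivatives(2)[OF g S] by blast
qed

text \<open>The spatial profile of the barrier: it vanishes together with its gradient on the sphere of radius \<open>r\<close>, and
  there its Hessian is the positive rank-one matrix \<open>8 \<xi> \<xi>\<^sup>T\<close> with \<open>\<xi> = x - x0\<close>.\<close>

lemma second_order_at_squared_defect:
  fixes x0 :: "real^'n" and r :: real
  defines "q \<equiv> \<lambda>y. r\<^sup>2 - (y - x0) \<bullet> (y - x0)"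
  shows "second_order_at (\<lambda>y. (q y)\<^sup>2) x (- (4 * q x) *\<^sub>R (x - x0))
    (8 *\<^sub>R outer (x - x0) - (4 * q x) *\<^sub>R mat 1)"
  unfolding second_order_at_def
proof (intro exI[of _ "\<lambda>y. - (4 * q y) *\<^sub>R (y - x0)"] conjI allI eventuallyI refl)
  fix y
  have q: "(q has_derivative (\<lambda>h. - 2 * ((y - x0) \<bullet> h))) (at y)" for y
    unfolding q_def by (auto intro!: derivative_eq_intros simp: inner_commute)
  show "((\<lambda>y. (q y)\<^sup>2) has_derivative (\<lambda>h. - (4 * q y) *\<^sub>R (y - x0) \<bullet> h)) (at y)"
    by (rule has_derivative_eq_rhs[OF has_derivative_power[OF q, of 2]])
      (auto simp: fun_eq_iff)
  fix v
  have "((\<lambda>y. - 4 * (q y * ((y - x0) \<bullet> v))) has_derivative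
      (\<lambda>h. - 4 * (q x * (h \<bullet> v) + - 2 * ((x - x0) \<bullet> h) * ((x - x0) \<bullet> v)))) (at x)"
    by (intro has_derivative_mult_right has_derivative_mult q) (auto intro!: derivative_eq_intros)
  moreover have "- 4 * (b * (h \<bullet> v) + - 2 * (\<xi> \<bullet> h) * (\<xi> \<bullet> v))
      = v \<bullet> ((8 *\<^sub>R outer \<xi> - (4 * b) *\<^sub>R mat 1) *v h)" for h \<xi> :: "real^'n" and b :: real
    by (simp add: matrix_vector_mult_diff_rdistrib inner_diff_right outer_vector mat_scaleR_vector
        inner_commute[of v] flip: scaleR_matrix_vector_assoc)
  ultimately show "((\<lambda>y. - (4 * q y) *\<^sub>R (y - x0) \<bullet> v) has_derivative
      (\<lambda>h. v \<bullet> ((8 *\<^sub>R outer (x - x0) - (4 * q x) *\<^sub>R mat 1) *v h))) (at x)"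
    by (simp add: mult.assoc)
qed

lemma second_derivative_test_1d:
  fixes \<phi> \<phi>' :: "real \<Rightarrow> real"
  assumes "0 < d" and der: "\<And>t. \<bar>t\<bar> < d \<Longrightarrow> (\<phi> has_real_derivative \<phi>' t) (at t)"
    and der2: "(\<phi>' has_real_derivative D) (at 0)" and min: "\<And>t. \<bar>t\<bar> < d \<Longrightarrow> \<phi> 0 \<le> \<phi> t"
  shows "\<phi>' 0 = 0" and "0 \<le> D"
proof -
  show z: "\<phi>' 0 = 0"
    by (rule DERIV_local_min[OF der[of 0] \<open>0 < d\<close>]) (use \<open>0 < d\<close> min in auto)
  show "0 \<le> D"
  proof (rule ccontr)
    assume "\<not> 0 \<le> D"
    then obtain e where e: "0 < e" "\<And>h. 0 < h \<Longrightarrow> h < e \<Longrightarrow> \<phi>' h < 0"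
      using DERIV_neg_dec_right[OF der2] z by auto
    define s where "s = min d e / 2"
    have s: "0 < s" "s < d" "s < e" using \<open>0 < d\<close> e(1) by (auto simp: s_def)
    obtain t where t: "0 < t" "t < s" "\<phi> s - \<phi> 0 = (s - 0) * \<phi>' t"
      using MVT2[of 0 s \<phi> \<phi>'] der s by auto
    have "\<phi>' t < 0" using e(2) t s by simp
    hence "(s - 0) * \<phi>' t < 0" using s(1) by (simp add: mult_pos_neg)
    moreover have "\<bar>s\<bar> < d" using s by linarith
    ultimately show False using t(3) min[of s] by linarith
  qed
qed

theorem second_order_at_local_minimum:
  assumes g: "second_order_at g x p H" and min: "\<forall>\<^sub>F y in nhds x. g x \<le> g y"
  shows "p = 0" and "0 \<le> z \<bullet> (H *v z)"
proof -
  obtain G where G: "\<forall>\<^sub>F y in nhds x. (g has_derivative (\<lambda>h. G y \<bullet> h)) (at y)" "G x = p"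
      "\<And>v. ((\<lambda>y. G y \<bullet> v) has_derivative (\<lambda>h. v \<bullet> (H *v h))) (at x)"
    using g unfolding second_order_at_def by blast
  have both: "p \<bullet> z = 0 \<and> 0 \<le> z \<bullet> (H *v z)" for z
  proof -
    have "((\<lambda>t. x + t *\<^sub>R z) \<longlongrightarrow> x + 0 *\<^sub>R z) (nhds 0)"
      by (intro tendsto_intros filterlim_ident)
    hence lim: "filterlim (\<lambda>t. x + t *\<^sub>R z) (nhds x) (nhds 0)" by simp
    have "\<forall>\<^sub>F t in nhds 0. (g has_derivative (\<lambda>h. G (x + t *\<^sub>R z) \<bullet> h)) (at (x + t *\<^sub>R z))
        \<and> g x \<le> g (x + t *\<^sub>R z)"
      using filterlim_iff[THEN iffD1, OF lim, rule_format, OF eventually_conj[OF G(1) min]] .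
    then obtain d where d: "0 < d"
      "\<And>t::real. \<bar>t\<bar> < d \<Longrightarrow> (g has_derivative (\<lambda>h. G (x + t *\<^sub>R z) \<bullet> h)) (at (x + t *\<^sub>R z))"
      "\<And>t::real. \<bar>t\<bar> < d \<Longrightarrow> g x \<le> g (x + t *\<^sub>R z)"
      unfolding eventually_nhds_metric by (auto simp: dist_real_def)
    have line: "((\<lambda>t. x + t *\<^sub>R z) has_derivative (\<lambda>h. h *\<^sub>R z)) (at t)" for t
      by (auto intro!: derivative_eq_intros)
    have 1: "((\<lambda>t. g (x + t *\<^sub>R z)) has_real_derivative G (x + t *\<^sub>R z) \<bullet> z) (at t)" if "\<bar>t\<bar> < d" for t
      using has_derivative_compose[OF line d(2)[OF that]]
      by (simp add: has_field_derivative_def mult.commute[of _ "G (x + t *\<^sub>R z) \<bullet> z"])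
    have "((\<lambda>y. G y \<bullet> z) has_derivative (\<lambda>h. z \<bullet> (H *v h))) (at (x + 0 *\<^sub>R z))" using G(3)[of z] by simp
    from has_derivative_compose[OF line this]
    have 2: "((\<lambda>t. G (x + t *\<^sub>R z) \<bullet> z) has_real_derivative z \<bullet> (H *v z)) (at 0)"
      by (simp add: has_field_derivative_def matrix_vector_mult_scaleR mult.commute[of _ "z \<bullet> (H *v z)"])
    show ?thesis
      using second_derivative_test_1d[of d "\<lambda>t. g (x + t *\<^sub>R z)" "\<lambda>t. G (x + t *\<^sub>R z) \<bullet> z", OF d(1) 1 2]
        d(3) G(2) by simp
  qed
  have "p \<bullet> p = 0" using both by blast
  thus "p = 0" by simp
  show "0 \<le> z \<bullet> (H *v z)" using both by blast
qed

text \<open>Space-time extrema may be attained at the last time considered, so only the past of \<open>t\<close> is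
  compared.\<close>

lemma deriv_nonpos_at_right_endpoint_minimum:
  fixes g :: "real \<Rightarrow> real"
  assumes "(g has_real_derivative D) (at t within A)" "a < t" "{a..t} \<subseteq> A"
    and "\<And>s. a \<le> s \<Longrightarrow> s \<le> t \<Longrightarrow> g t \<le> g s"
  shows "D \<le> 0"
proof (rule ccontr)
  assume "\<not> D \<le> 0"
  then obtain d where d: "d > 0" "\<And>h. 0 < h \<Longrightarrow> t - h \<in> A \<Longrightarrow> h < d \<Longrightarrow> g (t - h) < g t"
    using has_real_derivative_pos_inc_left[OF assms(1)] by auto
  define h where "h = min d (t - a) / 2"
  have h: "0 < h" "h < d" "h < t - a" using d(1) assms(2) by (auto simp: h_def)
  have "t - h \<in> {a..t}" using h by simp
  hence "t - h \<in> A" using assms(3) by blast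
  from d(2)[OF h(1) this h(2)] assms(4)[of "t - h"] h show False by simp
qed

lemma partial_deriv_cong:
  assumes "open S" "x \<in> S" "\<And>y. y \<in> S \<Longrightarrow> g y = h y"
  shows "partial_deriv i g x = partial_deriv i h x"
proof -
  have "(g has_derivative D) (at x) \<longleftrightarrow> (h has_derivative D) (at x)" for D
    using has_derivative_transform_within_open[OF _ assms(1,2), of g D UNIV h]
      has_derivative_transform_within_open[OF _ assms(1,2), of h D UNIV g] assms(3) by auto
  thus ?thesis by (simp add: partial_deriv_def frechet_derivative_def)
qed

lemma principal_curvatures_cong:
  assumes "open S" "x \<in> S" "\<And>y. y \<in> S \<Longrightarrow> g y = h y"
  shows "principal_curvatures g x = principal_curvatures h x"
proof -
  have 1: "partial_deriv i g y = partial_deriv i h y" if "y \<in> S" for i y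
    using partial_deriv_cong[OF assms(1) that assms(3)] by simp
  have 2: "partial_deriv j (partial_deriv i g) x = partial_deriv j (partial_deriv i h) x" for i j
    using partial_deriv_cong[OF assms(1,2) 1] by simp
  have gr: "grad g x = grad h x" by (simp add: grad_def 1[OF assms(2)])
  have w: "graph_w g x = graph_w h x" by (simp add: graph_w_def gr)
  show ?thesis
    by (simp add: principal_curvatures_def curvature_matrix_def graph_gamma_def hess_def w
        1[OF assms(2)] 2 assms(2,3))
qed

lemma norm_matrix_vector_le:
  fixes A :: "real^'n^'m"
  shows "norm (A *v x) \<le> norm A * norm x"
proof -
  have "norm (A *v x) = L2_set (\<lambda>i. norm ((A *v x) $ i)) UNIV" by (simp add: norm_vec_def)
  also have "\<dots> \<le> L2_set (\<lambda>i. norm (A $ i) * norm x) UNIV"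
  proof (rule L2_set_mono)
    fix i
    have "(A *v x) $ i = A $ i \<bullet> x" by (simp add: matrix_vector_mult_def inner_vec_def)
    thus "norm ((A *v x) $ i) \<le> norm (A $ i) * norm x" using Cauchy_Schwarz_ineq2[of "A $ i" x] by simp
  qed simp
  also have "\<dots> = norm A * norm x" by (simp add: L2_set_left_distrib norm_vec_def)
  finally show ?thesis .
qed

lemma continuous_on_matrix_vector_mult:
  fixes A :: "'a::topological_space \<Rightarrow> real^'n^'m"
  assumes "continuous_on S A" "continuous_on S z"
  shows "continuous_on S (\<lambda>x. A x *v z x)"
proof -
  have eq: "(\<lambda>x. A x *v z x) = (\<lambda>x. \<chi> i. A x $ i \<bullet> z x)"
    by (auto simp: vec_eq_iff matrix_vector_mult_def inner_vec_def)
  show ?thesis unfolding eq using assms by (intro continuous_intros)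
qed

section \<open>The flow: elementary properties and a priori bounds\<close>

lemma time_interval_downward: "t \<in> time_interval T \<Longrightarrow> 0 \<le> s \<Longrightarrow> s \<le> t \<Longrightarrow> s \<in> time_interval T"
  unfolding time_interval_def by (auto intro: le_less_trans[of "ereal s" "ereal t"])

lemma time_interval_segment: "t \<in> time_interval T \<Longrightarrow> {0..t} \<subseteq> time_interval T"
  using time_interval_downward by auto

lemma time_interval_extend:
  assumes "t \<in> time_interval T"
  obtains t' where "t < t'" "t' \<in> time_interval T"
proof -
  have "ereal t < T" using assms by (simp add: time_interval_def)
  then obtain t' where "ereal t < ereal t'" "ereal t' < T" using ereal_dense2 by blast
  thus ?thesis using that assms by (auto simp: time_interval_def)
qed

locale hyperbolic_graph_flow =
  fixes f :: "real^'n \<Rightarrow> real" and \<Omega> :: "(real^'n) set" and u0 :: "real^'n \<Rightarrow> real"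
    and u :: "real^'n \<Rightarrow> real \<Rightarrow> real" and \<sigma> \<epsilon> :: real and T :: ereal
  assumes curv: "curvature_function f" and domain: "bounded_smooth_domain \<Omega>"
    and sigma: "0 < \<sigma>" "\<sigma> < 1" and eps: "0 < \<epsilon>" and T: "0 < T"
    and initial: "initial_graph \<Omega> u0" and flow: "flow_solution f \<sigma> \<Omega> T u0 \<epsilon> u"
    and adm: "admissible \<Omega> T u"
    and initial_speed: "\<forall>x\<in>\<Omega>. f (principal_curvatures (\<lambda>y. u0 y + \<epsilon>) x) > \<sigma>"
begin

abbreviation J :: "real set" where "J \<equiv> time_interval T"

definition Du :: "real^'n \<Rightarrow> real \<Rightarrow> real^'n" where "Du x t = grad (\<lambda>y. u y t) x"

definition D2u :: "real^'n \<Rightarrow> real \<Rightarrow> real^'n^'n" where "D2u x t = hess (\<lambda>y. u y t) x"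

text \<open>The time derivative of the flow, expressed through the spatial derivatives.\<close>

definition u_speed :: "real^'n \<Rightarrow> real \<Rightarrow> real" where
  "u_speed x t = speed f \<sigma> (Du x t) (u x t) (D2u x t)"

lemma zero_J: "0 \<in> J"
  using T by (simp add: time_interval_def zero_ereal_def)

lemma J_nonneg: "t \<in> J \<Longrightarrow> 0 \<le> t"
  by (simp add: time_interval_def)

lemma open_domain: "open \<Omega>" and bounded_domain: "bounded \<Omega>"
  using domain by (auto simp: bounded_smooth_domain_def)

lemma closure_cases: "x \<in> closure \<Omega> \<Longrightarrow> x \<in> \<Omega> \<or> x \<in> frontier \<Omega>"
  using open_domain by (auto simp: frontier_def interior_open)

lemma u_continuous: "continuous_on (closure \<Omega> \<times> J) (\<lambda>(x, t). u x t)"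
  using flow by (simp add: flow_solution_def classical_regularity_def)

lemma u_continuous_compose:
  assumes "continuous_on S g" "continuous_on S h" "\<And>z. z \<in> S \<Longrightarrow> g z \<in> closure \<Omega>" "\<And>z. z \<in> S \<Longrightarrow> h z \<in> J"
  shows "continuous_on S (\<lambda>z. u (g z) (h z))"
  using continuous_on_compose2[OF u_continuous, of S "\<lambda>z. (g z, h z)"] assms
  by (auto intro: continuous_on_Pair)

lemma u_C2: "t \<in> J \<Longrightarrow> Ck_on 2 (\<lambda>x. u x t) \<Omega>"
  using flow by (simp add: flow_solution_def classical_regularity_def)

lemma u_boundary: "x \<in> frontier \<Omega> \<Longrightarrow> t \<in> J \<Longrightarrow> u x t = \<epsilon>"
  using flow by (simp add: flow_solution_def)

lemma u_initial: "x \<in> \<Omega> \<Longrightarrow> u x 0 = u0 x + \<epsilon>"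
  using flow by (simp add: flow_solution_def)

lemma u_initial_ge: "x \<in> \<Omega> \<Longrightarrow> \<epsilon> < u x 0"
  using initial by (simp add: u_initial initial_graph_def)

lemma u_pos: "x \<in> \<Omega> \<Longrightarrow> t \<in> J \<Longrightarrow> 0 < u x t"
  using adm by (simp add: admissible_def)

lemma u_second_order: "x \<in> \<Omega> \<Longrightarrow> t \<in> J \<Longrightarrow> second_order_at (\<lambda>y. u y t) x (Du x t) (D2u x t)"
  unfolding Du_def D2u_def by (rule second_order_at_Ck_on_2[OF u_C2 open_domain])

text \<open>Half the Hessian of \<open>|x|\<^sup>2 + u\<^sup>2\<close> is the matrix in the definition of admissibility, so this function
  is locally strictly convex.\<close>

lemma admissible_form:
  assumes x: "x \<in> \<Omega>" "t \<in> J"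
  shows "transpose (D2u x t) = D2u x t"
    and "z \<noteq> 0 \<Longrightarrow> 0 < z \<bullet> z + (Du x t \<bullet> z)\<^sup>2 + u x t * (z \<bullet> (D2u x t *v z))"
proof -
  define B where "B = (\<chi> i j. (if i = j then 1 else 0)
          + partial_deriv i (\<lambda>y. u y t) x * partial_deriv j (\<lambda>y. u y t) x
          + u x t * hess (\<lambda>y. u y t) x $ i $ j)"
  have "pos_definite B" using adm x by (simp add: admissible_def B_def)
  moreover have B: "B = mat 1 + outer (Du x t) + u x t *\<^sub>R D2u x t"
    by (simp add: B_def mat_def outer_def Du_def grad_def D2u_def vec_eq_iff)
  ultimately have pd: "pos_definite (mat 1 + outer (Du x t) + u x t *\<^sub>R D2u x t)" by simp
  hence "u x t *\<^sub>R transpose (D2u x t) = u x t *\<^sub>R D2u x t"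
    by (simp add: pos_definite_def transpose_add transpose_mat transpose_outer transpose_scaleR)
  thus "transpose (D2u x t) = D2u x t" using u_pos[OF x] by simp
  assume "z \<noteq> 0"
  hence "0 < z \<bullet> ((mat 1 + outer (Du x t) + u x t *\<^sub>R D2u x t) *v z)"
    using pd by (simp add: pos_definite_def)
  thus "0 < z \<bullet> z + (Du x t \<bullet> z)\<^sup>2 + u x t * (z \<bullet> (D2u x t *v z))"
    by (simp add: matrix_vector_mult_add_rdistrib inner_add_right outer_form
        flip: scaleR_matrix_vector_assoc)
qed

lemma pos_definite_u_curvature:
  "x \<in> \<Omega> \<Longrightarrow> t \<in> J \<Longrightarrow> pos_definite (scaled_curvature (Du x t) (u x t) (D2u x t))"
  using admissible_form by (intro pos_definite_scaled_curvature)

lemma u_speed_eq: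
  assumes x: "x \<in> \<Omega>" "t \<in> J"
  shows "u_speed x t
    = u x t * slope_w (Du x t) * (f (principal_curvatures (\<lambda>y. u y t) x) - \<sigma>)"
  using curvature_function_principal_curvatures[OF curv
      pos_definite_u_curvature[OF x, unfolded Du_def D2u_def]]
  by (simp add: u_speed_def speed_def Du_def D2u_def algebra_simps)

lemma u_speed_pos_iff:
  assumes x: "x \<in> \<Omega>" "t \<in> J"
  shows "0 < u_speed x t \<longleftrightarrow> \<sigma> < f (principal_curvatures (\<lambda>y. u y t) x)"
proof -
  have "0 < u x t * slope_w (Du x t)" using u_pos[OF x] slope_w_pos[of "Du x t"] by simp
  from mult_less_cancel_left_pos[OF this, of 0] show ?thesis by (simp add: u_speed_eq[OF x])
qed

lemma u_time_derivative:
  assumes "x \<in> \<Omega>" "t \<in> J"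
  shows "(u x has_real_derivative u_speed x t) (at t within J)"
proof -
  have "graph_w (\<lambda>y. u y t) x = slope_w (Du x t)"
    by (simp add: graph_w_def slope_w_def Du_def)
  moreover have "(u x has_real_derivative
      u x t * graph_w (\<lambda>y. u y t) x * (f (principal_curvatures (\<lambda>y. u y t) x) - \<sigma>)) (at t within J)"
    using flow assms unfolding flow_solution_def by blast
  ultimately show ?thesis by (simp add: u_speed_eq[OF assms])
qed

lemma u_speed_initial: "x \<in> \<Omega> \<Longrightarrow> 0 < u_speed x 0"
proof -
  assume x: "x \<in> \<Omega>"
  have "principal_curvatures (\<lambda>y. u y 0) x = principal_curvatures (\<lambda>y. u0 y + \<epsilon>) x"
    by (rule principal_curvatures_cong[OF open_domain x]) (rule u_initial)
  thus ?thesis using initial_speed x by (simp add: u_speed_pos_iff[OF x zero_J])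
qed

text \<open>At an interior minimum of the height the graph is horizontal and convex, so it moves up.\<close>

lemma u_ge_eps:
  assumes "x \<in> closure \<Omega>" "t \<in> J"
  shows "\<epsilon> \<le> u x t"
proof (rule ccontr)
  assume neg: "\<not> \<epsilon> \<le> u x t"
  have tJ: "{0..t} \<subseteq> J" by (rule time_interval_segment[OF assms(2)])
  let ?K = "closure \<Omega> \<times> {0..t}"
  have "compact ?K" using bounded_domain by (intro compact_Times) (simp_all add: compact_closure)
  moreover have xt: "(x, t) \<in> ?K" using assms J_nonneg by auto
  hence "?K \<noteq> {}" by blast
  moreover have "continuous_on ?K (\<lambda>(x, t). u x t)"
    using tJ by (intro continuous_on_subset[OF u_continuous]) auto
  ultimately obtain z where z: "z \<in> ?K" "\<forall>w\<in>?K. (case z of (x, t) \<Rightarrow> u x t) \<le> (case w of (x, t) \<Rightarrow> u x t)"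
    using continuous_attains_inf[of ?K "\<lambda>(x, t). u x t"] by blast
  obtain y s where ys: "z = (y, s)" by (cases z)
  have y: "y \<in> closure \<Omega>" and s: "0 \<le> s" "s \<le> t" using z(1) ys by auto
  have min: "u y s \<le> u y' s'" if "y' \<in> closure \<Omega>" "0 \<le> s'" "s' \<le> t" for y' s'
    using bspec[OF z(2), of "(y', s')"] that ys by auto
  have sJ: "s \<in> J" using s tJ by auto
  have "u y s < \<epsilon>" using min[of x t] assms J_nonneg neg by auto
  hence y\<Omega>: "y \<in> \<Omega>" using closure_cases[OF y] u_boundary[OF _ sJ] by auto
  have "s \<noteq> 0" using u_initial_ge[OF y\<Omega>] \<open>u y s < \<epsilon>\<close> by auto
  have "\<forall>\<^sub>F y' in nhds y. y' \<in> \<Omega>" using open_domain y\<Omega> by (rule eventually_nhds_in_open)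
  hence ev: "\<forall>\<^sub>F y' in nhds y. u y s \<le> u y' s"
    by eventually_elim (use min s closure_subset in auto)
  note loc = second_order_at_local_minimum[OF u_second_order[OF y\<Omega> sJ] ev]
  have "0 < u_speed y s"
    unfolding u_speed_def loc(1)
    by (rule speed_at_minimum[OF curv sigma(2) u_pos[OF y\<Omega> sJ] admissible_form(1)[OF y\<Omega> sJ] loc(2)])
  moreover have "u_speed y s \<le> 0"
    by (rule deriv_nonpos_at_right_endpoint_minimum[OF u_time_derivative[OF y\<Omega> sJ], of 0])
      (use s \<open>s \<noteq> 0\<close> tJ min y in auto)
  ultimately show False by simp
qed

text \<open>Along a ray inside \<open>\<Omega>\<close> the slope of the convex function \<open>(|x|\<^sup>2 + u\<^sup>2) / 2\<close> is at most its mean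
  slope up to the exit point, and there \<open>u\<close> takes its minimal value \<open>\<epsilon>\<close>. Hence \<open>u |Du|\<close> is at most
  twice the radius \<open>R\<close> of a ball around the origin containing \<open>\<Omega>\<close>.\<close>

lemma u_gradient_bound:
  obtains P where "0 \<le> P" "\<And>x t. x \<in> \<Omega> \<Longrightarrow> t \<in> J \<Longrightarrow> norm (Du x t) \<le> P"
proof -
  obtain R where R: "0 < R" "\<And>x. x \<in> closure \<Omega> \<Longrightarrow> norm x \<le> R"
    using bounded_closure[OF bounded_domain] unfolding bounded_pos by blast
  have dir: "u x t * (Du x t \<bullet> e) \<le> 2 * R" if x: "x \<in> \<Omega>" "t \<in> J" and e: "norm e = 1" for x t e
  proof -
    have "x \<in> interior \<Omega>" using x open_domain by (simp add: interior_open)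
    moreover have "e \<noteq> 0" using e by auto
    ultimately obtain d where d: "0 < d" "x + d *\<^sub>R e \<in> frontier \<Omega>"
      "\<And>s. 0 \<le> s \<Longrightarrow> s < d \<Longrightarrow> x + s *\<^sub>R e \<in> interior \<Omega>"
      using ray_to_frontier[OF bounded_domain] by blast
    have inside: "x + s *\<^sub>R e \<in> \<Omega>" if "0 \<le> s" "s < d" for s
      using d(3)[OF that] interior_subset by blast
    have ee: "e \<bullet> e = 1" using e by (simp add: dot_square_norm)
    let ?c = "\<lambda>s. x + s *\<^sub>R e"
    define \<phi> where "\<phi> s = (?c s \<bullet> ?c s + (u (?c s) t)\<^sup>2) / 2" for s
    define \<phi>1 where "\<phi>1 s = ?c s \<bullet> e + u (?c s) t * (Du (?c s) t \<bullet> e)" for s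
    define \<phi>2 where "\<phi>2 s = e \<bullet> e + (Du (?c s) t \<bullet> e)\<^sup>2 + u (?c s) t * (e \<bullet> (D2u (?c s) t *v e))" for s
    have line: "(?c has_derivative (\<lambda>h. h *\<^sub>R e)) (at s)" for s
      by (auto intro!: derivative_eq_intros)
    have du: "((\<lambda>s. u (?c s) t) has_real_derivative Du (?c s) t \<bullet> e) (at s)" if "0 \<le> s" "s < d" for s
      using has_derivative_compose[OF line
          Ck_on_2_derivatives(1)[OF u_C2[OF x(2)] open_domain inside[OF that]]]
      by (simp add: has_field_derivative_def Du_def mult.commute[of _ "grad _ _ \<bullet> e"])
    have dDu: "((\<lambda>s. Du (?c s) t \<bullet> e) has_real_derivative e \<bullet> (D2u (?c s) t *v e)) (at s)"
      if "0 \<le> s" "s < d" for s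
      using has_derivative_compose[OF line
          Ck_on_2_derivatives(2)[OF u_C2[OF x(2)] open_domain inside[OF that], of e]]
      by (simp add: has_field_derivative_def Du_def D2u_def matrix_vector_mult_scaleR
          mult.commute[of _ "e \<bullet> _"])
    have dcc: "((\<lambda>s. ?c s \<bullet> ?c s) has_real_derivative 2 * (?c s \<bullet> e)) (at s)" for s
      unfolding has_field_derivative_def
      by (auto intro!: derivative_eq_intros simp: fun_eq_iff inner_commute algebra_simps)
    have dce: "((\<lambda>s. ?c s \<bullet> e) has_real_derivative e \<bullet> e) (at s)" for s
      unfolding has_field_derivative_def
      by (auto intro!: derivative_eq_intros simp: fun_eq_iff)
    have d1: "(\<phi> has_real_derivative \<phi>1 s) (at s)" if "0 \<le> s" "s < d" for s
      unfolding \<phi>_def \<phi>1_def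
      by (rule DERIV_cong[OF DERIV_cdivide[OF DERIV_add[OF dcc DERIV_power[OF du[OF that], of 2]], of 2]]) simp
    have d2: "(\<phi>1 has_real_derivative \<phi>2 s) (at s)" if "0 \<le> s" "s < d" for s
      unfolding \<phi>1_def \<phi>2_def
      by (rule DERIV_cong[OF DERIV_add[OF dce DERIV_mult[OF du[OF that] dDu[OF that]]]])
        (simp add: power2_eq_square algebra_simps)
    have pos: "0 \<le> \<phi>2 s" if "0 \<le> s" "s < d" for s
      using admissible_form(2)[OF inside[OF that] x(2) \<open>e \<noteq> 0\<close>] by (simp add: \<phi>2_def)
    have "?c s \<in> closure \<Omega>" if "s \<in> {0..d}" for s
    proof (cases "s = d")
      case True
      thus ?thesis using d(2) by (simp add: frontier_def)
    next
      case False
      thus ?thesis using inside[of s] that closure_subset by auto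
    qed
    hence "continuous_on {0..d} \<phi>"
      unfolding \<phi>_def using x(2) by (intro continuous_intros u_continuous_compose) auto
    moreover have "\<phi> differentiable (at s)" if "0 < s" "s < d" for s
      using d1[of s] that real_differentiable_def by auto
    ultimately obtain D s where s: "0 < s" "s < d" "DERIV \<phi> s :> D" "\<phi> d - \<phi> 0 = (d - 0) * D"
      using MVT[OF d(1)] by blast
    have "D = \<phi>1 s" using DERIV_unique[OF s(3) d1] s by simp
    moreover have "\<phi>1 0 \<le> \<phi>1 s"
    proof (rule DERIV_nonneg_imp_nondecreasing[of 0 s \<phi>1])
      show "\<exists>y. (\<phi>1 has_real_derivative y) (at s') \<and> 0 \<le> y" if "0 \<le> s'" "s' \<le> s" for s'
        using d2[of s'] pos[of s'] that s by auto
    qed (use s in simp)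
    ultimately have "d * \<phi>1 0 \<le> \<phi> d - \<phi> 0" using s(4) d(1) by simp
    also have "\<phi> d - \<phi> 0 \<le> (?c d \<bullet> ?c d - x \<bullet> x) / 2"
    proof -
      have "u (?c d) t = \<epsilon>" by (rule u_boundary[OF d(2) x(2)])
      moreover have "\<epsilon>\<^sup>2 \<le> (u x t)\<^sup>2"
        using u_ge_eps[OF _ x(2), of x] x(1) closure_subset eps by (intro power_mono) auto
      ultimately show ?thesis by (simp add: \<phi>_def field_simps)
    qed
    also have "\<dots> = d * ((?c d \<bullet> e + x \<bullet> e) / 2)"
      by (simp add: inner_add_left inner_add_right ee inner_commute[of e x] algebra_simps)
    finally have "\<phi>1 0 \<le> (?c d \<bullet> e + x \<bullet> e) / 2" using d(1) by simp
    hence "u x t * (Du x t \<bullet> e) \<le> (?c d \<bullet> e - x \<bullet> e) / 2" by (simp add: \<phi>1_def field_simps)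
    moreover have ne: "\<bar>y \<bullet> e\<bar> \<le> R" if "y \<in> closure \<Omega>" for y
      using Cauchy_Schwarz_ineq2[of y e] R(2)[OF that] e by simp
    have "\<bar>?c d \<bullet> e\<bar> \<le> R" "\<bar>x \<bullet> e\<bar> \<le> R"
      using ne[of "?c d"] ne[of x] d(2) x(1) closure_subset by (auto simp: frontier_def)
    from abs_le_D1[OF this(1)] abs_le_D2[OF this(2)] have "(?c d \<bullet> e - x \<bullet> e) / 2 \<le> R" by simp
    ultimately show ?thesis using R(1) by linarith
  qed
  show ?thesis
  proof (rule that[of "2 * R / \<epsilon>"])
    show "0 \<le> 2 * R / \<epsilon>" using R eps by simp
    fix x t assume x: "x \<in> \<Omega>" "t \<in> J"
    show "norm (Du x t) \<le> 2 * R / \<epsilon>"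
    proof (cases "Du x t = 0")
      case False
      define e where "e = (1 / norm (Du x t)) *\<^sub>R Du x t"
      have "norm e = 1" using False by (simp add: e_def)
      moreover have "Du x t \<bullet> e = norm (Du x t)"
        using False by (simp add: e_def dot_square_norm power2_eq_square)
      ultimately have "u x t * norm (Du x t) \<le> 2 * R" using dir[OF x, of e] by simp
      moreover have "\<epsilon> * norm (Du x t) \<le> u x t * norm (Du x t)"
        using u_ge_eps[OF _ x(2), of x] x(1) closure_subset by (intro mult_right_mono) auto
      ultimately show ?thesis using eps by (simp add: pos_le_divide_eq mult.commute)
    qed (use R eps in simp)
  qed
qed

section \<open>Monotonicity in time\<close>

text \<open>The drop \<open>u x s - u x t\<close>, damped by \<open>exp (- \<Lambda> t)\<close>, is maximised over \<^emph>\<open>both\<close> times \<open>s \<le> t\<close>; at a positive maximum the graph at time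
  \<open>s\<close> has nonnegative speed (at \<open>s = 0\<close> by assumption, later because \<open>u x\<close> is maximal at \<open>s\<close>),
  so no bound on second derivatives is needed in the comparison with the graph at time \<open>t\<close>.\<close>

theorem u_mono:
  assumes x: "x \<in> closure \<Omega>" and "0 \<le> s" "s \<le> t" "t \<in> J"
  shows "u x s \<le> u x t"
proof (rule ccontr)
  assume neg: "\<not> u x s \<le> u x t"
  have tJ: "{0..t} \<subseteq> J" by (rule time_interval_segment) fact
  obtain P where P: "0 \<le> P" "\<And>x t. x \<in> \<Omega> \<Longrightarrow> t \<in> J \<Longrightarrow> norm (Du x t) \<le> P"
    using u_gradient_bound by blast
  define \<Lambda> where "\<Lambda> = \<sigma> * (1 + P) + 1"
  define g where "g = (\<lambda>z. exp (- \<Lambda> * snd (snd z)) * (u (fst z) (fst (snd z)) - u (fst z) (snd (snd z))))"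
  define K where "K = closure \<Omega> \<times> {z \<in> {0..t} \<times> {0..t}. fst z \<le> snd z}"
  have "compact {z \<in> {0..t} \<times> {0..t}. fst z \<le> snd z}"
  proof -
    have "closed {z::real\<times>real. fst z \<le> snd z}" by (intro closed_Collect_le continuous_intros)
    hence "compact (({0..t} \<times> {0..t}) \<inter> {z. fst z \<le> snd z})"
      by (intro compact_Int_closed compact_Times) auto
    moreover have "({0..t} \<times> {0..t}) \<inter> {z. fst z \<le> snd z} = {z \<in> {0..t} \<times> {0..t}. fst z \<le> snd z}" by auto
    ultimately show ?thesis by simp
  qed
  hence "compact K" unfolding K_def using bounded_domain by (intro compact_Times) (simp_all add: compact_closure)
  moreover have xst: "(x, s, t) \<in> K" using assms by (auto simp: K_def)
  hence "K \<noteq> {}" by blast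
  moreover have "continuous_on K g"
    unfolding g_def using tJ
    by (intro continuous_intros u_continuous_compose) (auto simp: K_def)
  ultimately obtain z where z: "z \<in> K" "\<forall>w\<in>K. g w \<le> g z"
    using continuous_attains_sup[of K g] by blast
  obtain y a b where yab: "z = (y, a, b)" by (cases z) auto
  have y: "y \<in> closure \<Omega>" and ab: "0 \<le> a" "a \<le> b" "b \<le> t" using z(1) yab by (auto simp: K_def)
  have max: "exp (- \<Lambda> * b') * (u y' a' - u y' b') \<le> exp (- \<Lambda> * b) * (u y a - u y b)"
    if "y' \<in> closure \<Omega>" "0 \<le> a'" "a' \<le> b'" "b' \<le> t" for y' a' b'
    using bspec[OF z(2), of "(y', a', b')"] that yab by (auto simp: K_def g_def)
  have aJ: "a \<in> J" and bJ: "b \<in> J" using ab tJ by auto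
  have "0 < exp (- \<Lambda> * t) * (u x s - u x t)" using neg by simp
  also have "\<dots> \<le> exp (- \<Lambda> * b) * (u y a - u y b)" by (rule max) (use assms in auto)
  finally have drop: "u y b < u y a" by (simp add: zero_less_mult_iff)
  hence "a \<noteq> b" by auto
  hence "a < b" using ab by simp
  have y\<Omega>: "y \<in> \<Omega>" using closure_cases[OF y] u_boundary[OF _ aJ] u_boundary[OF _ bJ] drop by auto
  have ev: "\<forall>\<^sub>F y' in nhds y. u y b - u y a \<le> u y' b - u y' a"
  proof -
    have "\<forall>\<^sub>F y' in nhds y. y' \<in> \<Omega>" using open_domain y\<Omega> by (rule eventually_nhds_in_open)
    thus ?thesis
    proof eventually_elim
      case (elim y')
      hence "exp (- \<Lambda> * b) * (u y' a - u y' b) \<le> exp (- \<Lambda> * b) * (u y a - u y b)"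
        using ab closure_subset by (intro max) auto
      thus ?case by simp
    qed
  qed
  note loc = second_order_at_local_minimum[OF
      second_order_at_diff[OF u_second_order[OF y\<Omega> bJ] u_second_order[OF y\<Omega> aJ]] ev]
  have grad: "Du y b = Du y a" using loc(1) by simp
  have hess: "w \<bullet> (D2u y a *v w) \<le> w \<bullet> (D2u y b *v w)" for w
    using loc(2)[of w] by (simp add: matrix_vector_mult_diff_rdistrib inner_diff_right)
  have speed_a: "0 \<le> u_speed y a"
  proof (cases "a = 0")
    case True
    thus ?thesis using u_speed_initial[OF y\<Omega>] by simp
  next
    case False
    have "- u_speed y a \<le> 0"
    proof (rule deriv_nonpos_at_right_endpoint_minimum)
      show "((\<lambda>s. - u y s) has_real_derivative - u_speed y a) (at a within J)"
        by (rule DERIV_minus[OF u_time_derivative[OF y\<Omega> aJ]])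
      show "- u y a \<le> - u y a'" if "0 \<le> a'" "a' \<le> a" for a'
        using max[OF y that(1), of b] that ab by simp
    qed (use ab False time_interval_segment[OF aJ] in auto)
    thus ?thesis by simp
  qed
  have "- \<sigma> * slope_w (Du y b) * (u y a - u y b) \<le> u_speed y b"
    unfolding u_speed_def
    by (rule speed_comparison[OF curv sigma(1) u_pos[OF y\<Omega> bJ] drop admissible_form(1)[OF y\<Omega> bJ]
          admissible_form(1)[OF y\<Omega> aJ] hess])
      (use pos_definite_u_curvature[OF y\<Omega> aJ] speed_a in \<open>simp_all add: grad u_speed_def\<close>)
  moreover have "\<sigma> * slope_w (Du y b) * (u y a - u y b) \<le> \<sigma> * (1 + P) * (u y a - u y b)"
    using slope_w_le[of "Du y b"] P(2)[OF y\<Omega> bJ] sigma drop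
    by (intro mult_right_mono mult_left_mono) auto
  ultimately have lower: "- (\<sigma> * (1 + P) * (u y a - u y b)) \<le> u_speed y b" by simp
  have "- (exp (- \<Lambda> * b) * (- \<Lambda> * (u y a - u y b) - u_speed y b)) \<le> 0"
  proof (rule deriv_nonpos_at_right_endpoint_minimum)
    show "((\<lambda>b'. - (exp (- \<Lambda> * b') * (u y a - u y b'))) has_real_derivative
        - (exp (- \<Lambda> * b) * (- \<Lambda> * (u y a - u y b) - u_speed y b))) (at b within J)"
      using u_time_derivative[OF y\<Omega> bJ]
      by (auto intro!: derivative_eq_intros simp: algebra_simps)
    show "- (exp (- \<Lambda> * b) * (u y a - u y b)) \<le> - (exp (- \<Lambda> * b') * (u y a - u y b'))"
      if "a \<le> b'" "b' \<le> b" for b'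
      using max[OF y ab(1) that(1)] that ab by simp
    show "{a..b} \<subseteq> J" using time_interval_segment[OF bJ] ab by auto
  qed fact
  hence "u_speed y b \<le> - \<Lambda> * (u y a - u y b)" by (simp add: zero_le_mult_iff)
  with lower have "u y a - u y b \<le> 0" by (simp add: \<Lambda>_def algebra_simps)
  thus False using drop by simp
qed

section \<open>Strict monotonicity in time\<close>

lemma Du_continuous: "continuous_on (\<Omega> \<times> J) (\<lambda>(x, t). Du x t)"
proof -
  have i: "continuous_on (\<Omega> \<times> J) (\<lambda>(x, t). partial_deriv i (\<lambda>y. u y t) x)" for i
    using flow unfolding flow_solution_def classical_regularity_def by blast
  have eq: "(\<lambda>(x, t). Du x t) = (\<lambda>z. \<chi> i. case z of (x, t) \<Rightarrow> partial_deriv i (\<lambda>y. u y t) x)"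
    by (auto simp: Du_def grad_def fun_eq_iff)
  show ?thesis unfolding eq by (intro continuous_on_vec_lambda i)
qed

lemma D2u_continuous: "continuous_on (\<Omega> \<times> J) (\<lambda>(x, t). D2u x t)"
  using flow unfolding flow_solution_def classical_regularity_def D2u_def by blast

text \<open>Away from the boundary of \<open>\<Omega>\<close> all quantities of the flow are bounded and admissibility is uniform,
  by continuity on compact sets.\<close>

lemma compact_bounds:
  assumes K: "compact K" "K \<subseteq> \<Omega> \<times> J" "K \<noteq> {}"
  obtains h S m where "0 \<le> h" "0 < S" "0 < m"
    "\<And>x t. (x, t) \<in> K \<Longrightarrow> norm (D2u x t) \<le> h"
    "\<And>x t. (x, t) \<in> K \<Longrightarrow> u x t \<le> S"
    "\<And>x t z. (x, t) \<in> K \<Longrightarrow> m * (z \<bullet> z) \<le> z \<bullet> z + (Du x t \<bullet> z)\<^sup>2 + u x t * (z \<bullet> (D2u x t *v z))"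
proof -
  have cu: "continuous_on K (\<lambda>z. u (fst z) (snd z))"
    using K(2) closure_subset[of \<Omega>]
    by (intro u_continuous_compose continuous_intros) (fastforce simp: subset_iff)+
  have cD: "continuous_on K (\<lambda>z. Du (fst z) (snd z))"
    using continuous_on_subset[OF Du_continuous K(2)] by (simp add: case_prod_unfold)
  have cH: "continuous_on K (\<lambda>z. D2u (fst z) (snd z))"
    using continuous_on_subset[OF D2u_continuous K(2)] by (simp add: case_prod_unfold)
  obtain h where h: "0 < h" "\<forall>w\<in>(\<lambda>z. D2u (fst z) (snd z)) ` K. norm w \<le> h"
    using compact_imp_bounded[OF compact_continuous_image[OF cH K(1)]] unfolding bounded_pos by blast
  obtain S where S: "0 < S" "\<forall>w\<in>(\<lambda>z. u (fst z) (snd z)) ` K. norm w \<le> S"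
    using compact_imp_bounded[OF compact_continuous_image[OF cu K(1)]] unfolding bounded_pos by blast
  define q where "q = (\<lambda>w :: ((real^'n) \<times> real) \<times> (real^'n). snd w \<bullet> snd w + (Du (fst (fst w)) (snd (fst w)) \<bullet> snd w)\<^sup>2
      + u (fst (fst w)) (snd (fst w)) * (snd w \<bullet> (D2u (fst (fst w)) (snd (fst w)) *v snd w)))"
  let ?KS = "K \<times> sphere (0 :: real^'n) 1"
  have "compact ?KS" using K(1) by (intro compact_Times) auto
  moreover obtain x t where "(x, t) \<in> K" using K(3) by auto
  hence "((x, t), axis undefined 1) \<in> ?KS" by (simp add: norm_axis_1)
  hence "?KS \<noteq> {}" by blast
  moreover have "continuous_on ?KS q"
    unfolding q_def
    by (intro continuous_intros continuous_on_matrix_vector_mult continuous_on_compose2[OF cD]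
        continuous_on_compose2[OF cu] continuous_on_compose2[OF cH]) auto
  ultimately obtain w where w: "w \<in> ?KS" "\<forall>w'\<in>?KS. q w \<le> q w'"
    using continuous_attains_inf[of ?KS q] by blast
  have form: "q w * (z \<bullet> z) \<le> z \<bullet> z + (Du x t \<bullet> z)\<^sup>2 + u x t * (z \<bullet> (D2u x t *v z))"
    if xt: "(x, t) \<in> K" for x t z
  proof (cases "z = 0")
    case False
    define e where "e = (1 / norm z) *\<^sub>R z"
    have "((x, t), e) \<in> ?KS" using xt False by (simp add: e_def)
    hence "q w \<le> q ((x, t), e)" using w(2) by blast
    hence "q w * (norm z)\<^sup>2 \<le> q ((x, t), e) * (norm z)\<^sup>2" by (intro mult_right_mono) auto
    also have "q ((x, t), e) * (norm z)\<^sup>2 = (norm z *\<^sub>R e) \<bullet> (norm z *\<^sub>R e) + (Du x t \<bullet> (norm z *\<^sub>R e))\<^sup>2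
        + u x t * ((norm z *\<^sub>R e) \<bullet> (D2u x t *v (norm z *\<^sub>R e)))"
      by (simp add: q_def matrix_vector_mult_scaleR power2_eq_square algebra_simps)
    also have "norm z *\<^sub>R e = z" using False by (simp add: e_def)
    finally show ?thesis by (simp add: power2_norm_eq_inner)
  qed simp
  have "0 < q w"
  proof -
    obtain x t z where xtz: "w = ((x, t), z)" by (metis surj_pair)
    have "z \<noteq> 0" "x \<in> \<Omega>" "t \<in> J" using w(1) xtz K(2) by auto
    thus ?thesis using admissible_form(2)[of x t z] by (simp add: q_def xtz)
  qed
  show ?thesis
    by (rule that[of h S "q w"]) (use h S \<open>0 < q w\<close> form in \<open>force+\<close>)
qed

text \<open>The initial speed is positive, hence bounded below near a compact set and for a short time; this
  passes to increments of \<open>u\<close> with a bound proportional to the elapsed time.\<close>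

lemma initial_increment:
  assumes B: "compact B" "B \<subseteq> \<Omega>" "B \<noteq> {}"
  obtains d h0 where "0 < d" "0 < h0"
    "\<And>x h. x \<in> B \<Longrightarrow> 0 \<le> h \<Longrightarrow> h < h0 \<Longrightarrow> h \<in> J \<Longrightarrow> d * h \<le> u x h - u x 0"
proof -
  have "classical_regularity \<Omega> T u" using flow by (simp add: flow_solution_def)
  hence "\<exists>v. continuous_on (\<Omega> \<times> J) (\<lambda>(x, t). v x t) \<and>
      (\<forall>x\<in>\<Omega>. \<forall>t\<in>J. (u x has_real_derivative v x t) (at t within J))"
    unfolding classical_regularity_def by (elim conjE)
  then obtain v where v: "continuous_on (\<Omega> \<times> J) (\<lambda>(x, t). v x t)"
    "\<And>x t. x \<in> \<Omega> \<Longrightarrow> t \<in> J \<Longrightarrow> (u x has_real_derivative v x t) (at t within J)"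
    by (elim exE conjE) simp
  obtain t1 where t1: "0 < t1" "t1 \<in> J" using time_interval_extend[OF zero_J] by blast
  have sub: "{0..t1} \<subseteq> J" by (rule time_interval_segment[OF t1(2)])
  have v0: "0 < v x 0" if "x \<in> \<Omega>" for x
  proof -
    have "v x 0 = u_speed x 0"
    proof (rule vector_derivative_unique_within_closed_interval[OF t1(1)])
      show "(u x has_vector_derivative v x 0) (at 0 within cbox 0 t1)"
        "(u x has_vector_derivative u_speed x 0) (at 0 within cbox 0 t1)"
        using DERIV_subset[OF v(2)[OF that zero_J] sub]
          DERIV_subset[OF u_time_derivative[OF that zero_J] sub]
        by (simp_all add: has_real_derivative_iff_has_vector_derivative)
    qed (use t1 in simp)
    thus ?thesis using u_speed_initial[OF that] by simp
  qed
  have cK: "continuous_on (B \<times> {0..t1}) (\<lambda>(x, t). v x t)"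
    using B sub by (intro continuous_on_subset[OF v(1)]) auto
  have "continuous_on B (\<lambda>x. v x 0)"
  proof -
    have "continuous_on B (\<lambda>x. (x, 0::real))" by (intro continuous_intros)
    moreover have "(\<lambda>x. (x, 0::real)) ` B \<subseteq> B \<times> {0..t1}" using t1(1) by auto
    ultimately show ?thesis using continuous_on_compose2[OF cK, of B "\<lambda>x. (x, 0)"] by simp
  qed
  from continuous_attains_inf[OF B(1,3) this]
  obtain x1 where x1: "x1 \<in> B" "\<And>x. x \<in> B \<Longrightarrow> v x1 0 \<le> v x 0" by blast
  define d where "d = v x1 0 / 2"
  have d: "0 < d" using v0 x1(1) B by (auto simp: d_def)
  have "uniformly_continuous_on (B \<times> {0..t1}) (\<lambda>(x, t). v x t)"
    using B(1) by (intro compact_uniformly_continuous cK compact_Times) auto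
  then obtain h0 where h0: "0 < h0"
    "\<And>z z'. z \<in> B \<times> {0..t1} \<Longrightarrow> z' \<in> B \<times> {0..t1} \<Longrightarrow> dist z' z < h0 \<Longrightarrow>
      dist (case z' of (x, t) \<Rightarrow> v x t) (case z of (x, t) \<Rightarrow> v x t) < d"
    using d unfolding uniformly_continuous_on_def by blast
  have vd: "d \<le> v x t" if "x \<in> B" "0 \<le> t" "t < h0" "t \<le> t1" for x t
  proof -
    have "dist (x, t) (x, 0) < h0" using that by (simp add: dist_Pair_Pair)
    hence "dist (v x t) (v x 0) < d" using h0(2)[of "(x, 0)" "(x, t)"] that t1 by auto
    hence "v x 0 - v x t < d" unfolding dist_real_def by linarith
    thus ?thesis using x1(2)[OF that(1)] by (simp add: d_def)
  qed
  show ?thesis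
  proof (rule that[of d "min h0 t1"])
    fix x h assume x: "x \<in> B" and h: "0 \<le> h" "h < min h0 t1" "h \<in> J"
    have x\<Omega>: "x \<in> \<Omega>" using x B by blast
    have "(u x has_derivative (*) (v x s)) (at s within {0..h})" if "0 \<le> s" "s \<le> h" for s
    proof -
      have "s \<in> J" by (rule time_interval_downward[OF h(3) that])
      from DERIV_subset[OF v(2)[OF x\<Omega> this] time_interval_segment[OF h(3)]]
      show ?thesis by (simp add: has_field_derivative_def)
    qed
    then obtain s where s: "s \<in> {0..h}" "u x h - u x 0 = v x s * (h - 0)"
      using mvt_very_simple[of 0 h "u x" "\<lambda>s. (*) (v x s)"] h(1) by auto
    have "d * h \<le> v x s * h" using vd[OF x, of s] s(1) h by (intro mult_right_mono) auto
    thus "d * h \<le> u x h - u x 0" using s(2) by simp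
  qed (use d h0 t1 in auto)
qed

text \<open>The decay rate \<open>(C + c)\<^sup>2 / (2 c r\<^sup>2)\<close> makes the discriminant in \<open>q\<close> negative. This is the balance in the
  strong maximum principle: near the edge \<open>q = 0\<close> of the ball the rank-one gain wins, elsewhere the
  decay in time does.\<close>

lemma barrier_quadratic_positive:
  fixes c C r q :: real
  assumes "0 < c" "0 < C" "0 < r"
  shows "0 < c * (r\<^sup>2 - q) - C * q + (C + c)\<^sup>2 / (2 * c * r\<^sup>2) * q\<^sup>2"
proof -
  have "0 < (c * r\<^sup>2 - (C + c) * q)\<^sup>2 + (c * r\<^sup>2)\<^sup>2"
    using assms by (intro add_nonneg_pos) auto
  hence "0 < ((c * r\<^sup>2 - (C + c) * q)\<^sup>2 + (c * r\<^sup>2)\<^sup>2) / (2 * c * r\<^sup>2)"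
    using assms by (intro divide_pos_pos) auto
  also have "\<dots> = c * (r\<^sup>2 - q) - C * q + (C + c)\<^sup>2 / (2 * c * r\<^sup>2) * q\<^sup>2"
    using assms by (simp add: field_simps power2_eq_square)
  finally show ?thesis .
qed

text \<open>Positivity of the speed propagates forward in time at a fixed point \<open>x0\<close>. On a ball around \<open>x0\<close> the increment \<open>u x (t + k) - u x t\<close> dominates
  \<open>k \<delta> exp (- \<Lambda> t) q\<^sup>2\<close> with \<open>q = r\<^sup>2 - |x - x0|\<^sup>2\<close>: it does so at time \<open>0\<close>, it is nonnegative on the
  edge of the ball where the barrier vanishes, and inside, a negative minimum of the difference
  contradicts the gain computed in \<open>speed_barrier_gain\<close>. Since \<open>\<delta>\<close> does not depend on \<open>k\<close>, the
  bound passes to the time derivative.\<close>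

theorem u_speed_pos:
  assumes x0: "x0 \<in> \<Omega>" and t0J: "t0 \<in> J"
  shows "0 < u_speed x0 t0"
proof (cases "t0 = 0")
  case True
  thus ?thesis using u_speed_initial[OF x0] by simp
next
  case False
  hence t0: "0 < t0" using J_nonneg[OF t0J] by simp
  obtain r where r: "0 < r" "cball x0 r \<subseteq> \<Omega>"
    using open_domain x0 by (meson open_contains_cball)
  let ?B = "cball x0 r"
  obtain t1 where t1: "t0 < t1" "t1 \<in> J" using time_interval_extend[OF t0J] by blast
  have sub: "{0..t1} \<subseteq> J" by (rule time_interval_segment[OF t1(2)])
  have Bcl: "?B \<subseteq> closure \<Omega>" using r(2) closure_subset by blast
  obtain P where P: "0 \<le> P" "\<And>x t. x \<in> \<Omega> \<Longrightarrow> t \<in> J \<Longrightarrow> norm (Du x t) \<le> P"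
    using u_gradient_bound by blast
  obtain h S m' where bnd: "0 \<le> h" "0 < S" "0 < m'"
    "\<And>x t. (x, t) \<in> ?B \<times> {0..t1} \<Longrightarrow> norm (D2u x t) \<le> h"
    "\<And>x t. (x, t) \<in> ?B \<times> {0..t1} \<Longrightarrow> u x t \<le> S"
    "\<And>x t z. (x, t) \<in> ?B \<times> {0..t1} \<Longrightarrow> m' * (z \<bullet> z) \<le> z \<bullet> z + (Du x t \<bullet> z)\<^sup>2 + u x t * (z \<bullet> (D2u x t *v z))"
  proof (rule compact_bounds[of "?B \<times> {0..t1}"])
    show "compact (?B \<times> {0..t1})" by (intro compact_Times) auto
    show "?B \<times> {0..t1} \<subseteq> \<Omega> \<times> J" using r(2) sub by auto
    show "?B \<times> {0..t1} \<noteq> {}" using r(1) t0 t1 by auto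
  qed (use that in blast)
  define m where "m = m' / (1 + P)\<^sup>2"
  define M where "M = 1 + S * h"
  have m: "0 < m" using bnd P by (simp add: m_def)
  have M: "0 < M" using bnd by (simp add: M_def add_pos_nonneg)
  have lo: "m * (y \<bullet> y) \<le> y \<bullet> (scaled_curvature (Du x t) (u x t) (D2u x t) *v y)"
    if x: "x \<in> ?B" "0 \<le> t" "t \<le> t1" for x t y
  proof -
    let ?p = "Du x t" and ?z = "slope_gamma (Du x t) *v y"
    have "x \<in> \<Omega>" "t \<in> J" using x r(2) sub by auto
    have "slope_w ?p \<le> 1 + P" using slope_w_le[of ?p] P(2)[OF \<open>x \<in> \<Omega>\<close> \<open>t \<in> J\<close>] by simp
    hence "y \<bullet> y / (1 + P)\<^sup>2 \<le> y \<bullet> y / (slope_w ?p)\<^sup>2"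
      using slope_w_pos[of ?p] P(1) by (intro divide_left_mono power_mono mult_pos_pos) auto
    also have "\<dots> \<le> ?z \<bullet> ?z" by (rule inner_slope_gamma_ge)
    finally have "m' * (y \<bullet> y / (1 + P)\<^sup>2) \<le> m' * (?z \<bullet> ?z)" using bnd(3) by (intro mult_left_mono) auto
    also have "\<dots> \<le> ?z \<bullet> ?z + (?p \<bullet> ?z)\<^sup>2 + u x t * (?z \<bullet> (D2u x t *v ?z))"
      using bnd(6)[of x t ?z] x by simp
    also have "\<dots> = y \<bullet> (scaled_curvature ?p (u x t) (D2u x t) *v y)"
      by (simp add: scaled_curvature_form slope_gamma_isometry)
    finally show ?thesis by (simp add: m_def)
  qed
  have hD: "norm (D2u x t *v y) \<le> h * norm y" if x: "x \<in> ?B" "0 \<le> t" "t \<le> t1" for x t y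
    using norm_matrix_vector_le[of "D2u x t" y] mult_right_mono[OF bnd(4)[of x t] norm_ge_zero[of y]] x
    by simp
  have hi: "y \<bullet> (scaled_curvature (Du x t) (u x t) (D2u x t) *v y) \<le> M * (y \<bullet> y)"
    if x: "x \<in> ?B" "0 \<le> t" "t \<le> t1" for x t y
  proof -
    let ?z = "slope_gamma (Du x t) *v y"
    have "x \<in> \<Omega>" "t \<in> J" using x r(2) sub by auto
    have "?z \<bullet> (D2u x t *v ?z) \<le> norm ?z * norm (D2u x t *v ?z)" by (rule norm_cauchy_schwarz)
    also have "\<dots> \<le> norm y * (h * norm y)"
      using hD[OF x, of ?z] norm_slope_gamma_le[of "Du x t" y] bnd(1)
      by (intro mult_mono) (auto intro: order_trans mult_left_mono)
    finally have "?z \<bullet> (D2u x t *v ?z) \<le> h * (y \<bullet> y)" by (simp add: dot_square_norm power2_eq_square mult_ac)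
    hence "u x t * (?z \<bullet> (D2u x t *v ?z)) \<le> u x t * (h * (y \<bullet> y))"
      using u_pos[OF \<open>x \<in> \<Omega>\<close> \<open>t \<in> J\<close>] by (intro mult_left_mono) auto
    also have "\<dots> \<le> S * (h * (y \<bullet> y))" using bnd(5)[of x t] bnd(1) x by (intro mult_right_mono) auto
    finally show ?thesis by (simp add: scaled_curvature_form M_def algebra_simps)
  qed
  obtain C c \<eta>0 where gain: "0 < C" "0 < c" "0 < \<eta>0"
    "\<And>v U q \<xi> \<eta> p p' H H'. \<lbrakk>\<epsilon> \<le> v; v \<le> U; U \<le> v + \<eta> * q\<^sup>2; v \<le> S; 0 \<le> q; \<xi> \<bullet> \<xi> + q = r\<^sup>2; 0 < \<eta>; \<eta> \<le> \<eta>0;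
       p' = p - (4 * \<eta> * q) *\<^sub>R \<xi>; norm p \<le> P; transpose H = H; transpose H' = H';
       \<And>z. z \<bullet> (H *v z) + \<eta> * (8 * (\<xi> \<bullet> z)\<^sup>2 - 4 * q * (z \<bullet> z)) \<le> z \<bullet> (H' *v z);
       \<And>z. norm (H *v z) \<le> h * norm z;
       \<And>y. m * (y \<bullet> y) \<le> y \<bullet> (scaled_curvature p v H *v y);
       \<And>y. y \<bullet> (scaled_curvature p v H *v y) \<le> M * (y \<bullet> y)\<rbrakk>
     \<Longrightarrow> speed f \<sigma> p v H + \<eta> * (c * (\<xi> \<bullet> \<xi>) - C * q) \<le> speed f \<sigma> p' U H'"
    using speed_barrier_gain[OF curv sigma eps m r(1) P(1) bnd(1,2) M] by metis
  define \<Lambda> where "\<Lambda> = (C + c)\<^sup>2 / (2 * c * r\<^sup>2)"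
  have \<Lambda>: "0 \<le> \<Lambda>" using gain by (simp add: \<Lambda>_def)
  obtain d h0 where d: "0 < d" "0 < h0"
    "\<And>x k. x \<in> ?B \<Longrightarrow> 0 \<le> k \<Longrightarrow> k < h0 \<Longrightarrow> k \<in> J \<Longrightarrow> d * k \<le> u x k - u x 0"
    using initial_increment[of ?B] r by (metis compact_cball cball_eq_empty not_less_iff_gr_or_eq)
  define \<delta> where "\<delta> = d / r^4"
  have \<delta>: "0 < \<delta>" using d r by (simp add: \<delta>_def)
  \<comment> \<open>For \<open>k < h1\<close> all times \<open>t + k\<close> lie in \<open>[0, t1]\<close>, the initial bound holds and the amplitude of the
      barrier is below \<open>\<eta>0\<close>.\<close>
  define h1 where "h1 = min (min h0 (t1 - t0)) (\<eta>0 / \<delta>)"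
  have h1: "0 < h1" using d t1 gain \<delta> by (simp add: h1_def)
  define q where "q x = r\<^sup>2 - (x - x0) \<bullet> (x - x0)" for x
  have q: "0 \<le> q x" "q x \<le> r\<^sup>2" if "x \<in> ?B" for x
  proof -
    have "(norm (x - x0))\<^sup>2 \<le> r\<^sup>2" using that by (intro power_mono) (auto simp: dist_norm norm_minus_commute)
    thus "0 \<le> q x" "q x \<le> r\<^sup>2" by (simp_all add: q_def power2_norm_eq_inner)
  qed
  have barrier: "k * \<delta> * exp (- \<Lambda> * t0) * (q x0)\<^sup>2 \<le> u x0 (t0 + k) - u x0 t0" if k: "0 < k" "k < h1" for k
  proof (rule ccontr)
    assume neg: "\<not> ?thesis"
    define \<eta> where "\<eta> t = k * \<delta> * exp (- \<Lambda> * t)" for t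
    have \<eta>: "0 < \<eta> t" for t using k \<delta> by (simp add: \<eta>_def)
    have \<eta>le: "\<eta> t \<le> \<eta>0" if "0 \<le> t" for t
    proof -
      have "\<eta> t \<le> k * \<delta> * 1" unfolding \<eta>_def using k \<delta> \<Lambda> that by (intro mult_left_mono) auto
      also have "k < \<eta>0 / \<delta>" using k by (simp add: h1_def)
      hence "k * \<delta> * 1 \<le> \<eta>0" using \<delta> by (simp add: field_simps)
      finally show ?thesis .
    qed
    have kt: "t \<in> J" "t + k \<in> J" "t + k \<le> t1" if "0 \<le> t" "t \<le> t0" for t
      using that k t1 sub by (auto simp: h1_def)
    define Z where "Z = (\<lambda>z. u (fst z) (snd z + k) - u (fst z) (snd z) - \<eta> (snd z) * (q (fst z))\<^sup>2)"
    let ?K = "?B \<times> {0..t0}"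
    have "compact ?K" by (intro compact_Times) auto
    moreover have x0K: "(x0, t0) \<in> ?K" using r t0 by simp
    hence "?K \<noteq> {}" by blast
    moreover have "continuous_on ?K Z"
      unfolding Z_def \<eta>_def q_def using Bcl kt
      by (intro continuous_intros u_continuous_compose) auto
    ultimately obtain z where z: "z \<in> ?K" "\<forall>w\<in>?K. Z z \<le> Z w"
      using continuous_attains_inf[of ?K Z] by blast
    obtain x s where xs: "z = (x, s)" by (cases z)
    have x: "x \<in> ?B" and s: "0 \<le> s" "s \<le> t0" using z(1) xs by auto
    have min: "u x (s + k) - u x s - \<eta> s * (q x)\<^sup>2 \<le> u x' (s' + k) - u x' s' - \<eta> s' * (q x')\<^sup>2"
      if "x' \<in> ?B" "0 \<le> s'" "s' \<le> t0" for x' s'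
      using bspec[OF z(2), of "(x', s')"] that by (simp add: Z_def xs)
    have "u x0 (t0 + k) - u x0 t0 - \<eta> t0 * (q x0)\<^sup>2 < 0" using neg by (simp add: \<eta>_def)
    hence neg': "u x (s + k) - u x s - \<eta> s * (q x)\<^sup>2 < 0"
      using min[of x0 t0] r t0 by simp
    have x\<Omega>: "x \<in> \<Omega>" using x r(2) by blast
    note sJ = kt(1)[OF s] and skJ = kt(2)[OF s]
    \<comment> \<open>Weak monotonicity keeps the height at the later time between that of the graph and the barrier.\<close>
    have mono: "u x s \<le> u x (s + k)"
      using u_mono[of x s "s + k"] x Bcl s k skJ by auto
    have "q x \<noteq> 0" using neg' mono by auto
    hence "(x - x0) \<bullet> (x - x0) < r\<^sup>2" using q[OF x] by (simp add: q_def)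
    hence "norm (x - x0) < r" using r(1) by (simp add: norm_lt_square)
    hence xball: "x \<in> ball x0 r" by (simp add: dist_norm norm_minus_commute)
    have "s \<noteq> 0"
    proof
      assume "s = 0"
      have "\<eta> 0 * (q x)\<^sup>2 \<le> \<eta> 0 * (r\<^sup>2)\<^sup>2"
        using q[OF x] \<eta>[of 0] by (intro mult_left_mono power_mono) auto
      also have "\<dots> = d * k" using r by (simp add: \<eta>_def \<delta>_def flip: power_mult)
      also have "\<dots> \<le> u x k - u x 0" using d(3)[OF x, of k] k skJ \<open>s = 0\<close> by (simp add: h1_def)
      finally show False using neg' \<open>s = 0\<close> by simp
    qed
    define \<xi> where "\<xi> = x - x0"
    have \<xi>q: "\<xi> \<bullet> \<xi> + q x = r\<^sup>2" by (simp add: \<xi>_def q_def)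
    have ev: "\<forall>\<^sub>F x' in nhds x. u x (s + k) - u x s - \<eta> s * (r\<^sup>2 - (x - x0) \<bullet> (x - x0))\<^sup>2
        \<le> u x' (s + k) - u x' s - \<eta> s * (r\<^sup>2 - (x' - x0) \<bullet> (x' - x0))\<^sup>2"
    proof -
      have "\<forall>\<^sub>F x' in nhds x. x' \<in> ball x0 r" using xball by (intro eventually_nhds_in_open) auto
      thus ?thesis by eventually_elim (use min s in \<open>simp add: q_def\<close>)
    qed
    note loc = second_order_at_local_minimum[OF second_order_at_diff[OF second_order_at_diff[OF
          u_second_order[OF x\<Omega> skJ] u_second_order[OF x\<Omega> sJ]]
          second_order_at_scale[OF second_order_at_squared_defect]] ev]
    have grad: "Du x (s + k) = Du x s - (4 * \<eta> s * q x) *\<^sub>R \<xi>"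
      using loc(1) by (simp add: \<xi>_def q_def algebra_simps)
    have hess: "y \<bullet> (D2u x s *v y) + \<eta> s * (8 * (\<xi> \<bullet> y)\<^sup>2 - 4 * q x * (y \<bullet> y)) \<le> y \<bullet> (D2u x (s + k) *v y)" for y
      using loc(2)[of y, folded \<xi>_def]
      by (simp add: q_def[of x, folded \<xi>_def] matrix_vector_mult_diff_rdistrib inner_diff_right outer_form mat_scaleR_vector
          flip: scaleR_matrix_vector_assoc)
    have "u_speed x s + \<eta> s * (c * (\<xi> \<bullet> \<xi>) - C * q x) \<le> u_speed x (s + k)"
      unfolding u_speed_def
    proof (rule gain(4)[where q = "q x" and \<xi> = \<xi> and \<eta> = "\<eta> s"])
      show "\<epsilon> \<le> u x s" using u_ge_eps[of x s] x Bcl sJ by auto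
      show "u x (s + k) \<le> u x s + \<eta> s * (q x)\<^sup>2" using neg' by simp
      show "u x s \<le> S" using bnd(5) x s t1 by simp
      show "norm (D2u x s *v y) \<le> h * norm y" for y using hD x s t1 by simp
      show "m * (y \<bullet> y) \<le> y \<bullet> (scaled_curvature (Du x s) (u x s) (D2u x s) *v y)" for y
        using lo x s t1 by simp
      show "y \<bullet> (scaled_curvature (Du x s) (u x s) (D2u x s) *v y) \<le> M * (y \<bullet> y)" for y
        using hi x s t1 by simp
    qed (fact mono q(1)[OF x] \<xi>q \<eta> \<eta>le[OF s(1)] grad P(2)[OF x\<Omega> sJ] admissible_form(1)[OF x\<Omega> sJ]
        admissible_form(1)[OF x\<Omega> skJ] hess)+
    moreover have "u_speed x (s + k) - u_speed x s + \<Lambda> * \<eta> s * (q x)\<^sup>2 \<le> 0"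
    proof (rule deriv_nonpos_at_right_endpoint_minimum)
      have seg: "{0..s} \<subseteq> J" by (rule time_interval_segment[OF sJ])
      have "b + k \<in> J" if "b \<in> {0..s}" for b using kt(2)[of b] that s by simp
      hence img: "(\<lambda>b. b + k) ` {0..s} \<subseteq> J" by (rule image_subsetI)
      have later: "((\<lambda>b. u x (b + k)) has_real_derivative u_speed x (s + k) * 1) (at s within {0..s})"
      proof -
        have shift: "((\<lambda>b. b + k) has_real_derivative 1) (at s within {0..s})"
          by (auto intro!: derivative_eq_intros)
        have "(u x has_real_derivative u_speed x (s + k)) (at (s + k) within (\<lambda>b. b + k) ` {0..s})"
          by (rule DERIV_subset[OF u_time_derivative[OF x\<Omega> skJ] img])
        from DERIV_image_chain[OF this shift] show ?thesis by (simp add: o_def)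
      qed
      have now: "(u x has_real_derivative u_speed x s) (at s within {0..s})"
        by (rule DERIV_subset[OF u_time_derivative[OF x\<Omega> sJ] seg])
      have bar: "((\<lambda>b. \<eta> b * (q x)\<^sup>2) has_real_derivative - \<Lambda> * \<eta> s * (q x)\<^sup>2) (at s within {0..s})"
        unfolding \<eta>_def by (auto intro!: derivative_eq_intros)
      show "((\<lambda>b. u x (b + k) - u x b - \<eta> b * (q x)\<^sup>2) has_real_derivative
          u_speed x (s + k) - u_speed x s + \<Lambda> * \<eta> s * (q x)\<^sup>2) (at s within {0..s})"
        by (rule DERIV_cong[OF DERIV_diff[OF DERIV_diff[OF later now] bar]]) simp
      show "0 < s" using s \<open>s \<noteq> 0\<close> by simp
      show "u x (s + k) - u x s - \<eta> s * (q x)\<^sup>2 \<le> u x (b + k) - u x b - \<eta> b * (q x)\<^sup>2"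
        if "0 \<le> b" "b \<le> s" for b
        using min[OF x that(1)] that s by simp
    qed simp
    ultimately have "\<eta> s * (c * (\<xi> \<bullet> \<xi>) - C * q x + \<Lambda> * (q x)\<^sup>2) \<le> 0"
      by (simp add: algebra_simps)
    moreover have "0 < c * (\<xi> \<bullet> \<xi>) - C * q x + \<Lambda> * (q x)\<^sup>2"
      using barrier_quadratic_positive[OF gain(2,1) r(1), of "q x"] \<xi>q
      by (simp add: \<Lambda>_def eq_diff_eq[symmetric])
    ultimately show False using \<eta>[of s] by (simp add: mult_le_0_iff)
  qed
  define \<kappa> where "\<kappa> = \<delta> * exp (- \<Lambda> * t0) * (q x0)\<^sup>2"
  have \<kappa>: "0 < \<kappa>" using \<delta> r by (simp add: \<kappa>_def q_def)
  show ?thesis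
  proof (rule ccontr)
    assume "\<not> 0 < u_speed x0 t0"
    hence "u_speed x0 t0 - \<kappa> < 0" using \<kappa> by simp
    moreover have "((\<lambda>t. u x0 t - \<kappa> * t) has_real_derivative u_speed x0 t0 - \<kappa>) (at t0 within J)"
      using u_time_derivative[OF x0 t0J] by (auto intro!: derivative_eq_intros)
    ultimately obtain e where e: "0 < e"
      "\<And>k. 0 < k \<Longrightarrow> t0 + k \<in> J \<Longrightarrow> k < e \<Longrightarrow> u x0 (t0 + k) - \<kappa> * (t0 + k) < u x0 t0 - \<kappa> * t0"
      using has_real_derivative_neg_dec_right by blast
    define k where "k = min e h1 / 2"
    have k: "0 < k" "k < e" "k < h1" using e(1) h1 by (auto simp: k_def)
    have "t0 + k \<in> J" using k sub t0 by (auto simp: h1_def)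
    from e(2)[OF k(1) this k(2)] barrier[OF k(1,3)] show False
      by (simp add: \<kappa>_def algebra_simps)
  qed
qed

end

theorem theorem1p6:
  fixes f :: "real ^ 'n \<Rightarrow> real"
    and \<Omega> :: "(real ^ 'n) set"
    and u0 :: "real ^ 'n \<Rightarrow> real"
    and u :: "real ^ 'n \<Rightarrow> real \<Rightarrow> real"
    and \<sigma> \<epsilon> :: real
    and T :: ereal
  assumes "curvature_function f"
    and "bounded_smooth_domain \<Omega>"
    and "0 < \<sigma>" and "\<sigma> < 1"
    and "0 < \<epsilon>" and "0 < T"
    and "initial_graph \<Omega> u0"
    and "flow_solution f \<sigma> \<Omega> T u0 \<epsilon> u"
    and "admissible \<Omega> T u"
    and "\<forall>x\<in>\<Omega>. f (principal_curvatures (\<lambda>y. u0 y + \<epsilon>) x) > \<sigma>"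
  shows "\<forall>t\<in>time_interval T. \<forall>x\<in>\<Omega>. f (principal_curvatures (\<lambda>y. u y t) x) > \<sigma>"
proof -
  interpret hyperbolic_graph_flow f \<Omega> u0 u \<sigma> \<epsilon> T
    by unfold_locales (use assms in auto)
  show ?thesis using u_speed_pos u_speed_pos_iff by blast
qed

end
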